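(* Let $p>1/3$ and $\tilde u\in\mathbb{R}$, and let the far field states satisfy $u_-=u_+=\tilde u$. Assume $f\in C^3(\mathbb{R})$ and $\sigma\in C^2(\mathbb{R})$ with $$\sigma(0)=0,\qquad \sigma'(v)>0\ (v\in\mathbb{R}),\qquad |\sigma(v)|\sim|v|^p,\quad |\sigma'(v)|\sim|v|^{p-1}\quad(|v|\to\infty),$$ $u_0-\tilde u\in H^2$, and further $u_0-\tilde u\in L^1$. Then the unique global in time solution $u$ of the Cauchy problem $$\partial_t u+\partial_x\big(f(u)-\sigma(\partial_x u)\big)=0\ \ (t>0,\ x\in\mathbb{R}),\qquad u(0,x)=u_0(x)\to\tilde u\ \ (x\to\pm\infty)$$ satisfies, for every $q\in(1,\infty)$ and every $\epsilon>0$, $$\|u(t)-\tilde u\|_{L^1}\le C_{u_0}\max\{1,\ln(1+t)\}\quad(t\ge0),$$ $$\|u(t)-\tilde u\|_{L^q}\le C_{u_0}(1+t)^{-\frac12\left(1-\frac1q\right)}\max\{1,\ln(1+t)\}\quad(t\ge0),$$ $$\|u(t)-\tilde u\|_{L^\infty}\le C_{u_0,\epsilon}(1+t)^{-\frac12+\epsilon}\quad(t\ge0).$$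
   Context: $L^q=L^q(\mathbb{R})$ and $H^k=H^k(\mathbb{R})$ are the usual Lebesgue and $L^2$-based Sobolev spaces in $x$. The notation $g(v)\sim h(v)$ as $|v|\to\infty$ means that there is a constant $C\ge1$ with $C^{-1}h(v)\le g(v)\le C\,h(v)$ for all sufficiently large $|v|$. The unique global in time solution is the one in the class $u-\tilde u\in C^0\cap L^\infty([0,\infty);H^2)$, $\partial_x u\in L^2(0,\infty;H^2)$, $\partial_t u\in C^0\cap L^\infty([0,\infty);L^2)\cap L^2(0,\infty;H^1)$. $C_{\alpha,\beta,\dots}$ denotes a generic positive constant independent of $t$, the subscripts emphasizing dependence; such constants may also depend on the fixed data ($f,\sigma,p,\tilde u$) and on the exponent $q$. *)

theory Defs
  imports "HOL-Analysis.Analysis" "HOL-Probability.Essential_Supremum"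
begin

definition Ck :: "nat \<Rightarrow> (real \<Rightarrow> real) \<Rightarrow> bool" where
  "Ck k f \<longleftrightarrow> (\<forall>j<k. \<forall>x. (deriv ^^ j) f differentiable at x) \<and> continuous_on UNIV ((deriv ^^ k) f)"

definition same_order :: "(real \<Rightarrow> real) \<Rightarrow> (real \<Rightarrow> real) \<Rightarrow> bool" where
  "same_order g h \<longleftrightarrow>
     (\<exists>C\<ge>1. \<exists>R. \<forall>v. \<bar>v\<bar> \<ge> R \<longrightarrow> h v / C \<le> g v \<and> g v \<le> C * h v)"

text \<open>Elements of Lebesgue and Sobolev spaces on the line are represented by Borel functions,
  to be understood up to equality almost everywhere. The real number \<open>Lp_norm q f\<close> is meaningful
  only for \<open>f\<close> in the space, so bounds on it have to be accompanied by \<open>in_Lp q f\<close>.\<close>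

definition in_Lp :: "real \<Rightarrow> (real \<Rightarrow> real) \<Rightarrow> bool" where
  "in_Lp q f \<longleftrightarrow> f \<in> borel_measurable lborel \<and> integrable lborel (\<lambda>x. \<bar>f x\<bar> powr q)"

definition Lp_norm :: "real \<Rightarrow> (real \<Rightarrow> real) \<Rightarrow> real" where
  "Lp_norm q f = (LINT x|lborel. \<bar>f x\<bar> powr q) powr (1 / q)"

definition Linf_norm :: "(real \<Rightarrow> real) \<Rightarrow> ereal" where
  "Linf_norm f = esssup lborel (\<lambda>x. ereal \<bar>f x\<bar>)"

definition test_function :: "(real \<Rightarrow> real) \<Rightarrow> bool" where
  "test_function \<phi> \<longleftrightarrow> (\<forall>k. Ck k \<phi>) \<and> (\<exists>R. \<forall>x. \<bar>x\<bar> > R \<longrightarrow> \<phi> x = 0)"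

definition loc_integrable :: "(real \<Rightarrow> real) \<Rightarrow> bool" where
  "loc_integrable f \<longleftrightarrow> (\<forall>a b. set_integrable lborel {a..b} f)"

definition weak_deriv :: "nat \<Rightarrow> (real \<Rightarrow> real) \<Rightarrow> (real \<Rightarrow> real) \<Rightarrow> bool" where
  "weak_deriv j f g \<longleftrightarrow> loc_integrable f \<and> loc_integrable g \<and>
     (\<forall>\<phi>. test_function \<phi> \<longrightarrow>
        (LINT x|lborel. f x * (deriv ^^ j) \<phi> x) = (- 1) ^ j * (LINT x|lborel. g x * \<phi> x))"

text \<open>A weak derivative is determined up to a null set; \<open>wderiv j f\<close> is some representative of it
  (and is arbitrary if \<open>f\<close> has no weak derivative of order \<open>j\<close>).\<close>

definition wderiv :: "nat \<Rightarrow> (real \<Rightarrow> real) \<Rightarrow> real \<Rightarrow> real" where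
  "wderiv j f = (SOME g. weak_deriv j f g)"

text \<open>The space \<open>H\<^sup>k\<close>; for \<open>k = 0\<close> it is \<open>L\<^sup>2\<close>, since \<open>f\<close> is its own weak derivative of order 0.\<close>

definition in_Hk :: "nat \<Rightarrow> (real \<Rightarrow> real) \<Rightarrow> bool" where
  "in_Hk k f \<longleftrightarrow> (\<forall>j\<le>k. \<exists>g. weak_deriv j f g \<and> in_Lp 2 g)"

definition Hk_norm :: "nat \<Rightarrow> (real \<Rightarrow> real) \<Rightarrow> real" where
  "Hk_norm k f = sqrt (\<Sum>j\<le>k. (Lp_norm 2 (wderiv j f))\<^sup>2)"

text \<open>Functions of time with values in \<open>H\<^sup>k\<close>, written \<open>v t x\<close>; their values for \<open>t < 0\<close> are
  irrelevant. As \<open>H\<^sup>k\<close> is not a type, strong (Bochner) measurability is spelled out as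
  almost everywhere approximability by simple functions.\<close>

definition C0_time :: "nat \<Rightarrow> (real \<Rightarrow> real \<Rightarrow> real) \<Rightarrow> bool" where
  "C0_time k v \<longleftrightarrow> (\<forall>t\<ge>0. in_Hk k (v t) \<and>
     ((\<lambda>s. Hk_norm k (\<lambda>x. v s x - v t x)) \<longlongrightarrow> 0) (at t within {0..}))"

definition simple_time :: "nat \<Rightarrow> (real \<Rightarrow> real \<Rightarrow> real) \<Rightarrow> bool" where
  "simple_time k s \<longleftrightarrow> (\<exists>(m::nat) A g. (\<forall>i<m. A i \<in> sets borel \<and> in_Hk k (g i)) \<and>
     s = (\<lambda>t x. \<Sum>i<m. indicator (A i) t * g i x))"

definition strongly_measurable_time :: "nat \<Rightarrow> (real \<Rightarrow> real \<Rightarrow> real) \<Rightarrow> bool" where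
  "strongly_measurable_time k v \<longleftrightarrow> (\<exists>s. (\<forall>n. simple_time k (s n)) \<and>
     (AE t in lborel. t > 0 \<longrightarrow> in_Hk k (v t) \<and>
        (\<lambda>n. Hk_norm k (\<lambda>x. s n t x - v t x)) \<longlonglongrightarrow> 0))"

definition Linf_time :: "nat \<Rightarrow> (real \<Rightarrow> real \<Rightarrow> real) \<Rightarrow> bool" where
  "Linf_time k v \<longleftrightarrow> strongly_measurable_time k v \<and>
     (\<exists>M. AE t in lborel. t > 0 \<longrightarrow> Hk_norm k (v t) \<le> M)"

definition L2_time :: "nat \<Rightarrow> (real \<Rightarrow> real \<Rightarrow> real) \<Rightarrow> bool" where
  "L2_time k v \<longleftrightarrow> strongly_measurable_time k v \<and>
     set_integrable lborel {0<..} (\<lambda>t. (Hk_norm k (v t))\<^sup>2)"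

text \<open>\<open>w\<close> is the time derivative of \<open>u\<close>, as the limit of difference quotients in \<open>L\<^sup>2\<close>
  (one-sided at \<open>t = 0\<close>).\<close>

definition time_deriv :: "(real \<Rightarrow> real \<Rightarrow> real) \<Rightarrow> (real \<Rightarrow> real \<Rightarrow> real) \<Rightarrow> bool" where
  "time_deriv u w \<longleftrightarrow> (\<forall>t\<ge>0.
     ((\<lambda>s. Hk_norm 0 (\<lambda>x. (u s x - u t x) / (s - t) - w t x)) \<longlongrightarrow> 0) (at t within {0..}))"

definition solution_class ::
  "real \<Rightarrow> (real \<Rightarrow> real \<Rightarrow> real) \<Rightarrow> (real \<Rightarrow> real \<Rightarrow> real) \<Rightarrow> bool" where
  "solution_class c u ut \<longleftrightarrow>
     C0_time 2 (\<lambda>t x. u t x - c) \<and> Linf_time 2 (\<lambda>t x. u t x - c) \<and>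
     L2_time 2 (\<lambda>t. wderiv 1 (u t)) \<and>
     C0_time 0 ut \<and> Linf_time 0 ut \<and> L2_time 1 ut"

text \<open>The equation is stated as: for every \<open>t > 0\<close>, the weak \<open>x\<close>-derivative of the flux
  \<open>f(u) - \<sigma>(\<partial>\<^sub>x u)\<close> is \<open>- \<partial>\<^sub>t u\<close>. The initial datum is attained almost everywhere.
  The pointwise far field condition on \<open>u0\<close> selects a suitable representative; in the situation
  \<open>in_Hk 2 (\<lambda>x. u0 x - c)\<close> the continuous one satisfies it.\<close>

definition cauchy_problem ::
  "(real \<Rightarrow> real) \<Rightarrow> (real \<Rightarrow> real) \<Rightarrow> real \<Rightarrow> (real \<Rightarrow> real) \<Rightarrow>
   (real \<Rightarrow> real \<Rightarrow> real) \<Rightarrow> (real \<Rightarrow> real \<Rightarrow> real) \<Rightarrow> bool" where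
  "cauchy_problem f \<sigma> c u0 u ut \<longleftrightarrow>
     (\<forall>t>0. weak_deriv 1 (\<lambda>x. f (u t x) - \<sigma> (wderiv 1 (u t) x)) (\<lambda>x. - ut t x)) \<and>
     (AE x in lborel. u 0 x = u0 x) \<and>
     (u0 \<longlongrightarrow> c) at_top \<and> (u0 \<longlongrightarrow> c) at_bot"

definition global_solution ::
  "(real \<Rightarrow> real) \<Rightarrow> (real \<Rightarrow> real) \<Rightarrow> real \<Rightarrow> (real \<Rightarrow> real) \<Rightarrow> (real \<Rightarrow> real \<Rightarrow> real) \<Rightarrow> bool" where
  "global_solution f \<sigma> c u0 u \<longleftrightarrow>
     (\<exists>ut. time_deriv u ut \<and> solution_class c u ut \<and> cauchy_problem f \<sigma> c u0 u ut)"

end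

theory Submission
  imports Defs "HOL-Computational_Algebra.Polynomial"
begin

text \<open>
  Put \<open>w = u - c\<close>. Membership in the solution class bounds \<open>w\<close>, \<open>\<partial>\<^sub>x w\<close> and the \<open>L\<^sup>2\<close> norm of \<open>\<partial>\<^sub>x w\<close>
  uniformly in time, by the Sobolev inequality. On the resulting bounded range of \<open>\<partial>\<^sub>x w\<close> the continuous
  function \<open>\<sigma>'\<close> has a positive minimum \<open>m\<close>, so the equation is uniformly parabolic along a given
  solution. The bounds and \<open>m\<close> depend on the solution, but by a Gronwall argument in \<open>L\<^sup>2\<close>
  (\<open>classical_solution_unique\<close>) there is only one solution for given data, so the constants may be
  chosen from the data.

  For a convex \<open>\<Phi>\<close> with \<open>\<Phi> 0 = \<Phi>' 0 = 0\<close>, testing the equation with \<open>\<Phi>' w\<close> gives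
  \<open>d/dt \<integral> \<Phi> w = - \<integral> \<Phi>'' w \<partial>\<^sub>x w \<sigma>(\<partial>\<^sub>x w) \<le> - m \<integral> \<Phi>'' w (\<partial>\<^sub>x w)\<^sup>2\<close>; the convective term drops out because
  it is an exact derivative (\<open>entropy_dissipation\<close>, \<open>convection_conservative\<close>). With smooth
  approximations of \<open>\<bar>w\<bar>\<close> as \<open>\<Phi>\<close> this shows that the \<open>L\<^sup>1\<close> norm does not increase
  (\<open>L1_contraction\<close>). With \<open>\<Phi> w = w\<^bsup>2 n\<^esup>\<close> the dissipation is a multiple of \<open>\<integral> (\<partial>\<^sub>x (w\<^sup>n))\<^sup>2\<close>, and Nash's
  inequality bounds it from below by the cube of \<open>\<integral> w\<^bsup>2 n\<^esup>\<close> over the fourth power of \<open>\<integral> \<bar>w\<bar>\<^sup>n\<close>. So the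
  heat-kernel rate for the moment of order \<open>n\<close> implies that of order \<open>2 n\<close> (\<open>moment_decay_double\<close>),
  and starting from \<open>L\<^sup>1\<close> all moments of order \<open>2\<^sup>k\<close> decay at that rate.

  The remaining exponents follow by interpolation (\<open>Lq_decay\<close>). For the supremum, integrating the
  derivative of \<open>w\<^bsup>n + 1\<^esup>\<close> and using only the boundedness of \<open>\<partial>\<^sub>x w\<close> in \<open>L\<^sup>2\<close> gives the rate
  \<open>(2 n - 1) / (4 (n + 1))\<close>, which tends to \<open>1 / 2\<close> (\<open>sup_decay\<close>).

  The equation and the Sobolev spaces are given in terms of weak derivatives. The du Bois-Reymond
  lemma turns a function with a locally integrable weak derivative into a primitive of it, and for
  such primitives the product rule holds by Fubini's theorem; this is all the calculus that the
  energy identities need.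
\<close>

section \<open>Smooth functions and test functions\<close>

lemma Ck_0: "Ck 0 f \<longleftrightarrow> continuous_on UNIV f"
  by (simp add: Ck_def)

lemma Ck_Suc: "Ck (Suc k) f \<longleftrightarrow> (\<forall>x. f differentiable at x) \<and> Ck k (deriv f)"
proof -
  have "(\<forall>j<Suc k. \<forall>x. (deriv ^^ j) f differentiable at x)
      \<longleftrightarrow> (\<forall>x. f differentiable at x) \<and> (\<forall>j<k. \<forall>x. (deriv ^^ j) (deriv f) differentiable at x)"
    unfolding All_less_Suc2 by (simp add: funpow_swap1)
  then show ?thesis
    unfolding Ck_def by (simp add: funpow_swap1)
qed

lemma Ck_SucI:
  assumes "\<And>x. (f has_real_derivative f' x) (at x)" and "Ck k f'"
  shows "Ck (Suc k) f"
proof -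
  have "deriv f = f'" using assms(1) by (auto intro!: DERIV_imp_deriv)
  with assms show ?thesis
    by (auto simp: Ck_Suc intro: differentiableI[OF has_field_derivative_imp_has_derivative])
qed

lemma Ck_Suc_DERIV: "Ck (Suc k) f \<Longrightarrow> (f has_real_derivative deriv f x) (at x)"
  by (simp add: Ck_Suc DERIV_deriv_iff_real_differentiable)

lemma Ck_Suc_imp_Ck: "Ck (Suc k) f \<Longrightarrow> Ck k f"
proof (induction k arbitrary: f)
  case 0
  then show ?case
    by (auto simp: Ck_Suc Ck_0 intro!: differentiable_imp_continuous_on differentiable_at_imp_differentiable_on)
next
  case (Suc k)
  then show ?case by (metis Ck_Suc)
qed

lemma Ck_const: "Ck k (\<lambda>_. c)"
  by (induction k arbitrary: c) (auto simp: Ck_0 intro: Ck_SucI derivative_eq_intros)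

lemma Ck_add: "Ck k f \<Longrightarrow> Ck k g \<Longrightarrow> Ck k (\<lambda>x. f x + g x)"
proof (induction k arbitrary: f g)
  case 0 then show ?case by (auto simp: Ck_0 intro: continuous_intros)
next
  case (Suc k)
  then show ?case
    by (intro Ck_SucI[where f' = "\<lambda>x. deriv f x + deriv g x"])
       (auto simp: Ck_Suc intro!: derivative_intros simp: DERIV_deriv_iff_real_differentiable)
qed

lemma Ck_mult: "Ck k f \<Longrightarrow> Ck k g \<Longrightarrow> Ck k (\<lambda>x. f x * g x)"
proof (induction k arbitrary: f g)
  case 0 then show ?case by (auto simp: Ck_0 intro: continuous_intros)
next
  case (Suc k)
  then have "Ck k f" "Ck k g" by (auto dest: Ck_Suc_imp_Ck)
  with Suc show ?case
    by (intro Ck_SucI[where f' = "\<lambda>x. deriv f x * g x + deriv g x * f x"])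
       (auto simp: Ck_Suc intro!: derivative_intros Ck_add simp: DERIV_deriv_iff_real_differentiable)
qed

lemma Ck_affine: "Ck k f \<Longrightarrow> Ck k (\<lambda>x. f (r * x + s))"
proof (induction k arbitrary: f)
  case 0
  then have "continuous_on UNIV (f \<circ> (\<lambda>x. r * x + s))"
    by (intro continuous_on_compose) (auto simp: Ck_0 intro: continuous_intros continuous_on_subset)
  then show ?case by (simp add: Ck_0 o_def)
next
  case (Suc k)
  have "((\<lambda>x. f (r * x + s)) has_real_derivative deriv f (r * x + s) * r) (at x)" for x
    by (rule DERIV_chain2[OF Ck_Suc_DERIV[OF Suc.prems]]) (auto intro!: derivative_eq_intros)
  moreover have "Ck k (\<lambda>x. deriv f (r * x + s) * r)"
    using Suc by (intro Ck_mult Ck_const) (auto simp: Ck_Suc)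
  ultimately show ?case by (rule Ck_SucI)
qed

lemma poly_div_exp_at_top: "((\<lambda>y. poly p y / exp y) \<longlongrightarrow> (0::real)) at_top"
proof -
  have "((\<lambda>y. \<Sum>i\<le>degree p. coeff p i * (y ^ i / exp y)) \<longlongrightarrow> (\<Sum>i\<le>degree p. coeff p i * 0)) at_top"
    by (intro tendsto_intros tendsto_power_div_exp_0)
  then show ?thesis by (simp add: poly_altdef sum_divide_distrib)
qed

text \<open>The usual building block of bump functions, with a polynomial factor that makes the family
  closed under differentiation.\<close>

definition flat :: "real poly \<Rightarrow> real \<Rightarrow> real" where
  "flat p x = (if x \<le> 0 then 0 else poly p (1 / x) * exp (- 1 / x))"

lemma flat_tendsto_0: "(flat p \<longlongrightarrow> 0) (at 0)"
proof -
  have "((\<lambda>x. poly p (inverse x) / exp (inverse x)) \<longlongrightarrow> (0::real)) (at_right 0)"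
    using poly_div_exp_at_top filterlim_inverse_at_top_right by (rule filterlim_compose)
  moreover have "eventually (\<lambda>x. poly p (inverse x) / exp (inverse x) = flat p x) (at_right (0::real))"
    by (auto simp: eventually_at_filter flat_def exp_minus divide_simps inverse_eq_divide)
  ultimately have r: "(flat p \<longlongrightarrow> 0) (at_right 0)" by (rule Lim_transform_eventually)
  have "eventually (\<lambda>x. 0 = flat p x) (at_left (0::real))"
    by (auto simp: eventually_at_filter flat_def)
  then have l: "(flat p \<longlongrightarrow> 0) (at_left 0)" by (rule Lim_transform_eventually[OF tendsto_const])
  from l r show ?thesis by (simp add: filterlim_at_split)
qed

text \<open>Differentiating produces a factor \<open>1 / x\<^sup>2\<close>, which is absorbed by the polynomial; so the
  functions \<open>p (1 / x) exp (- 1 / x)\<close> are closed under differentiation, also at the origin.\<close>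

lemma flat_DERIV: "(flat p has_real_derivative flat ([:0, 0, 1:] * (p - pderiv p)) x) (at x)"
proof -
  let ?q = "[:0, 0, 1:] * (p - pderiv p)"
  consider "x < 0" | "x = 0" | "x > 0" by linarith
  then show ?thesis
  proof cases
    case 1
    have "((\<lambda>_. 0) has_real_derivative 0) (at x)" by simp
    then have "(flat p has_real_derivative 0) (at x)"
      by (rule has_field_derivative_transform_within_open[where S = "{..<0}"])
         (use 1 in \<open>auto simp: flat_def\<close>)
    with 1 show ?thesis by (simp add: flat_def)
  next
    case 2
    have "eventually (\<lambda>h. flat ([:0, 1:] * p) h = (flat p (0 + h) - flat p 0) / h) (at (0::real))"
      by (auto simp: eventually_at_filter flat_def divide_simps)
    then have "((\<lambda>h. (flat p (0 + h) - flat p 0) / h) \<longlongrightarrow> 0) (at 0)"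
      by (rule Lim_transform_eventually[OF flat_tendsto_0])
    then show ?thesis using 2 by (simp add: DERIV_def flat_def)
  next
    case 3
    have "((\<lambda>x. poly p (1 / x) * exp (- 1 / x)) has_real_derivative
        (poly (pderiv p) (1 / x) * (- 1 / x ^ 2)) * exp (- 1 / x)
        + poly p (1 / x) * (exp (- 1 / x) * (1 / x ^ 2))) (at x)"
      using 3 by (auto intro!: derivative_eq_intros poly_DERIV[THEN DERIV_chain2] simp: power2_eq_square)
    moreover have "(poly (pderiv p) (1 / x) * (- 1 / x ^ 2)) * exp (- 1 / x)
        + poly p (1 / x) * (exp (- 1 / x) * (1 / x ^ 2)) = flat ?q x"
      using 3 by (simp add: flat_def power2_eq_square field_simps)
    ultimately have "((\<lambda>x. poly p (1 / x) * exp (- 1 / x)) has_real_derivative flat ?q x) (at x)"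
      by metis
    then show ?thesis
      by (rule has_field_derivative_transform_within_open[where S = "{0<..}"])
         (use 3 in \<open>auto simp: flat_def\<close>)
  qed
qed

lemma Ck_flat: "Ck k (flat p)"
proof (induction k arbitrary: p)
  case 0
  then show ?case
    by (auto simp: Ck_0 continuous_on_eq_continuous_at intro: DERIV_isCont[OF flat_DERIV])
next
  case (Suc k)
  then show ?case by (intro Ck_SucI[OF flat_DERIV])
qed

text \<open>A smooth approximation from below of the indicator of the open interval.\<close>

definition plateau :: "nat \<Rightarrow> real \<Rightarrow> real \<Rightarrow> real \<Rightarrow> real" where
  "plateau n a b x = flat 1 (real n * (x - a)) * flat 1 (real n * (b - x))"

lemma flat_1_bounds: "0 \<le> flat 1 x" "flat 1 x \<le> 1"
  by (auto simp: flat_def)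

lemma plateau_bounds: "0 \<le> plateau n a b x" "plateau n a b x \<le> 1"
  using flat_1_bounds by (auto simp: plateau_def intro!: mult_le_one)

lemma plateau_outside: "x \<notin> {a<..<b} \<Longrightarrow> plateau n a b x = 0"
  by (auto simp: plateau_def flat_def mult_nonneg_nonpos)

lemma test_function_plateau: "test_function (plateau n a b)"
proof -
  have "Ck k (\<lambda>x. flat 1 (real n * x + - (real n * a)) * flat 1 ((- real n) * x + real n * b))" for k
    by (intro Ck_mult Ck_affine Ck_flat)
  then have "Ck k (plateau n a b)" for k
    by (simp add: plateau_def[abs_def] algebra_simps)
  moreover have "plateau n a b x = 0" if "\<bar>x\<bar> > \<bar>a\<bar> + \<bar>b\<bar>" for x
    using that by (intro plateau_outside) auto
  ultimately show ?thesis by (auto simp: test_function_def)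
qed

lemma flat_1_scaled_tendsto: "x > 0 \<Longrightarrow> (\<lambda>n. flat 1 (real n * x)) \<longlonglongrightarrow> 1"
proof -
  assume x: "x > 0"
  have "(\<lambda>n. exp (- (1 / x) * (1 / real n))) \<longlonglongrightarrow> exp (- (1 / x) * 0)"
    by (intro tendsto_intros lim_1_over_n)
  then have "(\<lambda>n. exp (- (1 / x) * (1 / real n))) \<longlonglongrightarrow> 1" by simp
  moreover have "eventually (\<lambda>n. exp (- (1 / x) * (1 / real n)) = flat 1 (real n * x)) sequentially"
    using eventually_ge_at_top[of 1] by eventually_elim (use x in \<open>auto simp: flat_def field_simps mult_le_0_iff\<close>)
  ultimately show ?thesis by (rule Lim_transform_eventually)
qed

lemma plateau_tendsto: "(\<lambda>n. plateau n a b x) \<longlonglongrightarrow> indicator {a<..<b} x"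
proof (cases "x \<in> {a<..<b}")
  case True
  then have "(\<lambda>n. plateau n a b x) \<longlonglongrightarrow> 1 * 1"
    unfolding plateau_def by (intro tendsto_mult flat_1_scaled_tendsto) auto
  with True show ?thesis by simp
qed (simp add: plateau_outside)

lemma test_function_continuous: "test_function \<phi> \<Longrightarrow> continuous_on UNIV \<phi>"
  using Ck_0 by (auto simp: test_function_def)

lemma test_function_DERIV: "test_function \<phi> \<Longrightarrow> (\<phi> has_real_derivative deriv \<phi> x) (at x)"
  using Ck_Suc_DERIV by (auto simp: test_function_def)

lemma test_function_deriv:
  assumes "test_function \<phi>" shows "test_function (deriv \<phi>)"
proof -
  from assms obtain R where R: "\<And>x. \<bar>x\<bar> > R \<Longrightarrow> \<phi> x = 0" by (auto simp: test_function_def)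
  have "deriv \<phi> x = 0" if "\<bar>x\<bar> > R" for x
  proof -
    have "eventually (\<lambda>y. R < \<bar>y\<bar>) (nhds x)"
      using that by (intro order_tendstoD(1)[where y = "\<bar>x\<bar>"] tendsto_intros filterlim_ident)
    then have "eventually (\<lambda>y. \<phi> y = 0) (nhds x)" by eventually_elim (rule R)
    then have "deriv \<phi> x = deriv (\<lambda>_. 0) x" by (rule deriv_cong_ev) simp
    then show ?thesis by simp
  qed
  moreover have "Ck k (deriv \<phi>)" for k
    using assms Ck_Suc by (auto simp: test_function_def)
  ultimately show ?thesis by (auto simp: test_function_def)
qed

lemma test_function_bounded_support:
  assumes "test_function \<phi>"
  obtains R where "R > 0" "\<And>x. x \<notin> {-R..R} \<Longrightarrow> \<phi> x = 0"
proof -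
  from assms obtain R where R: "\<And>x. \<bar>x\<bar> > R \<Longrightarrow> \<phi> x = 0" by (auto simp: test_function_def)
  show ?thesis by (rule that[of "max 1 R"]) (auto intro!: R)
qed

section \<open>Primitives of locally integrable functions\<close>

text \<open>The positive and the negative part of \<open>h\<close> are densities of measures that agree on all rays,
  hence on all Borel sets.\<close>

lemma AE_zero_if_zero_on_rays:
  fixes h :: "real \<Rightarrow> real"
  assumes h[measurable]: "integrable lborel h"
    and 0: "\<And>x. (LINT y:{x<..}|lborel. h y) = 0"
  shows "AE x in lborel. h x = 0"
proof -
  define P where "P = density lborel (\<lambda>x. ennreal (max 0 (h x)))"
  define N where "N = density lborel (\<lambda>x. ennreal (max 0 (- h x)))"
  have i: "integrable lborel (\<lambda>y. indicator {x<..} y * max 0 (h y))"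
          "integrable lborel (\<lambda>y. indicator {x<..} y * max 0 (- h y))" for x
    by (rule Bochner_Integration.integrable_bound[OF h];
        auto split: split_indicator)+
  have P: "emeasure P {x<..} = ennreal (LINT y|lborel. indicator {x<..} y * max 0 (h y))" for x
    unfolding P_def
    by (subst emeasure_density, simp, simp, subst nn_integral_eq_integral[OF i(1), symmetric])
       (auto intro!: nn_integral_cong split: split_indicator)
  have N: "emeasure N {x<..} = ennreal (LINT y|lborel. indicator {x<..} y * max 0 (- h y))" for x
    unfolding N_def
    by (subst emeasure_density, simp, simp, subst nn_integral_eq_integral[OF i(2), symmetric])
       (auto intro!: nn_integral_cong split: split_indicator)
  have eq: "(LINT y|lborel. indicator {x<..} y * max 0 (h y))
      = (LINT y|lborel. indicator {x<..} y * max 0 (- h y))" for x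
  proof -
    have "(LINT y|lborel. indicator {x<..} y * max 0 (h y))
        - (LINT y|lborel. indicator {x<..} y * max 0 (- h y))
        = (LINT y|lborel. indicator {x<..} y * max 0 (h y) - indicator {x<..} y * max 0 (- h y))"
      by (rule Bochner_Integration.integral_diff[OF i, symmetric])
    also have "\<dots> = (LINT y:{x<..}|lborel. h y)"
      unfolding set_lebesgue_integral_def
      by (rule Bochner_Integration.integral_cong) (auto split: split_indicator)
    finally show ?thesis using 0 by simp
  qed
  have "P = N"
    by (rule measure_eqI_lessThan) (auto simp: P N eq, auto simp: P_def N_def)
  then have "AE x in lborel. ennreal (max 0 (h x)) = ennreal (max 0 (- h x))"
    unfolding P_def N_def by (intro sigma_finite_measure.density_unique[OF sigma_finite_lborel]) auto
  then show ?thesis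
  proof eventually_elim
    case (elim x)
    then have "max 0 (h x) = max 0 (- h x)" by (subst (asm) ennreal_inj) auto
    then show ?case by (auto simp: max_def split: if_splits)
  qed
qed

lemma loc_integrable_open_interval:
  "loc_integrable h \<Longrightarrow> set_integrable lborel {a<..<b} h"
  by (rule set_integrable_subset[of lborel "{a..b}"]) (auto simp: loc_integrable_def)

lemma AE_zero_if_zero_on_intervals:
  assumes h: "loc_integrable h"
    and 0: "\<And>a b. a < b \<Longrightarrow> (LINT y:{a<..<b}|lborel. h y) = 0"
  shows "AE x in lborel. h x = 0"
proof -
  have "AE x in lborel. \<forall>n. indicator {- real n<..<real n} x * h x = 0"
  proof (intro AE_all_countable[THEN iffD2] allI AE_zero_if_zero_on_rays)
    fix n
    show "integrable lborel (\<lambda>x. indicator {- real n<..<real n} x * h x)"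
      using loc_integrable_open_interval[OF h] by (simp add: set_integrable_def)
    fix x
    have "(LINT y:{x<..}|lborel. indicator {- real n<..<real n} y * h y)
        = (LINT y:{max x (- real n)<..<real n}|lborel. h y)"
      unfolding set_lebesgue_integral_def
      by (rule Bochner_Integration.integral_cong) (auto split: split_indicator)
    also have "\<dots> = 0"
    proof (cases "max x (- real n) < real n")
      case False
      then have "{max x (- real n)<..<real n} = {}" by auto
      then show ?thesis by (simp add: set_lebesgue_integral_def)
    qed (rule 0)
    finally show "(LINT y:{x<..}|lborel. indicator {- real n<..<real n} y * h y) = 0" .
  qed
  then show ?thesis
  proof eventually_elim
    case (elim x)
    obtain n where "\<bar>x\<bar> < real n" using reals_Archimedean2 by blast
    then have "indicator {- real n<..<real n} x = (1::real)" by (auto simp: indicator_def)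
    with elim[rule_format, of n] show ?case by simp
  qed
qed

lemma loc_integrable_borel: "loc_integrable f \<Longrightarrow> f \<in> borel_measurable borel"
proof -
  assume f: "loc_integrable f"
  show ?thesis
  proof (rule borel_measurable_LIMSEQ_real)
    show "(\<lambda>x. indicator {- real n..real n} x * f x) \<in> borel_measurable borel" for n
      using f unfolding loc_integrable_def set_integrable_def
      by (auto dest!: spec borel_measurable_integrable)
    fix x
    have "eventually (\<lambda>n. \<bar>x\<bar> \<le> real n) sequentially"
      using filterlim_real_sequentially by (simp add: filterlim_at_top)
    then have "eventually (\<lambda>n. f x = indicator {- real n..real n} x * f x) sequentially"
      by eventually_elim (auto simp: indicator_def)
    then show "(\<lambda>n. indicator {- real n..real n} x * f x) \<longlonglongrightarrow> f x"
      by (rule Lim_transform_eventually[OF tendsto_const])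
  qed
qed

lemma loc_integrable_continuous: "continuous_on UNIV f \<Longrightarrow> loc_integrable f"
  unfolding loc_integrable_def
  by (auto intro!: borel_integrable_atLeastAtMost' intro: continuous_on_subset)

lemma loc_integrable_add: "loc_integrable f \<Longrightarrow> loc_integrable g \<Longrightarrow> loc_integrable (\<lambda>x. f x + g x)"
  by (auto simp: loc_integrable_def)

lemma loc_integrable_diff: "loc_integrable f \<Longrightarrow> loc_integrable g \<Longrightarrow> loc_integrable (\<lambda>x. f x - g x)"
  by (auto simp: loc_integrable_def)

lemma continuous_abs_bound:
  fixes g :: "real \<Rightarrow> real"
  assumes "continuous_on UNIV g"
  obtains B where "B > 0" "\<And>x. x \<in> {a..b} \<Longrightarrow> \<bar>g x\<bar> \<le> B"
proof -
  have "bounded (g ` {a..b})"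
    by (intro compact_imp_bounded compact_continuous_image continuous_on_subset[OF assms]) auto
  then show ?thesis using that by (auto simp: bounded_pos)
qed

lemma set_integrable_mult_continuous:
  fixes f g :: "real \<Rightarrow> real"
  assumes f: "loc_integrable f" and g: "continuous_on UNIV g"
  shows "set_integrable lborel {a..b} (\<lambda>x. f x * g x)"
proof -
  obtain B where B: "B > 0" "\<And>x. x \<in> {a..b} \<Longrightarrow> \<bar>g x\<bar> \<le> B"
    using continuous_abs_bound[OF g] by metis
  have [measurable]: "f \<in> borel_measurable borel" "g \<in> borel_measurable borel"
    using f g by (auto intro: loc_integrable_borel borel_measurable_continuous_onI)
  have "set_integrable lborel {a..b} (\<lambda>x. B * f x)"
    using f by (auto simp: loc_integrable_def)
  then show ?thesis
  proof (rule set_integrable_bound)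
    show "set_borel_measurable lborel {a..b} (\<lambda>x. f x * g x)"
      unfolding set_borel_measurable_def by measurable
    show "AE x in lborel. x \<in> {a..b} \<longrightarrow> norm (f x * g x) \<le> norm (B * f x)"
      using B by (intro AE_I2 impI) (simp add: abs_mult mult.commute[of B] mult_left_mono)
  qed
qed

lemma loc_integrable_mult_continuous:
  "loc_integrable f \<Longrightarrow> continuous_on UNIV g \<Longrightarrow> loc_integrable (\<lambda>x. f x * g x)"
  unfolding loc_integrable_def using set_integrable_mult_continuous[of f g]
  by (auto simp: loc_integrable_def)

lemma integrable_bounded_support:
  assumes "loc_integrable h" "\<And>x. x \<notin> {a..b} \<Longrightarrow> h x = 0"
  shows "integrable lborel h" "(LINT x|lborel. h x) = (LINT x:{a..b}|lborel. h x)"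
proof -
  have eq: "h = (\<lambda>x. indicator {a..b} x *\<^sub>R h x)"
    using assms(2) by (auto split: split_indicator)
  show "integrable lborel h"
    using assms(1) by (subst eq) (auto simp: loc_integrable_def set_integrable_def)
  show "(LINT x|lborel. h x) = (LINT x:{a..b}|lborel. h x)"
    unfolding set_lebesgue_integral_def by (subst eq) simp
qed

lemma loc_integrable_mult_test:
  "loc_integrable h \<Longrightarrow> test_function \<phi> \<Longrightarrow> integrable lborel (\<lambda>x. h x * \<phi> x)"
  by (rule test_function_bounded_support, assumption, rule integrable_bounded_support(1))
     (auto intro: loc_integrable_mult_continuous test_function_continuous)

text \<open>The plateau functions turn an identity tested with smooth functions into one tested with
  intervals.\<close>

lemma AE_zero_if_orthogonal_to_tests:
  assumes h: "loc_integrable h"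
    and 0: "\<And>\<phi>. test_function \<phi> \<Longrightarrow> (LINT x|lborel. h x * \<phi> x) = 0"
  shows "AE x in lborel. h x = 0"
proof (rule AE_zero_if_zero_on_intervals[OF h])
  fix a b :: real assume "a < b"
  have hm[measurable]: "h \<in> borel_measurable borel" using h by (rule loc_integrable_borel)
  have [measurable]: "plateau n a b \<in> borel_measurable borel" for n
    by (intro borel_measurable_continuous_onI test_function_continuous test_function_plateau)
  have "(\<lambda>n. LINT x|lborel. h x * plateau n a b x) \<longlonglongrightarrow> (LINT x|lborel. h x * indicator {a<..<b} x)"
  proof (rule integral_dominated_convergence[where w = "\<lambda>x. \<bar>indicator {a<..<b} x * h x\<bar>"])
    show "integrable lborel (\<lambda>x. \<bar>indicator {a<..<b} x * h x\<bar>)"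
      using loc_integrable_open_interval[OF h] by (auto simp: set_integrable_def)
    show "AE x in lborel. (\<lambda>n. h x * plateau n a b x) \<longlonglongrightarrow> h x * indicator {a<..<b} x"
      by (intro AE_I2 tendsto_intros plateau_tendsto)
    show "AE x in lborel. norm (h x * plateau n a b x) \<le> \<bar>indicator {a<..<b} x * h x\<bar>" for n
      using plateau_bounds[of n a b] plateau_outside[of _ a b n]
      by (intro AE_I2) (auto simp: abs_mult mult_left_le split: split_indicator)
  qed auto
  then have "(LINT x|lborel. h x * indicator {a<..<b} x) = 0"
    by (simp add: 0[OF test_function_plateau] LIMSEQ_const_iff)
  then show "(LINT y:{a<..<b}|lborel. h y) = 0"
    by (simp add: set_lebesgue_integral_def mult.commute)
qed

text \<open>\<open>F\<close> is locally absolutely continuous with derivative \<open>f\<close> almost everywhere.\<close>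

definition primitive :: "(real \<Rightarrow> real) \<Rightarrow> (real \<Rightarrow> real) \<Rightarrow> bool" where
  "primitive F f \<longleftrightarrow> loc_integrable f \<and> (\<forall>x y. x \<le> y \<longrightarrow> F y - F x = (LINT s:{x..y}|lborel. f s))"

lemma primitiveD: "primitive F f \<Longrightarrow> x \<le> y \<Longrightarrow> F y - F x = (LINT s:{x..y}|lborel. f s)"
  by (simp add: primitive_def)

lemma primitive_loc_integrable: "primitive F f \<Longrightarrow> loc_integrable f"
  by (simp add: primitive_def)

lemma set_integral_split:
  fixes f :: "real \<Rightarrow> real"
  assumes "loc_integrable f" "a \<le> b" "b \<le> c"
  shows "(LINT s:{a..c}|lborel. f s) = (LINT s:{a..b}|lborel. f s) + (LINT s:{b..c}|lborel. f s)"
proof -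
  have "{a..b} \<union> {b..c} = {a..c}" using assms by auto
  moreover have "AE x in lborel. \<not> (x \<in> {a..b} \<and> x \<in> {b..c})"
    using AE_lborel_singleton[of b] by eventually_elim auto
  then have "(LINT s:{a..b} \<union> {b..c}|lborel. f s)
      = (LINT s:{a..b}|lborel. f s) + (LINT s:{b..c}|lborel. f s)"
    using assms by (intro set_integral_Un_AE) (auto simp: loc_integrable_def)
  ultimately show ?thesis by simp
qed

lemma primitive_exists: "loc_integrable f \<Longrightarrow> \<exists>F. primitive F f"
proof -
  assume f: "loc_integrable f"
  define F where "F x = (if 0 \<le> x then (LINT s:{0..x}|lborel. f s) else - (LINT s:{x..0}|lborel. f s))" for x
  have "F y - F x = (LINT s:{x..y}|lborel. f s)" if "x \<le> y" for x y
    using set_integral_split[OF f, of x 0 y] set_integral_split[OF f, of 0 x y]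
      set_integral_split[OF f, of x y 0] that
    by (auto simp: F_def)
  with f show ?thesis unfolding primitive_def by blast
qed

lemma primitive_continuous:
  assumes "primitive F f" shows "continuous_on UNIV F"
proof -
  have "continuous_on {-r<..<r} F" for r
  proof -
    have f: "set_integrable lborel {-r..x} f" for x
      using assms by (auto simp: primitive_def loc_integrable_def)
    have "continuous_on {-r..r} (\<lambda>x. integral {-r..x} f)"
      by (intro indefinite_integral_continuous_1 set_borel_integral_eq_integral f)
    then have "continuous_on {-r..r} (\<lambda>x. F (-r) + integral {-r..x} f)"
      by (intro continuous_intros)
    moreover have "F (-r) + integral {-r..x} f = F x" if "x \<in> {-r..r}" for x
      using that set_borel_integral_eq_integral(2)[OF f, of x] primitiveD[OF assms, of "-r" x]
      by auto
    ultimately have "continuous_on {-r..r} F" by (rule continuous_on_eq)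
    then show ?thesis by (rule continuous_on_subset) auto
  qed
  then have "continuous_on (\<Union>r. {-r<..<r}) F"
    by (intro continuous_on_open_UN) auto
  moreover have "(\<Union>r. {-r<..<r}) = (UNIV::real set)"
  proof -
    have "x \<in> {- (\<bar>x\<bar> + 1)<..<\<bar>x\<bar> + 1}" for x :: real by auto
    then show ?thesis by blast
  qed
  ultimately show ?thesis by simp
qed

lemma primitive_C1:
  assumes "\<And>x. (F has_real_derivative f x) (at x)" "continuous_on UNIV f"
  shows "primitive F f"
  unfolding primitive_def
proof safe
  show "loc_integrable f" using assms by (intro loc_integrable_continuous)
  fix x y :: real assume "x \<le> y"
  then have "integral\<^sup>L lborel (\<lambda>s. indicator {x..y} s *\<^sub>R f s) = F y - F x"
    using assms by (intro integral_FTC_atLeastAtMost)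
      (auto intro: continuous_on_subset has_field_derivative_at_within
        simp: has_real_derivative_iff_has_vector_derivative[symmetric])
  then show "F y - F x = (LINT s:{x..y}|lborel. f s)"
    by (simp add: set_lebesgue_integral_def)
qed

lemma primitive_diff: "primitive F f \<Longrightarrow> primitive G g \<Longrightarrow> primitive (\<lambda>x. F x - G x) (\<lambda>x. f x - g x)"
  unfolding primitive_def loc_integrable_def
  by (auto simp: set_integral_diff) (smt (verit))

lemma primitive_DERIV:
  assumes F: "primitive F f" and f: "continuous_on UNIV f"
  shows "(F has_real_derivative f x) (at x)"
proof -
  have i: "set_integrable lborel {x - 1..y} f" for y
    using F by (auto simp: primitive_def loc_integrable_def)
  have "((\<lambda>y. integral {x - 1..y} f) has_real_derivative f x) (at x within {x - 1..x + 1})"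
    by (rule integral_has_real_derivative) (auto intro: continuous_on_subset[OF f])
  then have "((\<lambda>y. integral {x - 1..y} f) has_real_derivative f x) (at x)"
    by (subst (asm) at_within_interior) auto
  then have "((\<lambda>y. F (x - 1) + integral {x - 1..y} f) has_real_derivative f x) (at x)"
    by (auto intro!: derivative_eq_intros)
  then show ?thesis
  proof (rule has_field_derivative_transform_within_open[where S = "{x - 1<..}"])
    fix y assume "y \<in> {x - 1<..}"
    then show "F (x - 1) + integral {x - 1..y} f = F y"
      using set_borel_integral_eq_integral(2)[OF i, of y] primitiveD[OF F, of "x - 1" y]
      by auto
  qed auto
qed

text \<open>Integrate \<open>f s * g r\<close> over the triangle \<open>x \<le> s \<le> r \<le> y\<close> in both orders.\<close>

lemma primitive_mult_set_integral:
  assumes F: "primitive F f" and G: "primitive G g" and xy: "x \<le> y"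
  shows "F y * G y - F x * G x
      = (LINT s:{x..y}|lborel. f s * G s) + (LINT s:{x..y}|lborel. g s * F s)"
proof -
  define f' where "f' s = indicator {x..y} s * f s" for s
  define g' where "g' s = indicator {x..y} s * g s" for s
  have fi: "set_integrable lborel {a..b} f" and gi: "set_integrable lborel {a..b} g" for a b
    using F G by (auto simp: primitive_def loc_integrable_def)
  have f'[measurable]: "integrable lborel f'" and g'[measurable]: "integrable lborel g'"
    using fi[of x y] gi[of x y] by (simp_all add: f'_def[abs_def] g'_def[abs_def] set_integrable_def)
  have [measurable]: "f' \<in> borel_measurable borel" "g' \<in> borel_measurable borel"
    using f' g' borel_measurable_integrable by force+
  have prod: "integrable (lborel \<Otimes>\<^sub>M lborel) (\<lambda>(s, r). f' s * g' r)"
    by (rule lborel_pair.Fubini_integrable) (use f' g' in \<open>auto simp: abs_mult\<close>)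
  define K where "K s r = (if s \<le> r then f' s * g' r else 0)" for s r
  have "integrable (lborel \<Otimes>\<^sub>M lborel) (case_prod K)"
    by (rule Bochner_Integration.integrable_bound[OF prod])
       (auto simp: K_def abs_mult case_prod_beta')
  then have "(LINT r|lborel. LINT s|lborel. K s r) = (LINT s|lborel. LINT r|lborel. K s r)"
    by (rule lborel_pair.Fubini_integral)
  moreover have "(LINT s|lborel. K s r) = indicator {x..y} r * (g r * (F r - F x))" for r
  proof (cases "r \<in> {x..y}")
    case True
    have "(LINT s|lborel. K s r) = (LINT s|lborel. (indicator {x..r} s * f s) * g r)"
      by (rule Bochner_Integration.integral_cong)
         (use True in \<open>auto simp: K_def f'_def g'_def split: split_indicator\<close>)
    also have "\<dots> = (LINT s:{x..r}|lborel. f s) * g r"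
      by (simp add: set_lebesgue_integral_def)
    finally show ?thesis using True primitiveD[OF F, of x r] by simp
  next
    case False
    then have "K s r = 0" for s by (auto simp: K_def g'_def)
    with False show ?thesis by simp
  qed
  moreover have "(LINT r|lborel. K s r) = indicator {x..y} s * (f s * (G y - G s))" for s
  proof (cases "s \<in> {x..y}")
    case True
    have "(LINT r|lborel. K s r) = (LINT r|lborel. (indicator {s..y} r * g r) * f s)"
      by (rule Bochner_Integration.integral_cong)
         (use True in \<open>auto simp: K_def f'_def g'_def split: split_indicator\<close>)
    also have "\<dots> = (LINT r:{s..y}|lborel. g r) * f s"
      by (simp add: set_lebesgue_integral_def)
    finally show ?thesis using True primitiveD[OF G, of s y] by simp
  next
    case False
    then have "K s r = 0" for r by (auto simp: K_def f'_def)
    with False show ?thesis by simp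
  qed
  ultimately have "(LINT r:{x..y}|lborel. g r * (F r - F x)) = (LINT s:{x..y}|lborel. f s * (G y - G s))"
    by (simp add: set_lebesgue_integral_def)
  moreover have "(LINT r:{x..y}|lborel. g r * (F r - F x))
      = (LINT r:{x..y}|lborel. g r * F r) - (G y - G x) * F x"
    using set_integrable_mult_continuous[OF primitive_loc_integrable[OF G] primitive_continuous[OF F], of x y]
      gi[of x y] primitiveD[OF G xy]
    by (simp add: right_diff_distrib set_integral_diff)
  moreover have "(LINT s:{x..y}|lborel. f s * (G y - G s))
      = (F y - F x) * G y - (LINT s:{x..y}|lborel. f s * G s)"
    using set_integrable_mult_continuous[OF primitive_loc_integrable[OF F] primitive_continuous[OF G], of x y]
      fi[of x y] primitiveD[OF F xy]
    by (simp add: right_diff_distrib set_integral_diff)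
  ultimately show ?thesis by (simp add: algebra_simps)
qed

lemma primitive_mult:
  assumes F: "primitive F f" and G: "primitive G g"
  shows "primitive (\<lambda>x. F x * G x) (\<lambda>x. f x * G x + g x * F x)"
  unfolding primitive_def
proof safe
  note i = loc_integrable_mult_continuous[OF primitive_loc_integrable[OF F] primitive_continuous[OF G]]
    loc_integrable_mult_continuous[OF primitive_loc_integrable[OF G] primitive_continuous[OF F]]
  then show "loc_integrable (\<lambda>x. f x * G x + g x * F x)" by (rule loc_integrable_add)
  fix x y :: real assume "x \<le> y"
  then show "F y * G y - F x * G x = (LINT s:{x..y}|lborel. f s * G s + g s * F s)"
    using primitive_mult_set_integral[OF F G] i by (simp add: loc_integrable_def set_integral_add)
qed

lemma integral_primitive_bounded_support:
  assumes H: "primitive H h" and 0: "\<And>x. x \<notin> {a..b} \<Longrightarrow> H x = 0 \<and> h x = 0"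
  shows "(LINT x|lborel. h x) = 0"
proof (cases "a \<le> b")
  case True
  have "(LINT x|lborel. h x) = (LINT x:{a - 1..b + 1}|lborel. h x)"
    by (rule integrable_bounded_support(2)) (use primitive_loc_integrable[OF H] 0 in auto)
  also have "\<dots> = H (b + 1) - H (a - 1)"
    using True by (intro primitiveD[OF H, symmetric]) auto
  finally show ?thesis using 0 by simp
qed (use 0 in simp)

lemma primitive_test_function: "test_function \<phi> \<Longrightarrow> primitive \<phi> (deriv \<phi>)"
  by (intro primitive_C1 test_function_DERIV test_function_continuous test_function_deriv)

section \<open>Weak derivatives on the line\<close>

lemma integral_by_parts_test:
  assumes F: "primitive F f" and \<phi>: "test_function \<phi>"
  shows "(LINT x|lborel. F x * deriv \<phi> x) = - (LINT x|lborel. f x * \<phi> x)"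
proof -
  obtain R1 where R1: "\<And>x. x \<notin> {-R1..R1} \<Longrightarrow> \<phi> x = 0"
    using test_function_bounded_support[OF \<phi>] by metis
  obtain R2 where R2: "\<And>x. x \<notin> {-R2..R2} \<Longrightarrow> deriv \<phi> x = 0"
    using test_function_bounded_support[OF test_function_deriv[OF \<phi>]] by metis
  have "\<phi> x = 0 \<and> deriv \<phi> x = 0" if "x \<notin> {- max R1 R2..max R1 R2}" for x
  proof
    show "\<phi> x = 0" by (rule R1) (use that in auto)
    show "deriv \<phi> x = 0" by (rule R2) (use that in auto)
  qed
  note support = this
  have "(LINT x|lborel. f x * \<phi> x + deriv \<phi> x * F x) = 0"
    by (rule integral_primitive_bounded_support[OF primitive_mult[OF F primitive_test_function[OF \<phi>]],
            of "- max R1 R2" "max R1 R2"]) (use support in auto)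
  moreover have "(LINT x|lborel. f x * \<phi> x + deriv \<phi> x * F x)
      = (LINT x|lborel. f x * \<phi> x) + (LINT x|lborel. F x * deriv \<phi> x)"
    using loc_integrable_mult_test[OF primitive_loc_integrable[OF F] \<phi>]
      loc_integrable_mult_test[OF loc_integrable_continuous[OF primitive_continuous[OF F]] test_function_deriv[OF \<phi>]]
    by (simp add: mult.commute)
  ultimately show ?thesis by simp
qed

lemma test_function_antiderivative:
  assumes \<phi>: "test_function \<phi>" and 0: "(LINT x|lborel. \<phi> x) = 0"
  obtains \<psi> where "test_function \<psi>" "deriv \<psi> = \<phi>"
proof -
  obtain R where R: "R > 0" "\<And>x. x \<notin> {-R..R} \<Longrightarrow> \<phi> x = 0"
    using test_function_bounded_support[OF \<phi>] by metis
  note cont = test_function_continuous[OF \<phi>]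
  obtain F where F: "primitive F \<phi>" using primitive_exists[OF loc_integrable_continuous[OF cont]] ..
  have D: "((\<lambda>x. F x - F (-R)) has_real_derivative \<phi> x) (at x)" for x
    using primitive_DERIV[OF F cont] by (auto intro!: derivative_eq_intros)
  have zero: "(LINT s:{x..y}|lborel. \<phi> s) = 0" if "{x..y} \<inter> {-R<..<R} = {}" for x y
  proof -
    have "AE s in lborel. indicator {x..y} s *\<^sub>R \<phi> s = 0"
      using AE_lborel_singleton[of R] AE_lborel_singleton[of "-R"]
    proof eventually_elim
      case (elim s)
      then have "s \<in> {x..y} \<Longrightarrow> s \<notin> {-R..R}" using that by force
      then show ?case using R by (auto simp: indicator_def)
    qed
    then show ?thesis unfolding set_lebesgue_integral_def by (intro integral_eq_zero_AE)
  qed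
  have "F x - F (-R) = 0" if "\<bar>x\<bar> > R" for x
  proof (cases "x > 0")
    case False
    with that have "F (-R) - F x = (LINT s:{x..-R}|lborel. \<phi> s)" by (intro primitiveD[OF F]) auto
    moreover have "{x..-R} \<inter> {-R<..<R} = {}" by auto
    ultimately show ?thesis using zero[of x "-R"] by simp
  next
    case True
    with that have "F x - F R = (LINT s:{R..x}|lborel. \<phi> s)" by (intro primitiveD[OF F]) auto
    moreover have "F R - F (-R) = 0"
      using primitiveD[OF F, of "-R" R] R 0 integrable_bounded_support(2)[OF loc_integrable_continuous[OF cont] R(2)]
      by simp
    moreover have "{R..x} \<inter> {-R<..<R} = {}" by auto
    ultimately show ?thesis using zero[of R x] by simp
  qed
  moreover have "Ck k (\<lambda>x. F x - F (-R))" for k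
    by (rule Ck_Suc_imp_Ck, rule Ck_SucI[OF D]) (use \<phi> in \<open>auto simp: test_function_def\<close>)
  ultimately have "test_function (\<lambda>x. F x - F (-R))" by (auto simp: test_function_def)
  moreover have "deriv (\<lambda>x. F x - F (-R)) = \<phi>" using D by (auto intro!: DERIV_imp_deriv)
  ultimately show ?thesis using that by blast
qed

text \<open>A test function with vanishing integral is the derivative of a test function, and every test
  function differs from such a one by a multiple of a fixed bump \<open>\<theta>\<close>; so a function that annihilates
  all derivatives acts on test functions as a constant.\<close>

lemma AE_const_if_orthogonal_to_derivs:
  assumes h: "loc_integrable h"
    and 0: "\<And>\<phi>. test_function \<phi> \<Longrightarrow> (LINT x|lborel. h x * deriv \<phi> x) = 0"
  shows "\<exists>c. AE x in lborel. h x = c"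
proof -
  define \<theta> where "\<theta> = plateau 1 0 1"
  have \<theta>: "test_function \<theta>" by (simp add: \<theta>_def test_function_plateau)
  have test_int: "integrable lborel \<phi>" if "test_function \<phi>" for \<phi>
    using loc_integrable_mult_test[OF loc_integrable_continuous that, of "\<lambda>_. 1"] by auto
  have "(LINT x|lborel. \<theta> x) \<noteq> 0"
  proof
    assume "(LINT x|lborel. \<theta> x) = 0"
    then have "AE x in lborel. \<theta> x = 0"
      using test_int[OF \<theta>] plateau_bounds
      by (subst (asm) integral_nonneg_eq_0_iff_AE) (auto simp: \<theta>_def)
    then have "AE x in lborel. x \<notin> {0<..<1::real}"
    proof eventually_elim
      case (elim x)
      then show ?case by (auto simp: \<theta>_def plateau_def flat_def)
    qed
    then have "emeasure lborel {0<..<1::real} = 0"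
      by (subst (asm) AE_iff_measurable[of "{0<..<1}"]) auto
    then show False by simp
  qed
  then obtain J where J: "J = (LINT x|lborel. \<theta> x)" "J \<noteq> 0" by blast
  define c where "c = (LINT x|lborel. h x * \<theta> x) / J"
  have "AE x in lborel. h x - c = 0"
  proof (rule AE_zero_if_orthogonal_to_tests)
    show "loc_integrable (\<lambda>x. h x - c)" by (rule loc_integrable_diff[OF h loc_integrable_continuous]) auto
    fix \<phi> assume \<phi>: "test_function \<phi>"
    define a where "a = (LINT x|lborel. \<phi> x) / J"
    have "test_function (\<lambda>x. \<phi> x + (- a) * \<theta> x)"
    proof -
      obtain R1 R2 where "\<And>x. \<bar>x\<bar> > R1 \<Longrightarrow> \<phi> x = 0" "\<And>x. \<bar>x\<bar> > R2 \<Longrightarrow> \<theta> x = 0"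
        using \<phi> \<theta> unfolding test_function_def by metis
      then have "\<bar>x\<bar> > max R1 R2 \<Longrightarrow> \<phi> x + (- a) * \<theta> x = 0" for x by simp
      moreover have "Ck k (\<lambda>x. \<phi> x + (- a) * \<theta> x)" for k
        using \<phi> \<theta> by (intro Ck_add Ck_mult Ck_const) (auto simp: test_function_def)
      ultimately show ?thesis unfolding test_function_def by blast
    qed
    moreover have "(LINT x|lborel. \<phi> x + (- a) * \<theta> x) = 0"
      using test_int[OF \<phi>] test_int[OF \<theta>] J by (simp add: a_def)
    ultimately obtain \<psi> where \<psi>: "test_function \<psi>" "deriv \<psi> = (\<lambda>x. \<phi> x + (- a) * \<theta> x)"
      by (rule test_function_antiderivative)
    have "(LINT x|lborel. h x * (\<phi> x + (- a) * \<theta> x)) = 0" using 0[OF \<psi>(1)] \<psi>(2) by simp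
    moreover have "(LINT x|lborel. h x * (\<phi> x + (- a) * \<theta> x))
        = (LINT x|lborel. h x * \<phi> x) - a * (LINT x|lborel. h x * \<theta> x)"
      using loc_integrable_mult_test[OF h \<phi>] loc_integrable_mult_test[OF h \<theta>]
      by (simp add: distrib_left right_diff_distrib mult.left_commute)
    ultimately have "(LINT x|lborel. h x * \<phi> x) = c * (LINT x|lborel. \<phi> x)"
      using J by (simp add: a_def c_def)
    then show "(LINT x|lborel. (h x - c) * \<phi> x) = 0"
      using loc_integrable_mult_test[OF h \<phi>] test_int[OF \<phi>] by (simp add: left_diff_distrib)
  qed
  then show ?thesis by (auto intro!: exI[of _ c])
qed

text \<open>Any primitive of \<open>g\<close> has the same weak derivative as \<open>f\<close>, so the two differ by a constant.\<close>

lemma weak_deriv_1_primitive: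
  assumes w: "weak_deriv 1 f g"
  obtains F where "primitive F g" "AE x in lborel. f x = F x"
proof -
  from w have f: "loc_integrable f" and g: "loc_integrable g"
    and eq: "\<And>\<phi>. test_function \<phi> \<Longrightarrow> (LINT x|lborel. f x * deriv \<phi> x) = - (LINT x|lborel. g x * \<phi> x)"
    by (auto simp: weak_deriv_def)
  obtain G where G: "primitive G g" using primitive_exists[OF g] ..
  note Gl = loc_integrable_continuous[OF primitive_continuous[OF G]]
  have "\<exists>c. AE x in lborel. f x - G x = c"
  proof (rule AE_const_if_orthogonal_to_derivs)
    show "loc_integrable (\<lambda>x. f x - G x)" using f Gl by (rule loc_integrable_diff)
    fix \<phi> assume \<phi>: "test_function \<phi>"
    show "(LINT x|lborel. (f x - G x) * deriv \<phi> x) = 0"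
      using eq[OF \<phi>] integral_by_parts_test[OF G \<phi>]
        loc_integrable_mult_test[OF f test_function_deriv[OF \<phi>]]
        loc_integrable_mult_test[OF Gl test_function_deriv[OF \<phi>]]
      by (simp add: left_diff_distrib)
  qed
  then obtain c where "AE x in lborel. f x - G x = c" ..
  then have "AE x in lborel. f x = G x + c" by eventually_elim simp
  moreover have "primitive (\<lambda>x. G x + c) g" using G by (simp add: primitive_def)
  ultimately show ?thesis using that by blast
qed

lemma weak_deriv_unique:
  assumes "weak_deriv j f g" "weak_deriv j f g'"
  shows "AE x in lborel. g x = g' x"
proof -
  from assms have g: "loc_integrable g" "loc_integrable g'" by (auto simp: weak_deriv_def)
  have "AE x in lborel. g x - g' x = 0"
  proof (rule AE_zero_if_orthogonal_to_tests)
    fix \<phi> assume \<phi>: "test_function \<phi>"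
    have "(LINT x|lborel. g x * \<phi> x) = (LINT x|lborel. g' x * \<phi> x)"
      using assms \<phi> by (auto simp: weak_deriv_def)
    then show "(LINT x|lborel. (g x - g' x) * \<phi> x) = 0"
      using loc_integrable_mult_test[OF g(1) \<phi>] loc_integrable_mult_test[OF g(2) \<phi>]
      by (simp add: left_diff_distrib)
  qed (use g in \<open>rule loc_integrable_diff\<close>)
  then show ?thesis by eventually_elim simp
qed

lemma weak_deriv_wderiv: "weak_deriv j f g \<Longrightarrow> weak_deriv j f (wderiv j f)"
  unfolding wderiv_def by (rule someI[of "weak_deriv j f"])

lemma wderiv_AE_eq: "weak_deriv j f g \<Longrightarrow> AE x in lborel. wderiv j f x = g x"
  using weak_deriv_unique weak_deriv_wderiv by blast

lemma weak_deriv_0_refl: "loc_integrable f \<Longrightarrow> weak_deriv 0 f f"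
  by (simp add: weak_deriv_def)

lemma weak_deriv_diff:
  assumes "weak_deriv j f g" "weak_deriv j f' g'"
  shows "weak_deriv j (\<lambda>x. f x - f' x) (\<lambda>x. g x - g' x)"
proof -
  have t: "test_function ((deriv ^^ j) \<phi>)" if "test_function \<phi>" for \<phi>
    using that by (induction j) (auto intro: test_function_deriv)
  show ?thesis
    using assms loc_integrable_mult_test[OF _ t] loc_integrable_mult_test
    by (auto simp: weak_deriv_def loc_integrable_diff left_diff_distrib right_diff_distrib)
qed

lemma weak_deriv_1_add_const:
  "weak_deriv 1 (\<lambda>x. f x - c) g \<Longrightarrow> weak_deriv 1 f g"
proof -
  assume w: "weak_deriv 1 (\<lambda>x. f x - c) g"
  have "weak_deriv 1 (\<lambda>x. - c) (\<lambda>x. 0)"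
  proof -
    have "primitive (\<lambda>x. - c) (\<lambda>x. 0)" by (rule primitive_C1) auto
    then show ?thesis using integral_by_parts_test[OF \<open>primitive (\<lambda>x. - c) (\<lambda>x. 0)\<close>]
      by (auto simp: weak_deriv_def loc_integrable_continuous)
  qed
  from weak_deriv_diff[OF w this] show ?thesis by simp
qed

text \<open>Derivatives of test functions are test functions, so a weak derivative of order two is a weak
  derivative of the one of order one.\<close>

lemma weak_deriv_2_imp_1:
  assumes "weak_deriv 1 f g" "weak_deriv 2 f h"
  shows "weak_deriv 1 g h"
proof -
  have "(LINT x|lborel. g x * deriv \<phi> x) = - (LINT x|lborel. h x * \<phi> x)" if \<phi>: "test_function \<phi>" for \<phi>
  proof -
    have "(LINT x|lborel. f x * deriv (deriv \<phi>) x) = - (LINT x|lborel. g x * deriv \<phi> x)"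
      using assms(1) test_function_deriv[OF \<phi>] by (simp add: weak_deriv_def)
    moreover have "(LINT x|lborel. f x * deriv (deriv \<phi>) x) = (LINT x|lborel. h x * \<phi> x)"
      using assms(2) \<phi> by (simp add: weak_deriv_def numeral_2_eq_2)
    ultimately show ?thesis by simp
  qed
  with assms show ?thesis by (simp add: weak_deriv_def)
qed

section \<open>Square integrable functions\<close>

definition L2 :: "(real \<Rightarrow> real) \<Rightarrow> bool" where
  "L2 f \<longleftrightarrow> f \<in> borel_measurable borel \<and> integrable lborel (\<lambda>x. (f x)\<^sup>2)"

definition nrm :: "(real \<Rightarrow> real) \<Rightarrow> real" where
  "nrm f = sqrt (LINT x|lborel. (f x)\<^sup>2)"

lemma abs_powr_2: "\<bar>x::real\<bar> powr 2 = x\<^sup>2"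
  by (cases "x = 0") auto

lemma in_Lp_2_iff: "in_Lp 2 f \<longleftrightarrow> L2 f"
  by (simp add: in_Lp_def L2_def abs_powr_2)

lemma Lp_norm_2: "Lp_norm 2 f = nrm f"
  by (simp add: Lp_norm_def nrm_def abs_powr_2 powr_half_sqrt)

lemma L2_borel[measurable_dest]: "L2 f \<Longrightarrow> f \<in> borel_measurable borel"
  by (simp add: L2_def)

lemma L2_square: "L2 f \<Longrightarrow> integrable lborel (\<lambda>x. (f x)\<^sup>2)"
  by (simp add: L2_def)

lemma nrm_nonneg[simp]: "0 \<le> nrm f"
  by (simp add: nrm_def)

lemma nrm_square: "(nrm f)\<^sup>2 = (LINT x|lborel. (f x)\<^sup>2)"
  by (simp add: nrm_def)

lemma nrm_cong_AE:
  assumes "f \<in> borel_measurable borel" "g \<in> borel_measurable borel" "AE x in lborel. f x = g x"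
  shows "nrm f = nrm g"
  unfolding nrm_def using assms
  by (intro arg_cong[where f = sqrt] integral_cong_AE) auto

lemma L2_cong_AE:
  assumes "L2 f" "g \<in> borel_measurable borel" "AE x in lborel. f x = g x"
  shows "L2 g"
  unfolding L2_def
proof
  show "integrable lborel (\<lambda>x. (g x)\<^sup>2)"
    by (rule integrable_cong_AE_imp[OF L2_square[OF assms(1)]]) (use assms in auto)
qed fact

lemma L2_bound:
  assumes "L2 f" "g \<in> borel_measurable borel" "\<And>x. \<bar>g x\<bar> \<le> C * \<bar>f x\<bar>"
  shows "L2 g"
  unfolding L2_def
proof
  have "integrable lborel (\<lambda>x. C\<^sup>2 * (f x)\<^sup>2)" using assms(1) by (simp add: L2_def)
  then show "integrable lborel (\<lambda>x. (g x)\<^sup>2)"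
  proof (rule Bochner_Integration.integrable_bound)
    have "(g x)\<^sup>2 \<le> C\<^sup>2 * (f x)\<^sup>2" for x
      using power_mono[OF assms(3)[of x], of 2] by (simp add: power_mult_distrib)
    then show "AE x in lborel. norm ((g x)\<^sup>2) \<le> norm (C\<^sup>2 * (f x)\<^sup>2)" by simp
  qed (use assms in simp)
qed fact

lemma L2_mult_bounded:
  assumes "L2 g" "continuous_on UNIV h" "\<And>x. \<bar>h x\<bar> \<le> K"
  shows "L2 (\<lambda>x. h x * g x)"
proof (rule L2_bound[OF assms(1), of _ K])
  show "(\<lambda>x. h x * g x) \<in> borel_measurable borel"
    using borel_measurable_continuous_onI[OF assms(2)] L2_borel[OF assms(1)] by auto
  show "\<bar>h x * g x\<bar> \<le> K * \<bar>g x\<bar>" for x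
    using assms(3)[of x] by (simp add: abs_mult mult_right_mono)
qed

lemma L2_mult_integrable:
  assumes f: "L2 f" and g: "L2 g"
  shows "integrable lborel (\<lambda>x. f x * g x)"
proof (rule Bochner_Integration.integrable_bound)
  show "integrable lborel (\<lambda>x. (f x)\<^sup>2 + (g x)\<^sup>2)"
    using f g by (simp add: L2_def)
  have "\<bar>f x * g x\<bar> \<le> (f x)\<^sup>2 + (g x)\<^sup>2" for x
  proof -
    have "2 * (\<bar>f x\<bar> * \<bar>g x\<bar>) \<le> (f x)\<^sup>2 + (g x)\<^sup>2"
      using sum_squares_bound[of "\<bar>f x\<bar>" "\<bar>g x\<bar>"] by simp
    moreover have "0 \<le> \<bar>f x\<bar> * \<bar>g x\<bar>" by simp
    ultimately show ?thesis unfolding abs_mult by linarith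
  qed
  then show "AE x in lborel. norm (f x * g x) \<le> norm ((f x)\<^sup>2 + (g x)\<^sup>2)" by simp
qed (use f g in \<open>auto simp: L2_def\<close>)

lemma L2_cmult: "L2 f \<Longrightarrow> L2 (\<lambda>x. c * f x)"
  by (rule L2_bound[of f _ "\<bar>c\<bar>"]) (auto simp: L2_def abs_mult)

lemma L2_add: "L2 f \<Longrightarrow> L2 g \<Longrightarrow> L2 (\<lambda>x. f x + g x)"
  using L2_mult_integrable[of f g] by (auto simp: L2_def power2_sum mult.assoc)

lemma L2_diff: "L2 f \<Longrightarrow> L2 g \<Longrightarrow> L2 (\<lambda>x. f x - g x)"
  using L2_add[of f "\<lambda>x. (-1) * g x"] L2_cmult[of g "-1"] by simp

lemma nrm_cmult: "nrm (\<lambda>x. c * f x) = \<bar>c\<bar> * nrm f"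
  by (simp add: nrm_def power_mult_distrib real_sqrt_mult)

lemma L2_loc_integrable:
  assumes f: "L2 f" shows "loc_integrable f"
  unfolding loc_integrable_def set_integrable_def
proof safe
  fix a b :: real
  have "L2 (indicator {a..b})"
    by (auto simp: L2_def power2_eq_square indicator_inter_arith[symmetric] emeasure_lborel_Icc_eq
        intro!: integrable_real_indicator)
  from L2_mult_integrable[OF this f] show "integrable lborel (\<lambda>x. indicator {a..b} x *\<^sub>R f x)" by simp
qed

lemma cauchy_schwarz:
  assumes f: "L2 f" and g: "L2 g"
  shows "(LINT x|lborel. \<bar>f x * g x\<bar>) \<le> nrm f * nrm g"
proof -
  have [measurable]: "f \<in> borel_measurable borel" "g \<in> borel_measurable borel"
    using f g by (auto simp: L2_def)
  have p: "(\<integral>\<^sup>+x. ennreal \<bar>f x\<bar> * ennreal \<bar>g x\<bar> \<partial>lborel) = ennreal (LINT x|lborel. \<bar>f x * g x\<bar>)"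
    using integrable_abs[OF L2_mult_integrable[OF f g]]
    by (subst nn_integral_eq_integral[symmetric]) (auto simp: abs_mult ennreal_mult)
  have q: "(\<integral>\<^sup>+x. (ennreal \<bar>h x\<bar>)\<^sup>2 \<partial>lborel) = ennreal ((nrm h)\<^sup>2)" if "L2 h" for h
    using L2_square[OF that] unfolding nrm_square
    by (subst nn_integral_eq_integral[symmetric]) (auto simp: ennreal_power)
  have "ennreal ((LINT x|lborel. \<bar>f x * g x\<bar>)\<^sup>2) \<le> ennreal ((nrm f)\<^sup>2 * (nrm g)\<^sup>2)"
    using Cauchy_Schwarz_nn_integral[of "\<lambda>x. ennreal \<bar>f x\<bar>" lborel "\<lambda>x. ennreal \<bar>g x\<bar>"]
    unfolding p q[OF f] q[OF g] by (simp add: ennreal_power ennreal_mult[symmetric])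
  then have "(LINT x|lborel. \<bar>f x * g x\<bar>)\<^sup>2 \<le> (nrm f * nrm g)\<^sup>2"
    by (simp add: power_mult_distrib)
  then show ?thesis by (rule power2_le_imp_le) simp
qed

lemma abs_integral_mult_le:
  assumes f: "L2 f" and g: "L2 g"
  shows "\<bar>LINT x|lborel. f x * g x\<bar> \<le> nrm f * nrm g"
  using integral_abs_bound[of lborel "\<lambda>x. f x * g x"] cauchy_schwarz[OF f g] by linarith

lemma nrm_triangle:
  assumes f: "L2 f" and g: "L2 g"
  shows "nrm (\<lambda>x. f x + g x) \<le> nrm f + nrm g"
proof (rule power2_le_imp_le)
  have "(nrm (\<lambda>x. f x + g x))\<^sup>2 = (nrm f)\<^sup>2 + (nrm g)\<^sup>2 + 2 * (LINT x|lborel. f x * g x)"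
    using L2_mult_integrable[OF f g] L2_square[OF f] L2_square[OF g]
    by (simp add: nrm_square power2_sum mult.assoc)
  also have "\<dots> \<le> (nrm f + nrm g)\<^sup>2"
    using abs_integral_mult_le[OF f g] by (simp add: power2_sum)
  finally show "(nrm (\<lambda>x. f x + g x))\<^sup>2 \<le> (nrm f + nrm g)\<^sup>2" .
qed simp

lemma nrm_triangle_diff:
  assumes f: "L2 f" and g: "L2 g"
  shows "nrm f \<le> nrm (\<lambda>x. f x - g x) + nrm g"
  using nrm_triangle[OF L2_diff[OF f g] g] by simp

section \<open>Functions with integrable derivative on the line\<close>

lemma integrable_small_somewhere:
  fixes H :: "real \<Rightarrow> real"
  assumes H: "integrable lborel H" and A: "A \<in> sets borel" "emeasure lborel A = \<infinity>" and e: "e > 0"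
  obtains y where "y \<in> A" "\<bar>H y\<bar> < e"
proof (rule ccontr)
  assume "\<not> thesis"
  with that have big: "\<And>y. y \<in> A \<Longrightarrow> e \<le> \<bar>H y\<bar>" by force
  have "integrable lborel (\<lambda>x. (1 / e) * H x)" using H by simp
  then have "integrable lborel (indicator A :: real \<Rightarrow> real)"
    by (rule Bochner_Integration.integrable_bound)
       (use A big e in \<open>auto simp: abs_mult field_simps split: split_indicator\<close>)
  with A show False by (simp add: integrable_indicator_iff)
qed

lemma emeasure_lborel_half_line: "emeasure lborel {a::real..} = \<infinity>" "emeasure lborel {..a::real} = \<infinity>"
proof -
  have "emeasure lborel A = \<infinity>" if "\<And>n. {b n..b n + real n} \<subseteq> A" "A \<in> sets borel" for A b
  proof (rule ccontr)
    assume "emeasure lborel A \<noteq> \<infinity>"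
    then obtain n where n: "emeasure lborel A < of_nat n"
      using ennreal_Ex_less_of_nat by (auto simp: less_top)
    have "emeasure lborel {b n..b n + real n} \<le> emeasure lborel A"
      using that by (intro emeasure_mono) auto
    with n show False by (simp add: ennreal_of_nat_eq_real_of_nat)
  qed
  from this[of "\<lambda>_. a" "{a..}"] this[of "\<lambda>n. a - real n" "{..a}"] show "emeasure lborel {a..} = \<infinity>" "emeasure lborel {..a} = \<infinity>"
    by auto
qed

lemma primitive_AE_cong:
  assumes "primitive F f" "AE x in lborel. f x = g x" "g \<in> borel_measurable borel"
  shows "primitive F g"
proof -
  have [measurable]: "f \<in> borel_measurable borel"
    using assms(1) by (intro loc_integrable_borel primitive_loc_integrable)
  note assms(3)[measurable]
  have "set_integrable lborel {a..b} g" for a b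
    unfolding set_integrable_def
  proof (rule integrable_cong_AE_imp)
    show "integrable lborel (\<lambda>x. indicator {a..b} x *\<^sub>R f x)"
      using primitive_loc_integrable[OF assms(1)] by (simp add: loc_integrable_def set_integrable_def)
    show "AE x in lborel. indicator {a..b} x *\<^sub>R f x = indicator {a..b} x *\<^sub>R g x"
      using assms(2) by eventually_elim simp
  qed simp
  moreover have "(LINT s:{a..b}|lborel. f s) = (LINT s:{a..b}|lborel. g s)" for a b
    using assms(2) unfolding set_lebesgue_integral_def by (intro integral_cong_AE) auto
  ultimately show ?thesis using assms(1) by (simp add: primitive_def loc_integrable_def)
qed

lemma abs_primitive_diff_le:
  assumes F: "primitive F f" and f: "integrable lborel f"
  shows "\<bar>F y - F x\<bar> \<le> (LINT s|lborel. \<bar>f s\<bar>)"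
proof -
  have *: "\<bar>F y - F x\<bar> \<le> (LINT s|lborel. \<bar>f s\<bar>)" if "x \<le> y" for x y
  proof -
    have "\<bar>F y - F x\<bar> \<le> (LINT s|lborel. \<bar>indicator {x..y} s *\<^sub>R f s\<bar>)"
      unfolding primitiveD[OF F that] set_lebesgue_integral_def by (rule integral_abs_bound)
    also have "\<dots> \<le> (LINT s|lborel. \<bar>f s\<bar>)"
      by (rule integral_mono) (use f primitive_loc_integrable[OF F] in
        \<open>auto simp: loc_integrable_def set_integrable_def split: split_indicator\<close>)
    finally show ?thesis .
  qed
  show ?thesis using *[of x y] *[of y x] by linarith
qed

text \<open>An integrable function is arbitrarily small somewhere; integrate the derivative from there.\<close>

lemma abs_le_integral_abs_deriv:
  assumes F: "primitive F f" and "integrable lborel F" and f: "integrable lborel f"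
  shows "\<bar>F x\<bar> \<le> (LINT s|lborel. \<bar>f s\<bar>)"
proof (rule field_le_epsilon)
  fix e :: real assume "e > 0"
  then obtain y where "\<bar>F y\<bar> < e"
    using integrable_small_somewhere[OF assms(2), of UNIV e] by auto
  then show "\<bar>F x\<bar> \<le> (LINT s|lborel. \<bar>f s\<bar>) + e"
    using abs_primitive_diff_le[OF F f, of x y] by linarith
qed

text \<open>Boundary terms vanish along suitable sequences of points that tend to both ends of the line.\<close>

lemma integral_deriv_eq_0:
  assumes F: "primitive F f" and Fi: "integrable lborel F" and f: "integrable lborel f"
  shows "(LINT x|lborel. f x) = 0"
proof -
  have "\<exists>y. y \<in> {real n..} \<and> \<bar>F y\<bar> < 1 / (real n + 1)" for n
    by (rule integrable_small_somewhere[OF Fi, of "{real n..}" "1 / (real n + 1)"])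
       (auto simp: emeasure_lborel_half_line)
  then obtain b where b: "\<And>n. b n \<ge> real n" "\<And>n. \<bar>F (b n)\<bar> < 1 / (real n + 1)" by (metis atLeast_iff)
  have "\<exists>y. y \<in> {..- real n} \<and> \<bar>F y\<bar> < 1 / (real n + 1)" for n
    by (rule integrable_small_somewhere[OF Fi, of "{..- real n}" "1 / (real n + 1)"])
       (auto simp: emeasure_lborel_half_line)
  then obtain a where a: "\<And>n. a n \<le> - real n" "\<And>n. \<bar>F (a n)\<bar> < 1 / (real n + 1)" by (metis atMost_iff)
  have ab: "a n \<le> b n" for n using a(1)[of n] b(1)[of n] by linarith
  have lim0: "(\<lambda>n. 1 / (real n + 1)) \<longlonglongrightarrow> 0"
    using LIMSEQ_inverse_real_of_nat by (simp add: inverse_eq_divide add.commute)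
  have "(\<lambda>n. F (b n)) \<longlonglongrightarrow> 0" "(\<lambda>n. F (a n)) \<longlonglongrightarrow> 0"
    by (rule Lim_null_comparison[OF _ lim0], use a b in \<open>auto intro!: eventuallyI less_imp_le\<close>)+
  then have "(\<lambda>n. F (b n) - F (a n)) \<longlonglongrightarrow> 0 - 0" by (rule tendsto_diff)
  moreover have "(\<lambda>n. F (b n) - F (a n)) \<longlonglongrightarrow> (LINT x|lborel. f x)"
    unfolding primitiveD[OF F ab] set_lebesgue_integral_def
  proof (rule integral_dominated_convergence[where w = "\<lambda>x. \<bar>f x\<bar>"])
    show "AE x in lborel. (\<lambda>n. indicator {a n..b n} x *\<^sub>R f x) \<longlonglongrightarrow> f x"
    proof (rule AE_I2)
      fix x
      have "eventually (\<lambda>n. \<bar>x\<bar> \<le> real n) sequentially"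
        using filterlim_real_sequentially by (simp add: filterlim_at_top)
      then have "eventually (\<lambda>n. f x = indicator {a n..b n} x *\<^sub>R f x) sequentially"
      proof eventually_elim
        case (elim n)
        then show ?case using a(1)[of n] b(1)[of n] by (auto simp: indicator_def)
      qed
      then show "(\<lambda>n. indicator {a n..b n} x *\<^sub>R f x) \<longlonglongrightarrow> f x"
        by (rule Lim_transform_eventually[OF tendsto_const])
    qed
  qed (use f in \<open>auto split: split_indicator\<close>)
  ultimately show ?thesis using LIMSEQ_unique by fastforce
qed

lemma integral_by_parts:
  assumes F: "primitive F f" and G: "primitive G g"
    and "L2 F" "L2 f" "L2 G" "L2 g"
  shows "(LINT x|lborel. F x * g x) = - (LINT x|lborel. f x * G x)"
proof -
  have i: "integrable lborel (\<lambda>x. f x * G x)" "integrable lborel (\<lambda>x. g x * F x)"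
    using assms by (auto intro: L2_mult_integrable)
  have "(LINT x|lborel. f x * G x + g x * F x) = 0"
    by (rule integral_deriv_eq_0[OF primitive_mult[OF F G]])
       (use assms i in \<open>auto intro: L2_mult_integrable\<close>)
  then show ?thesis using i by (simp add: mult.commute)
qed

text \<open>Apply the bound by the integral of the derivative to \<open>v\<^sup>2\<close>.\<close>

lemma square_le_nrm_mult_nrm_deriv:
  assumes v: "primitive v v'" and "L2 v" "L2 v'"
  shows "(v x)\<^sup>2 \<le> 2 * nrm v * nrm v'"
proof -
  have "\<bar>v x * v x\<bar> \<le> (LINT s|lborel. \<bar>v' s * v s + v' s * v s\<bar>)"
    by (rule abs_le_integral_abs_deriv[OF primitive_mult[OF v v]])
       (use assms in \<open>auto intro: L2_mult_integrable\<close>)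
  also have "\<dots> = 2 * (LINT s|lborel. \<bar>v s * v' s\<bar>)"
    by (subst integral_mult_right_zero[symmetric]) (simp add: abs_mult mult.commute)
  also have "\<dots> \<le> 2 * (nrm v * nrm v')"
    using cauchy_schwarz[OF assms(2,3)] by simp
  finally show ?thesis by (simp add: power2_eq_square)
qed

text \<open>The two elementary bounds \<open>\<parallel>v\<parallel>\<^sub>2\<^sup>2 \<le> \<parallel>v\<parallel>\<^sub>\<infinity> \<parallel>v\<parallel>\<^sub>1\<close> and \<open>\<parallel>v\<parallel>\<^sub>\<infinity>\<^sup>2 \<le> 2 \<parallel>v\<parallel>\<^sub>2 \<parallel>v'\<parallel>\<^sub>2\<close>
  combine to Nash's inequality in dimension one.\<close>

lemma nash_inequality:
  assumes v: "primitive v v'" and "L2 v" "L2 v'" and i: "integrable lborel v"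
  shows "(LINT x|lborel. (v x)\<^sup>2) ^ 3 \<le> 4 * (LINT x|lborel. (v' x)\<^sup>2) * (LINT x|lborel. \<bar>v x\<bar>) ^ 4"
proof -
  define E where "E = (LINT x|lborel. (v x)\<^sup>2)"
  define A where "A = (LINT x|lborel. \<bar>v x\<bar>)"
  define S where "S = sqrt (2 * nrm v * nrm v')"
  have pos: "0 \<le> E" "0 \<le> A" "0 \<le> S" by (auto simp: E_def A_def S_def)
  have S: "\<bar>v x\<bar> \<le> S" for x
    unfolding S_def using square_le_nrm_mult_nrm_deriv[OF assms(1-3), of x]
    by (intro real_le_rsqrt) simp
  have "E \<le> (LINT x|lborel. S * \<bar>v x\<bar>)"
    unfolding E_def
  proof (rule integral_mono)
    show "(v x)\<^sup>2 \<le> S * \<bar>v x\<bar>" for x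
      using mult_right_mono[OF S[of x], of "\<bar>v x\<bar>"] by (simp add: power2_eq_square abs_mult_self_eq)
  qed (use i L2_square[OF assms(2)] in auto)
  then have "E \<le> S * A" by (simp add: A_def)
  then have "E ^ 4 \<le> (S * A) ^ 4" using pos by (intro power_mono) auto
  also have "\<dots> = (S\<^sup>2)\<^sup>2 * A ^ 4" by (simp add: power_mult_distrib)
  also have "S\<^sup>2 = 2 * nrm v * nrm v'" by (simp add: S_def)
  also have "(2 * nrm v * nrm v')\<^sup>2 * A ^ 4 = E * (4 * (LINT x|lborel. (v' x)\<^sup>2) * A ^ 4)"
    by (simp add: power_mult_distrib nrm_square E_def)
  finally have "E * E ^ 3 \<le> E * (4 * (LINT x|lborel. (v' x)\<^sup>2) * A ^ 4)"
    by (simp add: power_numeral_reduce mult.assoc)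
  then have "E ^ 3 \<le> 4 * (LINT x|lborel. (v' x)\<^sup>2) * A ^ 4" if "E \<noteq> 0"
    using that pos by (simp add: mult_le_cancel_left)
  moreover have "0 \<le> 4 * (LINT x|lborel. (v' x)\<^sup>2) * A ^ 4"
    using pos by (intro mult_nonneg_nonneg) auto
  ultimately show ?thesis unfolding E_def A_def by fastforce
qed

section \<open>Classical representatives in Sobolev spaces\<close>

lemma AE_lborel_in_interval:
  fixes a b :: real
  assumes "AE x in lborel. P x" "a < b"
  obtains x where "a < x" "x < b" "P x"
proof (rule ccontr)
  assume "\<not> thesis"
  with that have "x \<in> {a<..<b} \<Longrightarrow> \<not> P x" for x by auto
  with assms(1) have "AE x in lborel. x \<notin> {a<..<b}" by auto
  then have "emeasure lborel {a<..<b} = 0"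
    by (subst (asm) AE_iff_measurable[of "{a<..<b}"]) auto
  with \<open>a < b\<close> show False by simp
qed

lemma continuous_AE_eq_imp_eq:
  fixes F G :: "real \<Rightarrow> real"
  assumes "continuous_on UNIV F" "continuous_on UNIV G" and ae: "AE x in lborel. F x = G x"
  shows "F x = G x"
proof (rule ccontr)
  assume "F x \<noteq> G x"
  have "open {y. F y \<noteq> G y}" using assms by (intro open_Collect_neq)
  then obtain e where e: "e > 0" "ball x e \<subseteq> {y. F y \<noteq> G y}"
    using \<open>F x \<noteq> G x\<close> by (auto simp: open_contains_ball)
  then obtain y where "x < y" "y < x + e" "F y = G y"
    using AE_lborel_in_interval[OF ae, of x "x + e"] by auto
  with e show False by (auto simp: subset_eq dist_real_def)
qed

lemma weak_deriv_borel:
  "weak_deriv j w g \<Longrightarrow> w \<in> borel_measurable borel" "weak_deriv j w g \<Longrightarrow> g \<in> borel_measurable borel"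
  by (auto simp: weak_deriv_def intro: loc_integrable_borel)

lemma in_Hk_wderiv:
  assumes "in_Hk k w" "j \<le> k"
  shows "weak_deriv j w (wderiv j w)" "L2 (wderiv j w)"
proof -
  obtain g where g: "weak_deriv j w g" "L2 g" using assms by (auto simp: in_Hk_def in_Lp_2_iff)
  show w: "weak_deriv j w (wderiv j w)" by (rule weak_deriv_wderiv[OF g(1)])
  have "AE x in lborel. g x = wderiv j w x" by (rule weak_deriv_unique[OF g(1) w])
  then show "L2 (wderiv j w)" by (rule L2_cong_AE[OF g(2) weak_deriv_borel(2)[OF w]])
qed

lemma in_Hk_borel: "in_Hk k w \<Longrightarrow> w \<in> borel_measurable borel"
  using in_Hk_wderiv(1)[of k w 0] weak_deriv_borel(1) by blast

lemma in_Hk_L2: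
  assumes "in_Hk k w" shows "L2 w" "nrm (wderiv 0 w) = nrm w"
proof -
  note w = in_Hk_wderiv[OF assms, of 0, simplified]
  have ae: "AE x in lborel. wderiv 0 w x = w x"
    by (rule weak_deriv_unique[OF w(1)], rule weak_deriv_0_refl) (use w(1) in \<open>simp add: weak_deriv_def\<close>)
  then show "L2 w" by (rule L2_cong_AE[OF w(2) in_Hk_borel[OF assms]])
  then show "nrm (wderiv 0 w) = nrm w" using w(2) ae by (intro nrm_cong_AE) (auto simp: L2_def)
qed

lemma L2_imp_in_Hk_0: "L2 w \<Longrightarrow> in_Hk 0 w"
  by (auto simp: in_Hk_def in_Lp_2_iff intro: weak_deriv_0_refl L2_loc_integrable)

lemma Hk_norm_0: "L2 w \<Longrightarrow> Hk_norm 0 w = nrm w"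
  using in_Hk_L2(2)[OF L2_imp_in_Hk_0] by (simp add: Hk_norm_def Lp_norm_2)

lemma nrm_wderiv_le_Hk_norm: "j \<le> k \<Longrightarrow> nrm (wderiv j w) \<le> Hk_norm k w"
  unfolding Hk_norm_def Lp_norm_2
  by (intro real_le_rsqrt member_le_sum[where f = "\<lambda>j. (nrm (wderiv j w))\<^sup>2"]) auto

lemma nrm_wderiv_triangle:
  assumes v: "in_Hk k v" and w: "in_Hk k w" and j: "j \<le> k"
  shows "nrm (wderiv j w) \<le> nrm (wderiv j v) + Hk_norm k (\<lambda>x. v x - w x)"
proof -
  note V = in_Hk_wderiv[OF v j] and W = in_Hk_wderiv[OF w j]
  note d = weak_deriv_diff[OF V(1) W(1)]
  have "nrm (wderiv j w) \<le> nrm (\<lambda>x. wderiv j w x - wderiv j v x) + nrm (wderiv j v)"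
    by (rule nrm_triangle_diff[OF W(2) V(2)])
  also have "nrm (\<lambda>x. wderiv j w x - wderiv j v x) = nrm (\<lambda>x. wderiv j v x - wderiv j w x)"
    by (simp add: nrm_def power2_commute)
  also have "\<dots> = nrm (wderiv j (\<lambda>x. v x - w x))"
    using wderiv_AE_eq[OF d] weak_deriv_borel(2)[OF d] weak_deriv_borel(2)[OF weak_deriv_wderiv[OF d]]
    by (intro nrm_cong_AE) auto
  also have "\<dots> \<le> Hk_norm k (\<lambda>x. v x - w x)" by (rule nrm_wderiv_le_Hk_norm[OF j])
  finally show ?thesis by simp
qed

text \<open>The essential bound in time holds at every time, by continuity in time.\<close>

lemma C0_time_Linf_time_bounded:
  assumes C: "C0_time k v" and L: "Linf_time k v"
  shows "\<exists>B>0. \<forall>t\<ge>0. \<forall>j\<le>k. nrm (wderiv j (v t)) \<le> B"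
proof -
  from L obtain B where B: "AE t in lborel. t > 0 \<longrightarrow> Hk_norm k (v t) \<le> B"
    by (auto simp: Linf_time_def)
  have "nrm (wderiv j (v t)) \<le> \<bar>B\<bar> + 1" if t: "t \<ge> 0" and j: "j \<le> k" for t j
  proof -
    from C t have "((\<lambda>s. Hk_norm k (\<lambda>x. v s x - v t x)) \<longlongrightarrow> 0) (at t within {0..})"
      by (auto simp: C0_time_def)
    then have "eventually (\<lambda>s. Hk_norm k (\<lambda>x. v s x - v t x) < 1) (at t within {0..})"
      by (rule order_tendstoD) simp
    then obtain d where d: "d > 0"
        "\<And>s. s \<ge> 0 \<Longrightarrow> s \<noteq> t \<Longrightarrow> \<bar>s - t\<bar> < d \<Longrightarrow> Hk_norm k (\<lambda>x. v s x - v t x) < 1"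
      by (auto simp: eventually_at dist_real_def)
    obtain s where s: "t < s" "s < t + d" "s > 0 \<longrightarrow> Hk_norm k (v s) \<le> B"
      using AE_lborel_in_interval[OF B, of t "t + d"] d(1) by auto
    have "in_Hk k (v s)" "in_Hk k (v t)" using C s t by (auto simp: C0_time_def)
    from nrm_wderiv_triangle[OF this j]
    have "nrm (wderiv j (v t)) \<le> nrm (wderiv j (v s)) + Hk_norm k (\<lambda>x. v s x - v t x)" .
    also have "\<dots> \<le> B + 1"
      using d(2)[of s] s t nrm_wderiv_le_Hk_norm[OF j, of "v s"] by (intro add_mono) auto
    finally show ?thesis by simp
  qed
  then show ?thesis by (intro exI[of _ "\<bar>B\<bar> + 1"]) auto
qed

text \<open>A primitive of a continuous function is differentiable everywhere; apply this to the primitive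
  of the first weak derivative, which itself is a primitive of the second.\<close>

lemma H2_representative:
  assumes "in_Hk 2 w"
  obtains W W1 W2 where "\<And>x. (W has_real_derivative W1 x) (at x)" "primitive W1 W2"
    "L2 W" "L2 W1" "L2 W2" "AE x in lborel. w x = W x" "AE x in lborel. wderiv 1 w x = W1 x"
    "nrm W = nrm (wderiv 0 w)" "nrm W1 = nrm (wderiv 1 w)" "nrm W2 = nrm (wderiv 2 w)"
proof -
  note w1 = in_Hk_wderiv[OF assms, of 1, simplified] and w2 = in_Hk_wderiv[OF assms, of 2, simplified]
  obtain W where W: "primitive W (wderiv 1 w)" "AE x in lborel. w x = W x"
    using weak_deriv_1_primitive[OF w1(1)[unfolded One_nat_def[symmetric]]] by metis
  obtain W1 where W1: "primitive W1 (wderiv 2 w)" "AE x in lborel. wderiv 1 w x = W1 x"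
    using weak_deriv_1_primitive[OF weak_deriv_2_imp_1[OF w1(1)[unfolded One_nat_def[symmetric]] w2(1)]]
    by (metis One_nat_def)
  note cW1 = primitive_continuous[OF W1(1)]
  have b: "W \<in> borel_measurable borel" "W1 \<in> borel_measurable borel"
    using primitive_continuous[OF W(1)] cW1 by (auto intro: borel_measurable_continuous_onI)
  have "primitive W W1" by (rule primitive_AE_cong[OF W(1) W1(2) b(2)])
  then have D: "(W has_real_derivative W1 x) (at x)" for x by (rule primitive_DERIV[OF _ cW1])
  have L: "L2 W" "L2 W1"
    using L2_cong_AE[OF in_Hk_L2(1)[OF assms] b(1) W(2)] L2_cong_AE[OF _ b(2) W1(2)] w1(2) by auto
  show ?thesis
  proof (rule that[OF D W1(1) L w2(2) W(2) W1(2)])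
    show "nrm W = nrm (wderiv 0 w)"
      unfolding in_Hk_L2(2)[OF assms] using W(2) b in_Hk_borel[OF assms]
      by (intro nrm_cong_AE) auto
    show "nrm W1 = nrm (wderiv 1 w)"
      using W1(2) b weak_deriv_borel(2)[OF w1(1)] by (intro nrm_cong_AE) auto
  qed simp
qed

section \<open>Solutions with classical spatial derivative\<close>

locale parabolic_law =
  fixes f \<sigma> :: "real \<Rightarrow> real" and c :: real
  assumes f_C1: "Ck 1 f" and \<sigma>_C1: "Ck 1 \<sigma>" and \<sigma>_0: "\<sigma> 0 = 0" and \<sigma>_pos: "deriv \<sigma> v > 0"
begin

lemma f_DERIV: "(f has_real_derivative deriv f x) (at x)"
  and \<sigma>_DERIV: "(\<sigma> has_real_derivative deriv \<sigma> x) (at x)"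
  using f_C1 \<sigma>_C1 Ck_Suc_DERIV[of 0] by auto

lemma f_cont: "continuous_on UNIV f" and \<sigma>_cont: "continuous_on UNIV \<sigma>"
  using DERIV_isCont[OF f_DERIV] DERIV_isCont[OF \<sigma>_DERIV] by (auto intro: continuous_at_imp_continuous_on)

lemma f_deriv_cont: "continuous_on UNIV (deriv f)" and \<sigma>_deriv_cont: "continuous_on UNIV (deriv \<sigma>)"
  using f_C1 \<sigma>_C1 by (auto simp: Ck_def)

lemma f_Lipschitz:
  obtains L where "L > 0" "\<And>a b. \<bar>a\<bar> \<le> M \<Longrightarrow> \<bar>b\<bar> \<le> M \<Longrightarrow> \<bar>f (c + a) - f (c + b)\<bar> \<le> L * \<bar>a - b\<bar>"
proof -
  obtain L where L: "L > 0" "\<And>x. x \<in> {c - M..c + M} \<Longrightarrow> \<bar>deriv f x\<bar> \<le> L"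
    using continuous_abs_bound[OF f_deriv_cont] by metis
  have "\<bar>f (c + a) - f (c + b)\<bar> \<le> L * \<bar>a - b\<bar>" if "\<bar>a\<bar> \<le> M" "\<bar>b\<bar> \<le> M" for a b
  proof -
    have "norm (f (c + a) - f (c + b)) \<le> L * norm ((c + a) - (c + b))"
      by (rule field_differentiable_bound[of "{c - M..c + M}" f "deriv f"])
         (use L that in \<open>auto intro: has_field_derivative_at_within[OF f_DERIV]\<close>)
    then show ?thesis by simp
  qed
  with L that show ?thesis by blast
qed

lemma \<sigma>_Lipschitz:
  obtains L where "L > 0" "\<And>v. \<bar>v\<bar> \<le> M \<Longrightarrow> \<bar>\<sigma> v\<bar> \<le> L * \<bar>v\<bar>"
proof -
  obtain L where L: "L > 0" "\<And>x. x \<in> {- M..M} \<Longrightarrow> \<bar>deriv \<sigma> x\<bar> \<le> L"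
    using continuous_abs_bound[OF \<sigma>_deriv_cont] by metis
  have "\<bar>\<sigma> v\<bar> \<le> L * \<bar>v\<bar>" if "\<bar>v\<bar> \<le> M" for v
  proof -
    have "norm (\<sigma> v - \<sigma> 0) \<le> L * norm (v - 0)"
      by (rule field_differentiable_bound[of "{- M..M}" \<sigma> "deriv \<sigma>"])
         (use L that in \<open>auto intro: has_field_derivative_at_within[OF \<sigma>_DERIV]\<close>)
    then show ?thesis using \<sigma>_0 by simp
  qed
  with L that show ?thesis by blast
qed

definition parabolicity_const :: "real \<Rightarrow> real \<Rightarrow> bool" where
  "parabolicity_const M m \<longleftrightarrow> m > 0 \<and>
     (\<forall>v w. \<bar>v\<bar> \<le> M \<longrightarrow> \<bar>w\<bar> \<le> M \<longrightarrow> m * (v - w)\<^sup>2 \<le> (\<sigma> v - \<sigma> w) * (v - w))"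

text \<open>By the mean value theorem, the minimum of \<open>\<sigma>'\<close> over the compact range of the gradients will do.\<close>

lemma parabolicity_const_exists:
  obtains m where "parabolicity_const M m"
proof -
  have "\<exists>x\<in>{- \<bar>M\<bar>..\<bar>M\<bar>}. \<forall>y\<in>{- \<bar>M\<bar>..\<bar>M\<bar>}. deriv \<sigma> x \<le> deriv \<sigma> y"
    by (rule continuous_attains_inf) (auto intro: continuous_on_subset[OF \<sigma>_deriv_cont])
  then obtain x where x: "\<And>y. \<bar>y\<bar> \<le> \<bar>M\<bar> \<Longrightarrow> deriv \<sigma> x \<le> deriv \<sigma> y" by force
  have *: "deriv \<sigma> x * (v - w) \<le> \<sigma> v - \<sigma> w" if vw: "\<bar>v\<bar> \<le> M" "\<bar>w\<bar> \<le> M" "w < v" for v w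
  proof -
    obtain z where z: "w < z" "z < v" "\<sigma> v - \<sigma> w = (v - w) * deriv \<sigma> z"
      using MVT2[OF vw(3), of \<sigma> "deriv \<sigma>"] \<sigma>_DERIV by blast
    then show ?thesis using x[of z] vw by (simp add: mult.commute mult_right_mono)
  qed
  have "deriv \<sigma> x * (v - w)\<^sup>2 \<le> (\<sigma> v - \<sigma> w) * (v - w)" if "\<bar>v\<bar> \<le> M" "\<bar>w\<bar> \<le> M" for v w
  proof (cases v w rule: linorder_cases)
    case less
    then show ?thesis using mult_right_mono[OF *[OF that(2,1) less], of "w - v"]
      by (simp add: power2_eq_square algebra_simps)
  next
    case greater
    then show ?thesis using mult_right_mono[OF *[OF that greater], of "v - w"]
      by (simp add: power2_eq_square algebra_simps)
  qed simp
  with \<sigma>_pos have "parabolicity_const M (deriv \<sigma> x)" by (simp add: parabolicity_const_def)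
  then show ?thesis by (rule that)
qed

end

text \<open>What the energy estimates use of a solution: \<open>w\<close>, \<open>wx\<close> and \<open>wt\<close> stand for \<open>u - c\<close> and its
  derivatives in \<open>x\<close> and in \<open>t\<close>, and one constant \<open>M\<close> serves for all bounds uniform in time.\<close>

locale classical_solution = parabolic_law +
  fixes M :: real and w wx wt :: "real \<Rightarrow> real \<Rightarrow> real"
  assumes w_DERIV: "t \<ge> 0 \<Longrightarrow> (w t has_real_derivative wx t x) (at x)"
    and wx_cont: "t \<ge> 0 \<Longrightarrow> continuous_on UNIV (wx t)"
    and w_L2: "t \<ge> 0 \<Longrightarrow> L2 (w t)" and wx_L2: "t \<ge> 0 \<Longrightarrow> L2 (wx t)" and wt_L2: "t \<ge> 0 \<Longrightarrow> L2 (wt t)"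
    and w_bound: "t \<ge> 0 \<Longrightarrow> \<bar>w t x\<bar> \<le> M" and wx_bound: "t \<ge> 0 \<Longrightarrow> \<bar>wx t x\<bar> \<le> M"
    and wx_nrm: "t \<ge> 0 \<Longrightarrow> nrm (wx t) \<le> M"
    and time_deriv: "t \<ge> 0 \<Longrightarrow>
      ((\<lambda>s. nrm (\<lambda>x. (w s x - w t x) / (s - t) - wt t x)) \<longlongrightarrow> 0) (at t within {0..})"
    and flux: "t > 0 \<Longrightarrow> primitive (\<lambda>x. f (c + w t x) - \<sigma> (wx t x)) (\<lambda>x. - wt t x)"

text \<open>The \<open>H\<^sup>2\<close> bound controls \<open>w\<close> and \<open>wx\<close> pointwise. The flux is continuous and almost everywhere
  equal to a primitive of \<open>- wt\<close>, hence equal to it.\<close>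

lemma (in parabolic_law) global_solution_imp_classical:
  assumes "global_solution f \<sigma> c u0 u"
  obtains M w wx wt where "classical_solution f \<sigma> c M w wx wt"
    "\<And>t. t \<ge> 0 \<Longrightarrow> AE x in lborel. u t x - c = w t x"
proof -
  define v where "v t x = u t x - c" for t x
  from assms obtain ut where td: "time_deriv u ut" and C: "C0_time 2 v" and L: "Linf_time 2 v"
    and Cut: "C0_time 0 ut"
    and eq: "\<And>t. t > 0 \<Longrightarrow> weak_deriv 1 (\<lambda>x. f (u t x) - \<sigma> (wderiv 1 (u t) x)) (\<lambda>x. - ut t x)"
    unfolding global_solution_def solution_class_def cauchy_problem_def v_def[abs_def] by blast
  have v_H2: "in_Hk 2 (v t)" if "t \<ge> 0" for t using C that by (auto simp: C0_time_def)
  define R where "R t W W1 W2 \<longleftrightarrow> (\<forall>x. (W has_real_derivative W1 x) (at x)) \<and> primitive W1 W2 \<and>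
      L2 W \<and> L2 W1 \<and> L2 W2 \<and> (AE x in lborel. v t x = W x) \<and> (AE x in lborel. wderiv 1 (v t) x = W1 x) \<and>
      nrm W = nrm (wderiv 0 (v t)) \<and> nrm W1 = nrm (wderiv 1 (v t)) \<and> nrm W2 = nrm (wderiv 2 (v t))" for t W W1 W2
  have "\<exists>W W1 W2. R t W W1 W2" if "t \<ge> 0" for t
    unfolding R_def by (rule H2_representative[OF v_H2[OF that]]) blast
  then obtain W W1 W2 where R: "\<And>t. t \<ge> 0 \<Longrightarrow> R t (W t) (W1 t) (W2 t)" by metis
  have W: "(W t has_real_derivative W1 t x) (at x)" "primitive (W1 t) (W2 t)"
      "L2 (W t)" "L2 (W1 t)" "L2 (W2 t)" "AE x in lborel. v t x = W t x"
      "AE x in lborel. wderiv 1 (v t) x = W1 t x"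
      "nrm (W t) = nrm (wderiv 0 (v t))" "nrm (W1 t) = nrm (wderiv 1 (v t))"
      "nrm (W2 t) = nrm (wderiv 2 (v t))" if "t \<ge> 0" for t x
    using R[OF that] unfolding R_def by blast+
  obtain B where B: "B > 0" "\<And>t j. t \<ge> 0 \<Longrightarrow> j \<le> 2 \<Longrightarrow> nrm (wderiv j (v t)) \<le> B"
    using C0_time_Linf_time_bounded[OF C L] by blast
  have Wc: "continuous_on UNIV (W t)" and W1c: "continuous_on UNIV (W1 t)" if "t \<ge> 0" for t
    using DERIV_isCont[OF W(1)[OF that]] primitive_continuous[OF W(2)[OF that]]
    by (auto intro: continuous_at_imp_continuous_on)
  have utL: "L2 (ut t)" if "t \<ge> 0" for t
    using Cut that in_Hk_L2(1) by (auto simp: C0_time_def)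
  have sq: "\<bar>a\<bar> \<le> 2 * B" if "a\<^sup>2 \<le> 2 * p * q" "p \<le> B" "q \<le> B" "0 \<le> p" "0 \<le> q" for a p q
  proof -
    have "p * q \<le> B * B" using that B(1) by (intro mult_mono) auto
    moreover have "a\<^sup>2 \<le> 2 * (p * q)" using that(1) by (simp add: mult.assoc)
    moreover have "(2 * B)\<^sup>2 = 4 * (B * B)" by (simp add: power2_eq_square)
    ultimately have "a\<^sup>2 \<le> (2 * B)\<^sup>2" using zero_le_square[of B] by linarith
    then show ?thesis using B(1) by (subst (asm) power2_le_iff_abs_le) auto
  qed
  have "classical_solution f \<sigma> c (2 * B) W W1 ut"
  proof
    fix t x :: real
    { assume t: "t \<ge> 0"
      note P = primitive_C1[OF W(1)[OF t] W1c[OF t]]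
      show "(W t has_real_derivative W1 t x) (at x)" "L2 (W t)" "L2 (W1 t)" by (rule W[OF t])+
      show "continuous_on UNIV (W1 t)" by (rule W1c[OF t])
      show "L2 (ut t)" by (rule utL[OF t])
      show "\<bar>W t x\<bar> \<le> 2 * B"
        using square_le_nrm_mult_nrm_deriv[OF P W(3,4)[OF t]] B(2)[OF t, of 0] B(2)[OF t, of 1] W(8,9)[OF t]
        by (intro sq[of _ "nrm (W t)" "nrm (W1 t)"]) auto
      show "\<bar>W1 t x\<bar> \<le> 2 * B"
        using square_le_nrm_mult_nrm_deriv[OF W(2,4,5)[OF t]] B(2)[OF t, of 2] B(2)[OF t, of 1] W(9,10)[OF t]
        by (intro sq[of _ "nrm (W1 t)" "nrm (W2 t)"]) auto
      show "nrm (W1 t) \<le> 2 * B" using B(1) B(2)[OF t, of 1] W(9)[OF t] by simp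
      have "nrm (\<lambda>x. (W s x - W t x) / (s - t) - ut t x) = Hk_norm 0 (\<lambda>x. (u s x - u t x) / (s - t) - ut t x)"
        if s: "s \<ge> 0" for s
      proof -
        have ub: "u r \<in> borel_measurable borel" if "r \<ge> 0" for r
          using borel_measurable_add[OF in_Hk_borel[OF v_H2[OF that]] borel_measurable_const, of c]
          by (simp add: v_def[abs_def])
        have L: "L2 (\<lambda>x. (1 / (s - t)) * (W s x - W t x) - ut t x)"
          by (intro L2_diff L2_cmult W(3) utL s t)
        have ae: "AE x in lborel. (1 / (s - t)) * (W s x - W t x) - ut t x = (u s x - u t x) / (s - t) - ut t x"
          using W(6)[OF s] W(6)[OF t] by eventually_elim (auto simp: v_def)
        have b: "(\<lambda>x. (u s x - u t x) / (s - t) - ut t x) \<in> borel_measurable borel"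
          using ub[OF s] ub[OF t] utL[OF t] by (auto simp: L2_def)
        have "Hk_norm 0 (\<lambda>x. (u s x - u t x) / (s - t) - ut t x) = nrm (\<lambda>x. (u s x - u t x) / (s - t) - ut t x)"
          by (rule Hk_norm_0[OF L2_cong_AE[OF L b ae]])
        also have "\<dots> = nrm (\<lambda>x. (1 / (s - t)) * (W s x - W t x) - ut t x)"
          by (rule nrm_cong_AE[OF b L2_borel[OF L]]) (use ae in eventually_elim, rule sym)
        finally show ?thesis by simp
      qed
      then have ev: "eventually (\<lambda>s. Hk_norm 0 (\<lambda>x. (u s x - u t x) / (s - t) - ut t x)
          = nrm (\<lambda>x. (W s x - W t x) / (s - t) - ut t x)) (at t within {0..})"
        by (auto simp: eventually_at_filter)
      have "((\<lambda>s. Hk_norm 0 (\<lambda>x. (u s x - u t x) / (s - t) - ut t x)) \<longlongrightarrow> 0) (at t within {0..})"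
        using td t by (auto simp: time_deriv_def)
      then show "((\<lambda>s. nrm (\<lambda>x. (W s x - W t x) / (s - t) - ut t x)) \<longlongrightarrow> 0) (at t within {0..})"
        by (rule Lim_transform_eventually[OF _ ev])
    }
    assume t: "t > 0"
    then have t0: "t \<ge> 0" by simp
    obtain G where G: "primitive G (\<lambda>x. - ut t x)"
        "AE x in lborel. f (u t x) - \<sigma> (wderiv 1 (u t) x) = G x"
      using weak_deriv_1_primitive[OF eq[OF t]] by metis
    have "weak_deriv 1 (u t) (wderiv 1 (v t))"
      by (rule weak_deriv_1_add_const[of _ c])
         (use in_Hk_wderiv(1)[OF v_H2[OF t0], of 1] in \<open>simp add: v_def[abs_def]\<close>)
    from wderiv_AE_eq[OF this] W(6,7)[OF t0] G(2)
    have "AE x in lborel. f (c + W t x) - \<sigma> (W1 t x) = G x"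
    proof eventually_elim
      case (elim x)
      then have "u t x = c + W t x" "wderiv 1 (u t) x = W1 t x" by (simp_all add: v_def)
      with elim show ?case by simp
    qed
    moreover have "continuous_on UNIV (\<lambda>x. f (c + W t x) - \<sigma> (W1 t x))"
      by (intro continuous_intros continuous_on_compose2[OF f_cont] continuous_on_compose2[OF \<sigma>_cont]
        Wc[OF t0] W1c[OF t0]) auto
    ultimately have "f (c + W t x) - \<sigma> (W1 t x) = G x" for x
      using primitive_continuous[OF G(1)] by (intro continuous_AE_eq_imp_eq)
    then show "primitive (\<lambda>x. f (c + W t x) - \<sigma> (W1 t x)) (\<lambda>x. - ut t x)" using G(1) by simp
  qed
  then show ?thesis using that W(6) by (auto simp: v_def)
qed

section \<open>Derivatives of energies in time\<close>

text \<open>A smooth nonlinearity that vanishes to second order at the origin, with its first two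
  derivatives.\<close>

definition entropy :: "(real \<Rightarrow> real) \<Rightarrow> (real \<Rightarrow> real) \<Rightarrow> (real \<Rightarrow> real) \<Rightarrow> bool" where
  "entropy \<Phi> \<Phi>1 \<Phi>2 \<longleftrightarrow> (\<forall>a. (\<Phi> has_real_derivative \<Phi>1 a) (at a)) \<and>
     (\<forall>a. (\<Phi>1 has_real_derivative \<Phi>2 a) (at a)) \<and> continuous_on UNIV \<Phi>2 \<and> \<Phi> 0 = 0 \<and> \<Phi>1 0 = 0"

lemma entropy_bounds:
  assumes "entropy \<Phi> \<Phi>1 \<Phi>2"
  obtains K where "K > 0"
    "\<And>a b. \<bar>a\<bar> \<le> M \<Longrightarrow> \<bar>b\<bar> \<le> M \<Longrightarrow> \<bar>\<Phi> b - \<Phi> a - \<Phi>1 a * (b - a)\<bar> \<le> K * (b - a)\<^sup>2"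
    "\<And>a. \<bar>a\<bar> \<le> M \<Longrightarrow> \<bar>\<Phi> a\<bar> \<le> K * a\<^sup>2" "\<And>a. \<bar>a\<bar> \<le> M \<Longrightarrow> \<bar>\<Phi>1 a\<bar> \<le> K * \<bar>a\<bar>"
    "\<And>a. \<bar>a\<bar> \<le> M \<Longrightarrow> \<bar>\<Phi>2 a\<bar> \<le> K"
proof -
  have D: "(\<Phi> has_real_derivative \<Phi>1 a) (at a)" "(\<Phi>1 has_real_derivative \<Phi>2 a) (at a)" for a
    using assms by (auto simp: entropy_def)
  have c: "continuous_on UNIV \<Phi>2" and 0: "\<Phi> 0 = 0" "\<Phi>1 0 = 0"
    using assms by (auto simp: entropy_def)
  obtain K where K: "K > 0" "\<And>x. x \<in> {- M..M} \<Longrightarrow> \<bar>\<Phi>2 x\<bar> \<le> K"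
    using continuous_abs_bound[OF c] by metis
  have 1: "\<bar>\<Phi>1 b - \<Phi>1 a\<bar> \<le> K * \<bar>b - a\<bar>" if "\<bar>a\<bar> \<le> M" "\<bar>b\<bar> \<le> M" for a b
  proof -
    have "norm (\<Phi>1 b - \<Phi>1 a) \<le> K * norm (b - a)"
      by (rule field_differentiable_bound[of "{- M..M}" \<Phi>1 \<Phi>2])
         (use K that in \<open>auto intro: has_field_derivative_at_within[OF D(2)]\<close>)
    then show ?thesis by simp
  qed
  have 2: "\<bar>\<Phi> b - \<Phi> a - \<Phi>1 a * (b - a)\<bar> \<le> K * (b - a)\<^sup>2" if ab: "\<bar>a\<bar> \<le> M" "\<bar>b\<bar> \<le> M" for a b
  proof -
    define g where "g y = \<Phi> y - \<Phi>1 a * y" for y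
    have gD: "(g has_real_derivative (\<Phi>1 y - \<Phi>1 a)) (at y within S)" for y S
      unfolding g_def by (auto intro!: derivative_eq_intros has_field_derivative_at_within[OF D(1)])
    have "norm (g b - g a) \<le> K * \<bar>b - a\<bar> * norm (b - a)"
    proof (rule field_differentiable_bound[of "{min a b..max a b}" g "\<lambda>y. \<Phi>1 y - \<Phi>1 a"])
      fix y assume y: "y \<in> {min a b..max a b}"
      have "\<bar>\<Phi>1 y - \<Phi>1 a\<bar> \<le> K * \<bar>y - a\<bar>" using ab y by (intro 1) auto
      also have "\<dots> \<le> K * \<bar>b - a\<bar>" using y K(1) by (intro mult_left_mono) auto
      finally show "norm (\<Phi>1 y - \<Phi>1 a) \<le> K * \<bar>b - a\<bar>" by simp
    qed (auto intro: gD)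
    then show ?thesis by (simp add: g_def algebra_simps power2_eq_square)
  qed
  show ?thesis
  proof (rule that[OF K(1) 2])
    fix a assume a: "\<bar>a\<bar> \<le> M"
    show "\<bar>\<Phi> a\<bar> \<le> K * a\<^sup>2" using 2[of 0 a] a 0 by simp
    show "\<bar>\<Phi>1 a\<bar> \<le> K * \<bar>a\<bar>" using 1[of 0 a] a 0 by simp
    show "\<bar>\<Phi>2 a\<bar> \<le> K" using K(2)[of a] a by (simp add: abs_le_iff)
  qed
qed

lemma entropy_continuous:
  assumes "entropy \<Phi> \<Phi>1 \<Phi>2"
  shows "continuous_on UNIV \<Phi>" "continuous_on UNIV \<Phi>1" "continuous_on UNIV \<Phi>2"
proof -
  from assms have D: "(\<Phi> has_real_derivative \<Phi>1 a) (at a)" "(\<Phi>1 has_real_derivative \<Phi>2 a) (at a)" for a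
    by (auto simp: entropy_def)
  show "continuous_on UNIV \<Phi>" "continuous_on UNIV \<Phi>1"
    using DERIV_isCont[OF D(1)] DERIV_isCont[OF D(2)] by (auto intro: continuous_at_imp_continuous_on)
  show "continuous_on UNIV \<Phi>2" using assms by (simp add: entropy_def)
qed

lemma entropy_compose:
  assumes ent: "entropy \<Phi> \<Phi>1 \<Phi>2" and v: "L2 v" and b: "\<And>x. \<bar>v x\<bar> \<le> M"
  shows "integrable lborel (\<lambda>x. \<Phi> (v x))" "L2 (\<lambda>x. \<Phi>1 (v x))"
proof -
  obtain K where K: "K > 0" "\<And>a. \<bar>a\<bar> \<le> M \<Longrightarrow> \<bar>\<Phi> a\<bar> \<le> K * a\<^sup>2" "\<And>a. \<bar>a\<bar> \<le> M \<Longrightarrow> \<bar>\<Phi>1 a\<bar> \<le> K * \<bar>a\<bar>"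
    using entropy_bounds[OF ent, of M] by metis
  have [measurable]: "\<Phi> \<in> borel_measurable borel" "\<Phi>1 \<in> borel_measurable borel" "v \<in> borel_measurable borel"
    using entropy_continuous[OF ent] v by (auto intro: borel_measurable_continuous_onI simp: L2_def)
  have "integrable lborel (\<lambda>x. K * (v x)\<^sup>2)" using L2_square[OF v] by simp
  then show "integrable lborel (\<lambda>x. \<Phi> (v x))"
    by (rule Bochner_Integration.integrable_bound) (use K b in auto)
  show "L2 (\<lambda>x. \<Phi>1 (v x))"
    by (rule L2_bound[OF v, of _ K]) (use K b in auto)
qed

text \<open>The difference quotient of the energy differs from the claimed derivative by the quadratic
  remainder of \<open>\<Phi>\<close>, which is of size \<open>\<bar>s - t\<bar>\<close>, and by a term that is linear in the error of the
  \<open>L\<^sup>2\<close> difference quotient of \<open>v\<close>.\<close>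

lemma energy_has_derivative:
  assumes ent: "entropy \<Phi> \<Phi>1 \<Phi>2" and t: "t \<ge> 0"
    and v: "\<And>s. s \<ge> 0 \<Longrightarrow> L2 (v s)" and b: "\<And>s x. s \<ge> 0 \<Longrightarrow> \<bar>v s x\<bar> \<le> M" and vt: "L2 vt"
    and lim: "((\<lambda>s. nrm (\<lambda>x. (v s x - v t x) / (s - t) - vt x)) \<longlongrightarrow> 0) (at t within {0..})"
  shows "((\<lambda>s. LINT x|lborel. \<Phi> (v s x)) has_real_derivative (LINT x|lborel. \<Phi>1 (v t x) * vt x))
    (at t within {0..})"
proof -
  obtain K where K: "K > 0"
    "\<And>a b. \<bar>a\<bar> \<le> M \<Longrightarrow> \<bar>b\<bar> \<le> M \<Longrightarrow> \<bar>\<Phi> b - \<Phi> a - \<Phi>1 a * (b - a)\<bar> \<le> K * (b - a)\<^sup>2"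
    using entropy_bounds[OF ent, of M] by metis
  define E where "E s = (LINT x|lborel. \<Phi> (v s x))" for s
  define D where "D = (LINT x|lborel. \<Phi>1 (v t x) * vt x)"
  define n where "n s = nrm (\<lambda>x. (v s x - v t x) / (s - t) - vt x)" for s
  note i = entropy_compose(1)[OF ent v b]
  note P = entropy_compose(2)[OF ent v[OF t] b[OF t]]
  have est: "\<bar>(E s - E t) / (s - t) - D\<bar> \<le> K * \<bar>s - t\<bar> * (n s + nrm vt)\<^sup>2 + nrm (\<lambda>x. \<Phi>1 (v t x)) * n s"
    if s: "s \<ge> 0" "s \<noteq> t" for s
  proof -
    define h where "h = s - t"
    have h: "h \<noteq> 0" using s by (simp add: h_def)
    define q where "q x = (v s x - v t x) / h" for x
    have qL: "L2 q" using L2_cmult[OF L2_diff[OF v[OF s(1)] v[OF t]], of "1 / h"]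
      by (simp add: q_def[abs_def])
    have n: "n s = nrm (\<lambda>x. q x - vt x)" by (simp add: n_def q_def h_def)
    have vs: "v s x = v t x + h * q x" for x using h by (simp add: q_def)
    define r where "r x = \<Phi> (v s x) - \<Phi> (v t x) - \<Phi>1 (v t x) * (h * q x)" for x
    have rb: "\<bar>r x\<bar> \<le> K * h\<^sup>2 * (q x)\<^sup>2" for x
      using K(2)[OF b[OF t] b[OF s(1)], of x x] by (simp add: r_def vs power_mult_distrib mult.assoc)
    have Pq: "integrable lborel (\<lambda>x. \<Phi>1 (v t x) * (h * q x))"
      by (intro L2_mult_integrable P L2_cmult qL)
    have ri: "integrable lborel r"
      unfolding r_def using i[OF s(1) s(1)] i[OF t t] Pq by auto
    have e: "E s - E t - h * D = (LINT x|lborel. r x) + h * (LINT x|lborel. \<Phi>1 (v t x) * (q x - vt x))"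
    proof -
      have e1: "(LINT x|lborel. r x) = E s - E t - h * (LINT x|lborel. \<Phi>1 (v t x) * q x)"
        unfolding r_def using i[OF s(1) s(1)] i[OF t t] Pq
        by (simp add: E_def mult.left_commute)
      have e2: "(LINT x|lborel. \<Phi>1 (v t x) * (q x - vt x)) = (LINT x|lborel. \<Phi>1 (v t x) * q x) - D"
        using L2_mult_integrable[OF P qL] L2_mult_integrable[OF P vt] by (simp add: D_def right_diff_distrib)
      show ?thesis unfolding e1 e2 by (simp add: right_diff_distrib)
    qed
    have "\<bar>LINT x|lborel. r x\<bar> \<le> (LINT x|lborel. \<bar>r x\<bar>)" by (rule integral_abs_bound)
    also have "\<dots> \<le> (LINT x|lborel. K * h\<^sup>2 * (q x)\<^sup>2)"
      using ri L2_square[OF qL] rb by (intro integral_mono) auto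
    also have "\<dots> = K * h\<^sup>2 * (nrm q)\<^sup>2" by (simp add: nrm_square)
    also have "\<dots> \<le> K * h\<^sup>2 * (n s + nrm vt)\<^sup>2"
      using nrm_triangle_diff[OF qL vt] K(1) unfolding n by (intro mult_left_mono power_mono) auto
    finally have 1: "\<bar>LINT x|lborel. r x\<bar> \<le> K * h\<^sup>2 * (n s + nrm vt)\<^sup>2" .
    have 2: "\<bar>h * (LINT x|lborel. \<Phi>1 (v t x) * (q x - vt x))\<bar> \<le> \<bar>h\<bar> * (nrm (\<lambda>x. \<Phi>1 (v t x)) * n s)"
      unfolding abs_mult n by (intro mult_left_mono abs_integral_mult_le P L2_diff qL vt) auto
    have "(E s - E t) / (s - t) - D = (E s - E t - h * D) / h"
      using h by (simp add: h_def diff_divide_distrib)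
    then have "\<bar>(E s - E t) / (s - t) - D\<bar> = \<bar>E s - E t - h * D\<bar> / \<bar>h\<bar>" by (simp add: abs_divide)
    also have "\<dots> \<le> (K * h\<^sup>2 * (n s + nrm vt)\<^sup>2 + \<bar>h\<bar> * (nrm (\<lambda>x. \<Phi>1 (v t x)) * n s)) / \<bar>h\<bar>"
      using 1 2 unfolding e by (intro divide_right_mono) auto
    also have "\<dots> = K * \<bar>h\<bar> * (n s + nrm vt)\<^sup>2 + nrm (\<lambda>x. \<Phi>1 (v t x)) * n s"
    proof -
      have "h\<^sup>2 / \<bar>h\<bar> = \<bar>h\<bar>" using h by (simp add: power2_eq_square abs_if)
      moreover have "K * h\<^sup>2 * X / \<bar>h\<bar> = K * (h\<^sup>2 / \<bar>h\<bar>) * X" for X by simp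
      ultimately show ?thesis using h by (simp add: add_divide_distrib)
    qed
    finally show ?thesis by (simp add: h_def)
  qed
  have nlim: "(n \<longlongrightarrow> 0) (at t within {0..})" using lim by (simp add: n_def[abs_def])
  have st: "((\<lambda>s. \<bar>s - t\<bar>) \<longlongrightarrow> \<bar>t - t\<bar>) (at t within {0..})" by (intro tendsto_intros)
  have "((\<lambda>s. K * \<bar>s - t\<bar> * (n s + nrm vt)\<^sup>2 + nrm (\<lambda>x. \<Phi>1 (v t x)) * n s)
      \<longlongrightarrow> K * \<bar>t - t\<bar> * (0 + nrm vt)\<^sup>2 + nrm (\<lambda>x. \<Phi>1 (v t x)) * 0) (at t within {0..})"
    by (intro tendsto_add tendsto_mult tendsto_power tendsto_const st nlim)
  then have "((\<lambda>s. K * \<bar>s - t\<bar> * (n s + nrm vt)\<^sup>2 + nrm (\<lambda>x. \<Phi>1 (v t x)) * n s) \<longlongrightarrow> 0) (at t within {0..})"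
    by simp
  moreover have "eventually (\<lambda>s. norm ((E s - E t) / (s - t) - D)
      \<le> K * \<bar>s - t\<bar> * (n s + nrm vt)\<^sup>2 + nrm (\<lambda>x. \<Phi>1 (v t x)) * n s) (at t within {0..})"
    using est by (auto simp: eventually_at_filter)
  ultimately have "((\<lambda>s. (E s - E t) / (s - t) - D) \<longlongrightarrow> 0) (at t within {0..})"
    by (rule Lim_null_comparison[rotated])
  then have "((\<lambda>s. (E s - E t) / (s - t)) \<longlongrightarrow> D) (at t within {0..})" by (rule LIM_zero_cancel)
  then show ?thesis unfolding has_field_derivative_iff E_def D_def .
qed

lemma nonincreasing_half_line:
  fixes g g' :: "real \<Rightarrow> real"
  assumes g: "\<And>t. t \<ge> 0 \<Longrightarrow> t \<le> T \<Longrightarrow> (g has_real_derivative g' t) (at t within {0..})"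
    and neg: "\<And>t. t > 0 \<Longrightarrow> t < T \<Longrightarrow> g' t \<le> 0" and st: "0 \<le> s" "s \<le> t" "t \<le> T"
  shows "g t \<le> g s"
proof (rule DERIV_nonpos_imp_decreasing_open[of s t g])
  fix x assume x: "s < x" "x < t"
  then have "at x within {0..} = at x" using st by (intro at_within_interior) auto
  then show "\<exists>y. (g has_real_derivative y) (at x) \<and> y \<le> 0"
    using g[of x] neg[of x] x st by auto
next
  have "continuous (at x within {s..t}) g" if "x \<in> {s..t}" for x
    using DERIV_continuous[OF g[of x]] that st by (auto intro: continuous_within_subset)
  then show "continuous_on {s..t} g" by (simp add: continuous_on_eq_continuous_within)
qed (rule st)

section \<open>Dissipation of convex entropies\<close>

context classical_solution
begin

lemma w_cont: "t \<ge> 0 \<Longrightarrow> continuous_on UNIV (w t)"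
  using DERIV_isCont[OF w_DERIV] by (auto intro: continuous_at_imp_continuous_on)

lemma M_nonneg: "0 \<le> M"
  using w_bound[of 0 0] by simp

lemma f_w_L2:
  assumes t: "t \<ge> 0" shows "L2 (\<lambda>x. f (c + w t x) - f c)"
proof -
  obtain L where L: "L > 0" "\<And>a b. \<bar>a\<bar> \<le> M \<Longrightarrow> \<bar>b\<bar> \<le> M \<Longrightarrow> \<bar>f (c + a) - f (c + b)\<bar> \<le> L * \<bar>a - b\<bar>"
    using f_Lipschitz by metis
  show ?thesis
  proof (rule L2_bound[OF w_L2[OF t], of _ L])
    show "(\<lambda>x. f (c + w t x) - f c) \<in> borel_measurable borel"
      by (intro borel_measurable_continuous_onI continuous_intros continuous_on_compose2[OF f_cont] w_cont t) auto
    show "\<bar>f (c + w t x) - f c\<bar> \<le> L * \<bar>w t x\<bar>" for x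
      using L(2)[OF w_bound[OF t], of 0 x] M_nonneg by simp
  qed
qed

lemma \<sigma>_wx_L2:
  assumes t: "t \<ge> 0" shows "L2 (\<lambda>x. \<sigma> (wx t x))"
proof -
  obtain L where L: "L > 0" "\<And>v. \<bar>v\<bar> \<le> M \<Longrightarrow> \<bar>\<sigma> v\<bar> \<le> L * \<bar>v\<bar>" using \<sigma>_Lipschitz by metis
  show ?thesis
  proof (rule L2_bound[OF wx_L2[OF t], of _ L])
    show "(\<lambda>x. \<sigma> (wx t x)) \<in> borel_measurable borel"
      by (intro borel_measurable_continuous_onI continuous_on_compose2[OF \<sigma>_cont] wx_cont t) auto
  qed (use L wx_bound[OF t] in auto)
qed

text \<open>The convective term is the derivative of a function of \<open>w\<close> that vanishes to second order.\<close>

lemma convection_conservative: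
  assumes ent: "entropy \<Phi> \<Phi>1 \<Phi>2" and t: "t \<ge> 0"
  shows "(LINT x|lborel. \<Phi>2 (w t x) * wx t x * (f (c + w t x) - f c)) = 0"
proof -
  obtain K where K: "K > 0" "\<And>a. \<bar>a\<bar> \<le> M \<Longrightarrow> \<bar>\<Phi>2 a\<bar> \<le> K"
    using entropy_bounds[OF ent, of M] by metis
  obtain L where L: "L > 0" "\<And>a b. \<bar>a\<bar> \<le> M \<Longrightarrow> \<bar>b\<bar> \<le> M \<Longrightarrow> \<bar>f (c + a) - f (c + b)\<bar> \<le> L * \<bar>a - b\<bar>"
    using f_Lipschitz by metis
  define \<psi> where "\<psi> a = \<Phi>2 a * (f (c + a) - f c)" for a
  have \<Phi>2c: "continuous_on UNIV \<Phi>2" using ent by (simp add: entropy_def)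
  have \<psi>c: "continuous_on UNIV \<psi>"
    unfolding \<psi>_def by (intro continuous_intros \<Phi>2c continuous_on_compose2[OF f_cont]) auto
  obtain \<Psi>' where "primitive \<Psi>' \<psi>" using primitive_exists[OF loc_integrable_continuous[OF \<psi>c]] ..
  then have "(\<Psi>' has_real_derivative \<psi> a) (at a)" for a by (rule primitive_DERIV[OF _ \<psi>c])
  then have \<Psi>D: "((\<lambda>a. \<Psi>' a - \<Psi>' 0) has_real_derivative \<psi> a) (at a)" for a
    by (auto intro!: derivative_eq_intros)
  define \<Psi> where "\<Psi> a = \<Psi>' a - \<Psi>' 0" for a
  note \<Psi>D = \<Psi>D[folded \<Psi>_def]
  have \<psi>b: "\<bar>\<psi> a\<bar> \<le> K * L * \<bar>a\<bar>" if "\<bar>a\<bar> \<le> M" for a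
    using mult_mono[OF K(2)[OF that] L(2)[OF that, of 0]] K(1) M_nonneg by (simp add: \<psi>_def abs_mult)
  have \<Psi>b: "\<bar>\<Psi> a\<bar> \<le> K * L * a\<^sup>2" if a: "\<bar>a\<bar> \<le> M" for a
  proof -
    have "norm (\<Psi> a - \<Psi> 0) \<le> K * L * \<bar>a\<bar> * norm (a - 0)"
    proof (rule field_differentiable_bound[of "{- \<bar>a\<bar>..\<bar>a\<bar>}" \<Psi> \<psi>])
      fix y assume y: "y \<in> {- \<bar>a\<bar>..\<bar>a\<bar>}"
      then have "\<bar>\<psi> y\<bar> \<le> K * L * \<bar>y\<bar>" using a by (intro \<psi>b) auto
      also have "\<dots> \<le> K * L * \<bar>a\<bar>" using y K(1) L(1) by (intro mult_left_mono) auto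
      finally show "norm (\<psi> y) \<le> K * L * \<bar>a\<bar>" by simp
    qed (auto intro: has_field_derivative_at_within[OF \<Psi>D])
    then show ?thesis by (simp add: \<Psi>_def power2_eq_square mult.assoc)
  qed
  have wc: "continuous_on UNIV (w t)" by (rule w_cont[OF t])
  have D: "((\<lambda>x. \<Psi> (w t x)) has_real_derivative \<psi> (w t x) * wx t x) (at x)" for x
    by (rule DERIV_chain2[OF \<Psi>D w_DERIV[OF t]])
  have "primitive (\<lambda>x. \<Psi> (w t x)) (\<lambda>x. \<psi> (w t x) * wx t x)"
    by (intro primitive_C1 D continuous_intros wx_cont t continuous_on_compose2[OF \<psi>c wc]) auto
  moreover have "integrable lborel (\<lambda>x. \<Psi> (w t x))"
  proof (rule Bochner_Integration.integrable_bound)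
    show "integrable lborel (\<lambda>x. K * L * (w t x)\<^sup>2)" using L2_square[OF w_L2[OF t]] by simp
    have "continuous_on UNIV (\<lambda>x. \<Psi> (w t x))"
      using DERIV_isCont[OF D] by (auto intro: continuous_at_imp_continuous_on)
    then show "(\<lambda>x. \<Psi> (w t x)) \<in> borel_measurable lborel"
      by (simp add: borel_measurable_continuous_onI)
    show "AE x in lborel. norm (\<Psi> (w t x)) \<le> norm (K * L * (w t x)\<^sup>2)"
      using \<Psi>b[OF w_bound[OF t]] K(1) L(1) by (intro AE_I2) simp
  qed
  moreover have "integrable lborel (\<lambda>x. \<psi> (w t x) * wx t x)"
  proof -
    have "L2 (\<lambda>x. \<Phi>2 (w t x) * wx t x)"
      by (rule L2_mult_bounded[OF wx_L2[OF t], of _ K])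
         (auto intro: K(2) w_bound[OF t] continuous_on_compose2[OF \<Phi>2c wc])
    from L2_mult_integrable[OF this f_w_L2[OF t]] show ?thesis by (simp add: \<psi>_def ac_simps)
  qed
  ultimately have "(LINT x|lborel. \<psi> (w t x) * wx t x) = 0" by (rule integral_deriv_eq_0)
  then show ?thesis by (simp add: \<psi>_def ac_simps)
qed

lemma flux_L2:
  assumes "t \<ge> 0" shows "L2 (\<lambda>x. f (c + w t x) - f c - \<sigma> (wx t x))"
  using L2_diff[OF f_w_L2[OF assms] \<sigma>_wx_L2[OF assms]] .

lemma flux_primitive:
  assumes t: "t > 0" shows "primitive (\<lambda>x. f (c + w t x) - f c - \<sigma> (wx t x)) (\<lambda>x. - wt t x)"
  using flux[OF t] by (simp add: primitive_def algebra_simps)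

text \<open>Integrate the equation by parts against \<open>\<Phi>' w\<close>. The constant \<open>f c\<close> is subtracted from the flux to
  make it square integrable.\<close>

lemma entropy_production:
  assumes ent: "entropy \<Phi> \<Phi>1 \<Phi>2" and t: "t > 0"
  shows "(LINT x|lborel. \<Phi>1 (w t x) * wt t x) = - (LINT x|lborel. \<Phi>2 (w t x) * wx t x * \<sigma> (wx t x))"
proof -
  have t0: "t \<ge> 0" using t by simp
  obtain K where K: "K > 0" "\<And>a. \<bar>a\<bar> \<le> M \<Longrightarrow> \<bar>\<Phi>2 a\<bar> \<le> K"
    using entropy_bounds[OF ent, of M] by metis
  note \<Phi>2c = entropy_continuous(3)[OF ent] and wc = w_cont[OF t0]
  have D: "((\<lambda>x. \<Phi>1 (w t x)) has_real_derivative \<Phi>2 (w t x) * wx t x) (at x)" for x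
    using ent by (intro DERIV_chain2[OF _ w_DERIV[OF t0]]) (simp add: entropy_def)
  have P: "primitive (\<lambda>x. \<Phi>1 (w t x)) (\<lambda>x. \<Phi>2 (w t x) * wx t x)"
    by (intro primitive_C1 D continuous_intros wx_cont t0 continuous_on_compose2[OF \<Phi>2c wc]) auto
  have PL: "L2 (\<lambda>x. \<Phi>2 (w t x) * wx t x)"
    by (rule L2_mult_bounded[OF wx_L2[OF t0], of _ K])
       (auto intro: K(2) w_bound[OF t0] continuous_on_compose2[OF \<Phi>2c wc])
  have "L2 (\<lambda>x. - wt t x)" using L2_cmult[OF wt_L2[OF t0], of "-1"] by simp
  from integral_by_parts[OF P flux_primitive[OF t] entropy_compose(2)[OF ent w_L2[OF t0] w_bound[OF t0]]
      PL flux_L2[OF t0] this]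
  have "(LINT x|lborel. \<Phi>1 (w t x) * wt t x)
      = (LINT x|lborel. \<Phi>2 (w t x) * wx t x * (f (c + w t x) - f c - \<sigma> (wx t x)))"
    by simp
  also have "\<dots> = (LINT x|lborel. \<Phi>2 (w t x) * wx t x * (f (c + w t x) - f c))
      - (LINT x|lborel. \<Phi>2 (w t x) * wx t x * \<sigma> (wx t x))"
    using L2_mult_integrable[OF PL f_w_L2[OF t0]] L2_mult_integrable[OF PL \<sigma>_wx_L2[OF t0]]
    by (simp add: right_diff_distrib)
  finally show ?thesis by (simp add: convection_conservative[OF ent t0])
qed

lemma entropy_DERIV:
  assumes ent: "entropy \<Phi> \<Phi>1 \<Phi>2" and t: "t \<ge> 0"
  shows "((\<lambda>s. LINT x|lborel. \<Phi> (w s x)) has_real_derivative (LINT x|lborel. \<Phi>1 (w t x) * wt t x))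
    (at t within {0..})"
  using ent t w_L2 w_bound wt_L2[OF t] time_deriv[OF t] by (rule energy_has_derivative)

lemma entropy_dissipation:
  assumes par: "parabolicity_const M m" and ent: "entropy \<Phi> \<Phi>1 \<Phi>2"
    and pos: "\<And>a. \<Phi>2 a \<ge> 0" and t: "t > 0"
  shows "integrable lborel (\<lambda>x. \<Phi>2 (w t x) * (wx t x)\<^sup>2) \<and>
    (LINT x|lborel. \<Phi>1 (w t x) * wt t x) \<le> - m * (LINT x|lborel. \<Phi>2 (w t x) * (wx t x)\<^sup>2)"
proof -
  have t0: "t \<ge> 0" using t by simp
  have m: "m * (v - w)\<^sup>2 \<le> (\<sigma> v - \<sigma> w) * (v - w)" if "\<bar>v\<bar> \<le> M" "\<bar>w\<bar> \<le> M" for v w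
    using par that by (simp add: parabolicity_const_def)
  obtain K where K: "K > 0" "\<And>a. \<bar>a\<bar> \<le> M \<Longrightarrow> \<bar>\<Phi>2 a\<bar> \<le> K"
    using entropy_bounds[OF ent, of M] by metis
  have PL: "L2 (\<lambda>x. \<Phi>2 (w t x) * wx t x)"
    by (rule L2_mult_bounded[OF wx_L2[OF t0], of _ K])
       (auto intro: K(2) w_bound[OF t0] continuous_on_compose2[OF entropy_continuous(3)[OF ent] w_cont[OF t0]])
  have i: "integrable lborel (\<lambda>x. \<Phi>2 (w t x) * (wx t x)\<^sup>2)"
    using L2_mult_integrable[OF PL wx_L2[OF t0]] by (simp add: power2_eq_square mult.assoc)
  have "m * (LINT x|lborel. \<Phi>2 (w t x) * (wx t x)\<^sup>2) = (LINT x|lborel. m * (\<Phi>2 (w t x) * (wx t x)\<^sup>2))"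
    by simp
  also have "\<dots> \<le> (LINT x|lborel. \<Phi>2 (w t x) * wx t x * \<sigma> (wx t x))"
  proof (rule integral_mono)
    fix x
    have "m * (wx t x)\<^sup>2 \<le> wx t x * \<sigma> (wx t x)"
      using m[OF wx_bound[OF t0], of 0 x] M_nonneg \<sigma>_0 by (simp add: mult.commute)
    from mult_left_mono[OF this pos[of "w t x"]]
    show "m * (\<Phi>2 (w t x) * (wx t x)\<^sup>2) \<le> \<Phi>2 (w t x) * wx t x * \<sigma> (wx t x)"
      by (simp add: mult.assoc mult.left_commute)
  qed (use i L2_mult_integrable[OF PL \<sigma>_wx_L2[OF t0]] in auto)
  finally show ?thesis using i by (simp add: entropy_production[OF ent t])
qed

lemma entropy_nonincreasing:
  assumes ent: "entropy \<Phi> \<Phi>1 \<Phi>2" and pos: "\<And>a. \<Phi>2 a \<ge> 0" and st: "0 \<le> s" "s \<le> t"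
  shows "(LINT x|lborel. \<Phi> (w t x)) \<le> (LINT x|lborel. \<Phi> (w s x))"
proof (rule nonincreasing_half_line[OF entropy_DERIV[OF ent], of t])
  fix r :: real assume "r > 0"
  obtain m where m: "parabolicity_const M m" by (rule parabolicity_const_exists)
  have "(LINT x|lborel. \<Phi>1 (w r x) * wt r x) \<le> - m * (LINT x|lborel. \<Phi>2 (w r x) * (wx r x)\<^sup>2)"
    using entropy_dissipation[OF m ent pos \<open>r > 0\<close>] by simp
  also have "\<dots> \<le> 0" using m pos by (simp add: parabolicity_const_def)
  finally show "(LINT x|lborel. \<Phi>1 (w r x) * wt r x) \<le> 0" .
qed (use st in auto)

end

section \<open>Uniqueness\<close>

lemma classical_solution_mono:
  assumes "classical_solution f \<sigma> c M w wx wt" "M \<le> M'"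
  shows "classical_solution f \<sigma> c M' w wx wt"
proof -
  interpret classical_solution f \<sigma> c M w wx wt by fact
  show ?thesis
    by unfold_locales (use w_DERIV wx_cont w_L2 wx_L2 wt_L2 time_deriv flux in auto,
        (use w_bound wx_bound wx_nrm assms(2) in \<open>meson order_trans\<close>)+)
qed

lemma nrm_diff_le: "L2 f \<Longrightarrow> L2 g \<Longrightarrow> nrm (\<lambda>x. f x - g x) \<le> nrm f + nrm g"
  using nrm_triangle[of f "\<lambda>x. (-1) * g x"] L2_cmult[of g "-1"] nrm_cmult[of "-1" g] by simp

text \<open>Gronwall for the \<open>L\<^sup>2\<close> norm of the difference: by strong monotonicity of \<open>\<sigma>\<close> the diffusion
  absorbs the derivative that falls on the difference in the convective term.\<close>

lemma (in parabolic_law) classical_solution_unique: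
  assumes A: "classical_solution f \<sigma> c M w wx wt" and B: "classical_solution f \<sigma> c M v vx vt"
    and init: "AE x in lborel. w 0 x = v 0 x" and T: "T \<ge> 0"
  shows "w T x = v T x"
proof -
  interpret A: classical_solution f \<sigma> c M w wx wt by fact
  interpret B: classical_solution f \<sigma> c M v vx vt by fact
  define d where "d t x = w t x - v t x" for t x
  define dx where "dx t x = wx t x - vx t x" for t x
  define dt where "dt t x = wt t x - vt t x" for t x
  have dL: "L2 (d t)" "L2 (dx t)" "L2 (dt t)" if "t \<ge> 0" for t
    using that A.w_L2 B.w_L2 A.wx_L2 B.wx_L2 A.wt_L2 B.wt_L2
    by (auto simp: d_def[abs_def] dx_def[abs_def] dt_def[abs_def] intro!: L2_diff)
  have db: "\<bar>d t x\<bar> \<le> 2 * M" if "t \<ge> 0" for t x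
    using A.w_bound[OF that, of x] B.w_bound[OF that, of x] by (simp add: d_def)
  have ent: "entropy (\<lambda>a. a\<^sup>2) (\<lambda>a. 2 * a) (\<lambda>_. 2)"
    by (auto simp: entropy_def intro!: derivative_eq_intros)
  define E where "E t = (LINT x|lborel. (d t x)\<^sup>2)" for t
  define E' where "E' t = (LINT x|lborel. 2 * d t x * dt t x)" for t
  have E_DERIV: "(E has_real_derivative E' t) (at t within {0..})" if t: "t \<ge> 0" for t
    unfolding E_def E'_def
  proof (rule energy_has_derivative[OF ent t dL(1) db dL(3)[OF t]])
    let ?a = "\<lambda>s x. (w s x - w t x) / (s - t) - wt t x"
    let ?b = "\<lambda>s x. (v s x - v t x) / (s - t) - vt t x"
    have "((\<lambda>s. nrm (?a s) + nrm (?b s)) \<longlongrightarrow> 0 + 0) (at t within {0..})"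
      using A.time_deriv[OF t] B.time_deriv[OF t] by (rule tendsto_add)
    then have lim: "((\<lambda>s. nrm (?a s) + nrm (?b s)) \<longlongrightarrow> 0) (at t within {0..})" by simp
    have "nrm (\<lambda>x. (d s x - d t x) / (s - t) - dt t x) \<le> nrm (?a s) + nrm (?b s)" if s: "s \<ge> 0" for s
    proof -
      have "L2 (?a s)" "L2 (?b s)"
        using L2_diff[OF L2_cmult[OF L2_diff[OF A.w_L2[OF s] A.w_L2[OF t]], of "1 / (s - t)"] A.wt_L2[OF t]]
          L2_diff[OF L2_cmult[OF L2_diff[OF B.w_L2[OF s] B.w_L2[OF t]], of "1 / (s - t)"] B.wt_L2[OF t]]
        by simp_all
      moreover have "(d s x - d t x) / (s - t) - dt t x = ?a s x - ?b s x" for x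
        by (simp add: d_def dt_def diff_divide_distrib)
      ultimately show ?thesis using nrm_diff_le[of "?a s" "?b s"] by simp
    qed
    then have "eventually (\<lambda>s. norm (nrm (\<lambda>x. (d s x - d t x) / (s - t) - dt t x)) \<le> nrm (?a s) + nrm (?b s))
        (at t within {0..})"
      by (auto simp: eventually_at_filter)
    then show "((\<lambda>s. nrm (\<lambda>x. (d s x - d t x) / (s - t) - dt t x)) \<longlongrightarrow> 0) (at t within {0..})"
      using lim by (rule Lim_null_comparison)
  qed
  obtain m where "parabolicity_const M m" by (rule parabolicity_const_exists)
  then have m: "m > 0"
    "\<And>a b. \<bar>a\<bar> \<le> M \<Longrightarrow> \<bar>b\<bar> \<le> M \<Longrightarrow> m * (a - b)\<^sup>2 \<le> (\<sigma> a - \<sigma> b) * (a - b)"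
    by (auto simp: parabolicity_const_def)
  obtain L where L: "L > 0" "\<And>a b. \<bar>a\<bar> \<le> M \<Longrightarrow> \<bar>b\<bar> \<le> M \<Longrightarrow> \<bar>f (c + a) - f (c + b)\<bar> \<le> L * \<bar>a - b\<bar>"
    using f_Lipschitz by metis
  \<comment> \<open>The constant left over when the square in \<open>q\<close> is completed below.\<close>
  define k where "k = L\<^sup>2 / (2 * m)"
  have E'_le: "E' t \<le> k * E t" if t: "t > 0" for t
  proof -
    have t0: "t \<ge> 0" using t by simp
    define F where "F x = (f (c + w t x) - f c - \<sigma> (wx t x)) - (f (c + v t x) - f c - \<sigma> (vx t x))" for x
    have FL: "L2 F" unfolding F_def by (intro L2_diff A.flux_L2 B.flux_L2 t0)
    have Fp: "primitive F (\<lambda>x. - dt t x)"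
      using primitive_diff[OF A.flux_primitive[OF t] B.flux_primitive[OF t]]
      by (simp add: F_def[abs_def] dt_def)
    have dp: "primitive (d t) (dx t)"
      unfolding d_def[abs_def] dx_def[abs_def]
      by (intro primitive_diff primitive_C1 A.w_DERIV B.w_DERIV A.wx_cont B.wx_cont t0)
    have "L2 (\<lambda>x. - dt t x)" using L2_cmult[OF dL(3)[OF t0], of "-1"] by simp
    from integral_by_parts[OF dp Fp dL(1,2)[OF t0] FL this]
    have "(LINT x|lborel. d t x * dt t x) = (LINT x|lborel. dx t x * F x)" by simp
    then have "E' t = 2 * (LINT x|lborel. dx t x * F x)" by (simp add: E'_def mult.assoc)
    also have "(LINT x|lborel. dx t x * F x) \<le> (LINT x|lborel. (k / 2) * (d t x)\<^sup>2)"
    proof (rule integral_mono)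
      fix x
      define p q where "p = \<bar>d t x\<bar>" and "q = \<bar>dx t x\<bar>"
      have "dx t x * F x = dx t x * (f (c + w t x) - f (c + v t x)) - (\<sigma> (wx t x) - \<sigma> (vx t x)) * dx t x"
        by (simp add: F_def algebra_simps)
      also have "\<dots> \<le> q * (L * p) - m * q\<^sup>2"
      proof (rule diff_mono)
        have "\<bar>dx t x * (f (c + w t x) - f (c + v t x))\<bar> \<le> q * (L * p)"
          unfolding abs_mult p_def q_def d_def
          by (intro mult_left_mono L(2) A.w_bound B.w_bound t0) auto
        then show "dx t x * (f (c + w t x) - f (c + v t x)) \<le> q * (L * p)" by linarith
        show "m * q\<^sup>2 \<le> (\<sigma> (wx t x) - \<sigma> (vx t x)) * dx t x"
          using m(2)[OF A.wx_bound[OF t0] B.wx_bound[OF t0], of x x] by (simp add: q_def dx_def)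
      qed
      also have "\<dots> = (k / 2) * p\<^sup>2 - (2 * m * q - L * p)\<^sup>2 / (4 * m)"
        using m(1) by (simp add: k_def power2_eq_square field_simps)
      also have "\<dots> \<le> (k / 2) * p\<^sup>2" using m(1) by simp
      finally show "dx t x * F x \<le> (k / 2) * (d t x)\<^sup>2" by (simp add: p_def)
    qed (use L2_mult_integrable[OF dL(2)[OF t0] FL] L2_square[OF dL(1)[OF t0]] in auto)
    finally show ?thesis by (simp add: E_def)
  qed
  have "E T * exp (- k * T) \<le> E 0 * exp (- k * 0)"
  proof (rule nonincreasing_half_line[where g = "\<lambda>t. E t * exp (- k * t)"
        and g' = "\<lambda>t. E' t * exp (- k * t) + (exp (- k * t) * (- k)) * E t" and T = T])
    show "((\<lambda>t. E t * exp (- k * t)) has_real_derivative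
        E' t * exp (- k * t) + (exp (- k * t) * (- k)) * E t) (at t within {0..})" if "t \<ge> 0" for t
      by (intro DERIV_mult E_DERIV that) (auto intro!: derivative_eq_intros)
    show "E' t * exp (- k * t) + (exp (- k * t) * (- k)) * E t \<le> 0" if "t > 0" for t
      using mult_right_mono[OF E'_le[OF that], of "exp (- k * t)"] by (simp add: algebra_simps)
  qed (use T in auto)
  moreover have "E 0 = 0"
    unfolding E_def using init by (intro integral_eq_zero_AE) (auto simp: d_def)
  ultimately have "E T \<le> 0" by (simp add: mult_le_0_iff)
  moreover have "E T \<ge> 0" by (simp add: E_def)
  ultimately have "E T = 0" by linarith
  then have "(LINT x|lborel. (d T x)\<^sup>2) = 0" by (simp add: E_def)
  then have "AE x in lborel. (d T x)\<^sup>2 = 0"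
    by (subst (asm) integral_nonneg_eq_0_iff_AE) (use L2_square[OF dL(1)[OF T]] in auto)
  then have "AE x in lborel. w T x = v T x" by eventually_elim (simp add: d_def)
  then show ?thesis by (intro continuous_AE_eq_imp_eq A.w_cont B.w_cont T)
qed

section \<open>Contraction in the integral norm\<close>

text \<open>A smooth convex approximation of the absolute value from below.\<close>

definition soft_abs :: "real \<Rightarrow> real \<Rightarrow> real" where
  "soft_abs \<delta> a = sqrt (a\<^sup>2 + \<delta>\<^sup>2) - \<delta>"

lemma soft_abs_bounds:
  assumes "\<delta> > 0"
  shows "0 \<le> soft_abs \<delta> a" "soft_abs \<delta> a \<le> \<bar>a\<bar>" "\<bar>a\<bar> - \<delta> \<le> soft_abs \<delta> a"
proof -
  have "sqrt (\<delta>\<^sup>2) \<le> sqrt (a\<^sup>2 + \<delta>\<^sup>2)" "sqrt (a\<^sup>2) \<le> sqrt (a\<^sup>2 + \<delta>\<^sup>2)" by simp_all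
  then show "0 \<le> soft_abs \<delta> a" "\<bar>a\<bar> - \<delta> \<le> soft_abs \<delta> a"
    using assms by (simp_all add: soft_abs_def)
  show "soft_abs \<delta> a \<le> \<bar>a\<bar>"
    using sqrt_sum_squares_le_sum_abs[of a \<delta>] assms by (simp add: soft_abs_def)
qed

lemma entropy_soft_abs:
  assumes "\<delta> > 0"
  shows "entropy (soft_abs \<delta>) (\<lambda>a. a / sqrt (a\<^sup>2 + \<delta>\<^sup>2)) (\<lambda>a. \<delta>\<^sup>2 / (sqrt (a\<^sup>2 + \<delta>\<^sup>2)) ^ 3)"
  unfolding entropy_def
proof safe
  fix a :: real
  define s where "s = sqrt (a\<^sup>2 + \<delta>\<^sup>2)"
  have pos: "a\<^sup>2 + \<delta>\<^sup>2 > 0" for a using assms by (simp add: add_nonneg_pos)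
  have s: "s > 0" "s\<^sup>2 = a\<^sup>2 + \<delta>\<^sup>2" using pos[of a] by (auto simp: s_def)
  have sD: "((\<lambda>a. sqrt (a\<^sup>2 + \<delta>\<^sup>2)) has_real_derivative a / s) (at a)"
    using pos[of a] unfolding s_def by (auto intro!: derivative_eq_intros simp: field_simps)
  show "(soft_abs \<delta> has_real_derivative a / sqrt (a\<^sup>2 + \<delta>\<^sup>2)) (at a)"
    using DERIV_diff[OF sD DERIV_const[of \<delta>]] by (simp add: soft_abs_def[abs_def] s_def)
  have "((\<lambda>a. a / sqrt (a\<^sup>2 + \<delta>\<^sup>2)) has_real_derivative (1 * s - a * (a / s)) / (s * s)) (at a)"
    using DERIV_divide[OF DERIV_ident sD] assms by (simp add: s_def)
  moreover have "(1 * s - a * (a / s)) / (s * s) = \<delta>\<^sup>2 / s ^ 3"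
    using s by (simp add: field_simps power2_eq_square power3_eq_cube)
  ultimately show "((\<lambda>a. a / sqrt (a\<^sup>2 + \<delta>\<^sup>2)) has_real_derivative \<delta>\<^sup>2 / (sqrt (a\<^sup>2 + \<delta>\<^sup>2)) ^ 3) (at a)"
    by (simp add: s_def)
  show "continuous_on UNIV (\<lambda>a. \<delta>\<^sup>2 / (sqrt (a\<^sup>2 + \<delta>\<^sup>2)) ^ 3)"
    using pos by (intro continuous_intros) (auto simp: less_imp_neq[symmetric])
qed (use assms in \<open>auto simp: soft_abs_def\<close>)

text \<open>The integrals of the smooth approximations do not increase in time; Fatou's lemma passes to the
  limit and provides integrability at later times along with the bound.\<close>

lemma (in classical_solution) L1_contraction:
  assumes init: "integrable lborel (w 0)" and t: "t \<ge> 0"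
  shows "integrable lborel (w t)" "(LINT x|lborel. \<bar>w t x\<bar>) \<le> (LINT x|lborel. \<bar>w 0 x\<bar>)"
proof -
  define A where "A = (LINT x|lborel. \<bar>w 0 x\<bar>)"
  define \<delta> where "\<delta> n = 1 / (real n + 1)" for n
  have \<delta>: "\<delta> n > 0" for n by (simp add: \<delta>_def)
  have \<delta>0: "\<delta> \<longlonglongrightarrow> 0"
    using LIMSEQ_inverse_real_of_nat by (simp add: \<delta>_def[abs_def] inverse_eq_divide add.commute)
  note ent = entropy_soft_abs[OF \<delta>]
  have wm[measurable]: "w t \<in> borel_measurable borel" using w_L2[OF t] by (simp add: L2_def)
  have [measurable]: "soft_abs (\<delta> n) \<in> borel_measurable borel" for n
    by (intro borel_measurable_continuous_onI entropy_continuous(1)[OF ent])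
  have le: "(\<integral>\<^sup>+x. ennreal (soft_abs (\<delta> n) (w t x)) \<partial>lborel) \<le> ennreal A" for n
  proof -
    have i: "integrable lborel (\<lambda>x. soft_abs (\<delta> n) (w s x))" if "s \<ge> 0" for s
      by (rule entropy_compose(1)[OF ent w_L2[OF that] w_bound[OF that]])
    have "(LINT x|lborel. soft_abs (\<delta> n) (w t x)) \<le> (LINT x|lborel. soft_abs (\<delta> n) (w 0 x))"
      by (rule entropy_nonincreasing[OF ent]) (use t in auto)
    also have "\<dots> \<le> A" unfolding A_def
      by (rule integral_mono) (use i[of 0] init soft_abs_bounds[OF \<delta>] in auto)
    finally have "ennreal (LINT x|lborel. soft_abs (\<delta> n) (w t x)) \<le> ennreal A" by (rule ennreal_leI)
    then show ?thesis
      by (subst nn_integral_eq_integral[OF i[OF t]]) (use soft_abs_bounds[OF \<delta>] in auto)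
  qed
  have lim: "(\<lambda>n. soft_abs (\<delta> n) a) \<longlonglongrightarrow> \<bar>a\<bar>" for a
  proof (rule real_tendsto_sandwich)
    show "eventually (\<lambda>n. \<bar>a\<bar> - \<delta> n \<le> soft_abs (\<delta> n) a) sequentially"
      "eventually (\<lambda>n. soft_abs (\<delta> n) a \<le> \<bar>a\<bar>) sequentially"
      using soft_abs_bounds[OF \<delta>] by auto
    show "(\<lambda>n. \<bar>a\<bar> - \<delta> n) \<longlonglongrightarrow> \<bar>a\<bar>" using tendsto_diff[OF tendsto_const \<delta>0, of "\<bar>a\<bar>"] by simp
  qed simp
  have "(\<integral>\<^sup>+x. ennreal \<bar>w t x\<bar> \<partial>lborel) = (\<integral>\<^sup>+x. liminf (\<lambda>n. ennreal (soft_abs (\<delta> n) (w t x))) \<partial>lborel)"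
  proof (rule nn_integral_cong)
    fix x
    have "(\<lambda>n. ennreal (soft_abs (\<delta> n) (w t x))) \<longlonglongrightarrow> ennreal \<bar>w t x\<bar>"
      by (intro tendsto_ennrealI lim)
    then show "ennreal \<bar>w t x\<bar> = liminf (\<lambda>n. ennreal (soft_abs (\<delta> n) (w t x)))"
      by (intro lim_imp_Liminf[symmetric]) auto
  qed
  also have "\<dots> \<le> liminf (\<lambda>n. \<integral>\<^sup>+x. ennreal (soft_abs (\<delta> n) (w t x)) \<partial>lborel)"
    by (rule nn_integral_liminf) measurable
  also have "\<dots> \<le> liminf (\<lambda>n. ennreal A)"
    by (intro Liminf_mono) (use le in auto)
  also have "\<dots> = ennreal A" by (simp add: Liminf_const)
  finally have fin: "(\<integral>\<^sup>+x. ennreal \<bar>w t x\<bar> \<partial>lborel) \<le> ennreal A" .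
  show i: "integrable lborel (w t)"
  proof (rule integrableI_bounded)
    have "(\<integral>\<^sup>+x. ennreal (norm (w t x)) \<partial>lborel) \<le> ennreal A" using fin by simp
    then show "(\<integral>\<^sup>+x. ennreal (norm (w t x)) \<partial>lborel) < \<infinity>" by (rule order_le_less_trans) simp
  qed simp
  have "ennreal (LINT x|lborel. \<bar>w t x\<bar>) \<le> ennreal A"
    using fin i by (subst (asm) nn_integral_eq_integral) auto
  then show "(LINT x|lborel. \<bar>w t x\<bar>) \<le> (LINT x|lborel. \<bar>w 0 x\<bar>)"
    by (subst (asm) ennreal_le_iff) (auto simp: A_def)
qed

section \<open>Decay rates\<close>

text \<open>While \<open>y\<close> is positive, \<open>(1 / y\<^sup>2)' \<ge> 2 k (1 + t)\<^sup>j\<close>, which can be integrated; as \<open>y\<close> does not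
  increase, it is positive up to every time at which it does not vanish.\<close>

lemma cubic_decay:
  fixes y y' :: "real \<Rightarrow> real"
  assumes nonneg: "\<And>t. t \<ge> 0 \<Longrightarrow> y t \<ge> 0"
    and D: "\<And>t. t \<ge> 0 \<Longrightarrow> (y has_real_derivative y' t) (at t within {0..})"
    and le: "\<And>t. t > 0 \<Longrightarrow> y' t \<le> - k * (1 + t) ^ j * y t ^ 3"
    and k: "k > 0" and T: "T \<ge> 0"
  shows "(y T)\<^sup>2 * (1 + T) ^ Suc j \<le> real (Suc j) / (2 * k) + (y 0)\<^sup>2"
proof (cases "y T = 0")
  case True
  then show ?thesis using k by simp
next
  case False
  have "y' t \<le> 0" if "t > 0" for t
  proof -
    have "0 \<le> k * (1 + t) ^ j * y t ^ 3" using k that nonneg[of t] by simp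
    then show ?thesis using le[OF that] by simp
  qed
  then have mono: "y t \<le> y s" if "0 \<le> s" "s \<le> t" for s t
    using nonincreasing_half_line[of t y y' s t] D that by auto
  have pos: "y s > 0" if "0 \<le> s" "s \<le> T" for s
    using mono[OF that] nonneg[OF T] False by linarith
  define \<alpha> where "\<alpha> = 2 * k / real (Suc j)"
  have \<alpha>: "\<alpha> > 0" using k by (simp add: \<alpha>_def)
  define q where "q = (1 + T) ^ Suc j"
  have "\<alpha> * (1 + T) ^ Suc j - 1 / (y T)\<^sup>2 \<le> \<alpha> * (1 + 0) ^ Suc j - 1 / (y 0)\<^sup>2"
  proof (rule nonincreasing_half_line[where g = "\<lambda>t. \<alpha> * (1 + t) ^ Suc j - 1 / (y t)\<^sup>2"
        and g' = "\<lambda>t. 2 * k * (1 + t) ^ j + 2 * y' t / y t ^ 3" and T = T])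
    fix t assume t: "0 \<le> t" "t \<le> T"
    have yp: "y t > 0" by (rule pos[OF t])
    have 1: "((\<lambda>t. \<alpha> * (1 + t) ^ Suc j) has_real_derivative 2 * k * (1 + t) ^ j) (at t within {0..})"
      unfolding \<alpha>_def by (auto intro!: derivative_eq_intros simp del: power_Suc simp: divide_simps)
    have 2: "((\<lambda>t. 1 / (y t)\<^sup>2) has_real_derivative - (2 * y' t / y t ^ 3)) (at t within {0..})"
      using yp by (auto intro!: derivative_eq_intros D[OF t(1)] simp: field_simps power2_eq_square power3_eq_cube)
    show "((\<lambda>t. \<alpha> * (1 + t) ^ Suc j - 1 / (y t)\<^sup>2) has_real_derivative
        2 * k * (1 + t) ^ j + 2 * y' t / y t ^ 3) (at t within {0..})"
      using DERIV_diff[OF 1 2] by simp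
  next
    fix t assume t: "0 < t" "t < T"
    have yp: "y t > 0" using t by (intro pos) auto
    have "y' t / y t ^ 3 \<le> (- k * (1 + t) ^ j * y t ^ 3) / y t ^ 3"
      using yp by (intro divide_right_mono le t) auto
    also have "\<dots> = - k * (1 + t) ^ j" using yp by simp
    finally show "2 * k * (1 + t) ^ j + 2 * y' t / y t ^ 3 \<le> 0" by simp
  qed (use T in auto)
  then have *: "\<alpha> * (q - 1) + 1 / (y 0)\<^sup>2 \<le> 1 / (y T)\<^sup>2" by (simp add: q_def algebra_simps)
  have y0: "y 0 > 0" and yT: "y T > 0" using pos T by auto
  have q: "q \<ge> 1" using T unfolding q_def by (intro one_le_power) simp
  define C where "C = 1 / \<alpha> + (y 0)\<^sup>2"
  have C: "C > 0" using \<alpha> by (simp add: C_def add_pos_nonneg)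
  have "q = (1 / \<alpha>) * (\<alpha> * (q - 1)) + (y 0)\<^sup>2 * (1 / (y 0)\<^sup>2)" using \<alpha> y0 by simp
  also have "\<dots> \<le> C * (\<alpha> * (q - 1)) + C * (1 / (y 0)\<^sup>2)"
    using \<alpha> q y0 unfolding C_def by (intro add_mono mult_right_mono) auto
  also have "\<dots> = C * (\<alpha> * (q - 1) + 1 / (y 0)\<^sup>2)" by (simp add: distrib_left)
  also have "\<dots> \<le> C * (1 / (y T)\<^sup>2)" using * C by (intro mult_left_mono) auto
  finally have "(y T)\<^sup>2 * q \<le> C" using yT by (simp add: field_simps)
  then show ?thesis by (simp add: q_def C_def \<alpha>_def)
qed

lemma entropy_even_power:
  assumes n: "n \<ge> 1"
  shows "entropy (\<lambda>a. a ^ (2 * n)) (\<lambda>a. real (2 * n) * a ^ (2 * n - 1))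
    (\<lambda>a. real (2 * n) * (real (2 * n - 1) * a ^ (2 * n - 2)))"
  unfolding entropy_def
proof safe
  fix a :: real
  show "((\<lambda>a. a ^ (2 * n)) has_real_derivative real (2 * n) * a ^ (2 * n - 1)) (at a)"
    using DERIV_pow[of "2 * n" a] by simp
  have "((\<lambda>a. a ^ (2 * n - 1)) has_real_derivative real (2 * n - 1) * a ^ (2 * n - 1 - 1)) (at a)"
    using DERIV_pow[of "2 * n - 1" a] by simp
  from DERIV_cmult[OF this, of "real (2 * n)"]
  show "((\<lambda>a. real (2 * n) * a ^ (2 * n - 1)) has_real_derivative
      real (2 * n) * (real (2 * n - 1) * a ^ (2 * n - 2))) (at a)"
    by (simp add: numeral_2_eq_2)
qed (use n in \<open>auto intro!: continuous_intros\<close>)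

context classical_solution
begin

text \<open>The moment of order \<open>n\<close> decays like \<open>(1 + t)\<^bsup>- (n - 1) / 2\<^esup>\<close>, the rate of the heat kernel; it is
  squared to keep the exponent a natural number.\<close>

definition moment_decay :: "nat \<Rightarrow> real \<Rightarrow> bool" where
  "moment_decay n C \<longleftrightarrow> (\<forall>t\<ge>0. integrable lborel (\<lambda>x. \<bar>w t x\<bar> ^ n) \<and>
     (LINT x|lborel. \<bar>w t x\<bar> ^ n)\<^sup>2 * (1 + t) ^ (n - 1) \<le> C)"

lemma w_power_L2:
  assumes n: "n \<ge> 1" and t: "t \<ge> 0"
  shows "L2 (\<lambda>x. w t x ^ n)"
proof (rule L2_bound[OF w_L2[OF t], of _ "M ^ (n - 1)"])
  show "(\<lambda>x. w t x ^ n) \<in> borel_measurable borel"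
    by (intro borel_measurable_continuous_onI continuous_intros w_cont t)
  fix x
  have "\<bar>w t x ^ n\<bar> = \<bar>w t x\<bar> ^ (n - 1) * \<bar>w t x\<bar>"
    using n by (cases n) (auto simp: power_abs abs_mult)
  also have "\<dots> \<le> M ^ (n - 1) * \<bar>w t x\<bar>"
    by (intro mult_right_mono power_mono w_bound t) auto
  finally show "\<bar>w t x ^ n\<bar> \<le> M ^ (n - 1) * \<bar>w t x\<bar>" .
qed

lemma w_power_DERIV:
  assumes t: "t \<ge> 0"
  shows "((\<lambda>x. w t x ^ n) has_real_derivative real n * w t x ^ (n - 1) * wx t x) (at x)"
  using DERIV_power[OF w_DERIV[OF t], of n x] by (simp add: mult.commute mult.left_commute)

lemma w_power_primitive:
  assumes t: "t \<ge> 0"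
  shows "primitive (\<lambda>x. w t x ^ n) (\<lambda>x. real n * w t x ^ (n - 1) * wx t x)"
  by (intro primitive_C1 w_power_DERIV continuous_intros w_cont wx_cont t)

lemma w_power_deriv_L2:
  assumes t: "t \<ge> 0"
  shows "L2 (\<lambda>x. real n * w t x ^ (n - 1) * wx t x)"
proof (rule L2_mult_bounded[OF wx_L2[OF t], of _ "real n * M ^ (n - 1)"])
  show "continuous_on UNIV (\<lambda>x. real n * w t x ^ (n - 1))"
    by (intro continuous_intros w_cont t)
  show "\<bar>real n * w t x ^ (n - 1)\<bar> \<le> real n * M ^ (n - 1)" for x
    unfolding abs_mult power_abs by (simp add: mult_left_mono power_mono w_bound[OF t])
qed

text \<open>Nash's inequality for \<open>w\<^sup>n\<close> turns the decay of the moment of order \<open>n\<close> into a cubic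
  differential inequality for the moment of order \<open>2 n\<close>.\<close>

lemma moment_decay_double:
  assumes n: "n \<ge> 1" and C: "moment_decay n C"
  shows "\<exists>C'. moment_decay (2 * n) C'"
proof -
  obtain m where par: "parabolicity_const M m" by (rule parabolicity_const_exists)
  then have m: "m > 0" by (simp add: parabolicity_const_def)
  let ?\<Phi>1 = "\<lambda>a. real (2 * n) * a ^ (2 * n - 1)"
  let ?\<Phi>2 = "\<lambda>a. real (2 * n) * (real (2 * n - 1) * a ^ (2 * n - 2))"
  note ent = entropy_even_power[OF n]
  define E where "E t = (LINT x|lborel. w t x ^ (2 * n))" for t
  define E' where "E' t = (LINT x|lborel. ?\<Phi>1 (w t x) * wt t x)" for t
  define D where "D t = (LINT x|lborel. (real n * w t x ^ (n - 1) * wx t x)\<^sup>2)" for t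
  have E_DERIV: "(E has_real_derivative E' t) (at t within {0..})" if "t \<ge> 0" for t
    unfolding E_def E'_def by (rule entropy_DERIV[OF ent that])
  have E_nonneg: "E t \<ge> 0" for t by (simp add: E_def zero_le_even_power)
  have D_nonneg: "D t \<ge> 0" for t by (simp add: D_def)
  have diss: "E' t \<le> - (2 * m) * D t" if t: "t > 0" for t
  proof -
    have t0: "t \<ge> 0" using t by simp
    have "even (2 * n - 2)" by simp
    then have pos: "?\<Phi>2 a \<ge> 0" for a by (auto intro!: mult_nonneg_nonneg simp: zero_le_even_power)
    note d = entropy_dissipation[OF par ent pos t]
    have "2 * D t = (LINT x|lborel. 2 * (real n * w t x ^ (n - 1) * wx t x)\<^sup>2)" by (simp add: D_def)
    also have "\<dots> \<le> (LINT x|lborel. ?\<Phi>2 (w t x) * (wx t x)\<^sup>2)"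
    proof (rule integral_mono)
      fix x
      have p: "w t x ^ (2 * n - 2) = (w t x ^ (n - 1))\<^sup>2"
        by (simp add: power_mult[symmetric] right_diff_distrib' mult.commute)
      \<comment> \<open>This is \<open>2 n - 1 \<ge> n\<close>, in the form needed to compare the two integrands.\<close>
      have "real n * (2 * real n) \<le> real (2 * n) * real (2 * n - 1)"
        using n by (simp add: of_nat_diff algebra_simps)
      then have "(2 * (real n)\<^sup>2) * ((w t x ^ (n - 1))\<^sup>2 * (wx t x)\<^sup>2)
          \<le> (real (2 * n) * real (2 * n - 1)) * ((w t x ^ (n - 1))\<^sup>2 * (wx t x)\<^sup>2)"
        by (intro mult_right_mono) (auto simp: power2_eq_square)
      then show "2 * (real n * w t x ^ (n - 1) * wx t x)\<^sup>2 \<le> ?\<Phi>2 (w t x) * (wx t x)\<^sup>2"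
        unfolding p by (simp add: power_mult_distrib mult.assoc)
    qed (use L2_square[OF w_power_deriv_L2[OF t0]] d in auto)
    finally have "m * (2 * D t) \<le> m * (LINT x|lborel. ?\<Phi>2 (w t x) * (wx t x)\<^sup>2)"
      using m by (intro mult_left_mono) auto
    then show ?thesis using d unfolding E'_def by simp
  qed
  \<comment> \<open>The summand 1 only serves to make \<open>K\<close> positive.\<close>
  define K where "K = 4 * C\<^sup>2 + 1"
  have K: "K > 0" by (simp add: K_def add_nonneg_pos)
  have nash: "(1 + t) ^ (2 * n - 2) * E t ^ 3 \<le> K * D t" if t: "t \<ge> 0" for t
  proof -
    define A where "A = (LINT x|lborel. \<bar>w t x ^ n\<bar>)"
    have A: "A\<^sup>2 * (1 + t) ^ (n - 1) \<le> C" and i: "integrable lborel (\<lambda>x. \<bar>w t x\<bar> ^ n)"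
      using C t by (auto simp: moment_decay_def A_def power_abs)
    have "integrable lborel (\<lambda>x. w t x ^ n)"
      by (rule Bochner_Integration.integrable_bound[OF i])
         (use w_power_L2[OF n t] in \<open>auto simp: L2_def power_abs\<close>)
    from nash_inequality[OF w_power_primitive[OF t] w_power_L2[OF n t] w_power_deriv_L2[OF t] this]
    have N: "E t ^ 3 \<le> 4 * D t * A ^ 4"
      by (simp add: E_def D_def A_def power_mult[symmetric] mult.commute)
    have "0 \<le> A\<^sup>2 * (1 + t) ^ (n - 1)" using t by simp
    then have "(A\<^sup>2 * (1 + t) ^ (n - 1))\<^sup>2 \<le> C\<^sup>2" using A by (intro power_mono) auto
    moreover have "(A\<^sup>2 * (1 + t) ^ (n - 1))\<^sup>2 = A ^ 4 * (1 + t) ^ (2 * n - 2)"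
      by (simp add: power_mult_distrib power_mult[symmetric] right_diff_distrib' mult.commute)
    ultimately have A4: "A ^ 4 * (1 + t) ^ (2 * n - 2) \<le> C\<^sup>2" by simp
    have "(1 + t) ^ (2 * n - 2) * E t ^ 3 \<le> (1 + t) ^ (2 * n - 2) * (4 * D t * A ^ 4)"
      using N t by (intro mult_left_mono) auto
    also have "\<dots> = 4 * D t * (A ^ 4 * (1 + t) ^ (2 * n - 2))" by simp
    also have "\<dots> \<le> 4 * D t * C\<^sup>2" using A4 D_nonneg[of t] by (intro mult_left_mono) auto
    also have "\<dots> \<le> K * D t" using D_nonneg[of t] by (simp add: K_def algebra_simps)
    finally show ?thesis .
  qed
  have ode: "E' t \<le> - (2 * m / K) * (1 + t) ^ (2 * n - 2) * E t ^ 3" if t: "t > 0" for t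
  proof -
    have "(2 * m / K) * ((1 + t) ^ (2 * n - 2) * E t ^ 3) \<le> (2 * m / K) * (K * D t)"
      using nash[of t] t m K by (intro mult_left_mono) auto
    also have "\<dots> = 2 * m * D t" using K by simp
    finally show ?thesis using diss[OF t] by (simp add: mult.assoc)
  qed
  have "Suc (2 * n - 2) = 2 * n - 1" using n by simp
  then have "(E t)\<^sup>2 * (1 + t) ^ (2 * n - 1)
      \<le> real (2 * n - 1) / (2 * (2 * m / K)) + (E 0)\<^sup>2" if "t \<ge> 0" for t
    using cubic_decay[of E E' "2 * m / K" "2 * n - 2" t] E_nonneg E_DERIV ode m K that by simp
  moreover have "integrable lborel (\<lambda>x. w t x ^ (2 * n))" if "t \<ge> 0" for t
    by (rule entropy_compose(1)[OF ent w_L2[OF that] w_bound[OF that]])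
  ultimately show ?thesis
    unfolding moment_decay_def E_def by (auto simp: power_even_abs)
qed

lemma moment_decay_powers_of_2:
  assumes init: "integrable lborel (w 0)"
  shows "\<exists>C. moment_decay (2 ^ k) C"
proof (induction k)
  case 0
  have "(LINT x|lborel. \<bar>w t x\<bar>)\<^sup>2 \<le> (LINT x|lborel. \<bar>w 0 x\<bar>)\<^sup>2" if "t \<ge> 0" for t
    using L1_contraction(2)[OF init that] by (intro power_mono) auto
  then show ?case
    using L1_contraction(1)[OF init] unfolding moment_decay_def
    by (intro exI[of _ "(LINT x|lborel. \<bar>w 0 x\<bar>)\<^sup>2"]) auto
next
  case (Suc k)
  then show ?case using moment_decay_double[of "2 ^ k"] by auto
qed

lemma moment_decay_powr:
  assumes n: "n \<ge> 1" and C: "moment_decay n C" and t: "t \<ge> 0"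
  shows "(LINT x|lborel. \<bar>w t x\<bar> ^ n) \<le> sqrt \<bar>C\<bar> * (1 + t) powr (- (real n - 1) / 2)"
proof -
  define X where "X = (LINT x|lborel. \<bar>w t x\<bar> ^ n)"
  have X: "X\<^sup>2 * (1 + t) ^ (n - 1) \<le> \<bar>C\<bar>" and X0: "X \<ge> 0"
    using C t by (auto simp: moment_decay_def X_def)
  have p: "(1 + t) ^ (n - 1) = (1 + t) powr (real n - 1)"
    using n t by (simp add: powr_realpow[symmetric] of_nat_diff)
  have "X\<^sup>2 = X\<^sup>2 * (1 + t) ^ (n - 1) * (1 + t) powr (- (real n - 1))"
    unfolding p mult.assoc using t by (simp add: powr_add[symmetric])
  also have "\<dots> \<le> \<bar>C\<bar> * (1 + t) powr (- (real n - 1))"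
    using X by (intro mult_right_mono) auto
  also have "\<dots> = (sqrt \<bar>C\<bar> * (1 + t) powr (- (real n - 1) / 2))\<^sup>2"
  proof -
    have "- (real n - 1) / 2 + - (real n - 1) / 2 = - (real n - 1)" by argo
    then have "((1 + t) powr (- (real n - 1) / 2))\<^sup>2 = (1 + t) powr (- (real n - 1))"
      by (simp only: power2_eq_square powr_add[symmetric])
    then show ?thesis by (simp add: power_mult_distrib)
  qed
  finally show ?thesis unfolding X_def by (rule power2_le_imp_le) simp
qed

text \<open>Splitting \<open>\<bar>w\<bar>\<^sup>q\<close> at the height \<open>(1 + t)\<^bsup>- 1 / 2\<^esup>\<close> interpolates between the moments of order
  one and \<open>N\<close> without loss in the rate.\<close>

lemma Lq_decay:
  assumes init: "integrable lborel (w 0)" and q: "q > 1"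
  shows "\<exists>C>0. \<forall>t\<ge>0. integrable lborel (\<lambda>x. \<bar>w t x\<bar> powr q) \<and>
    (LINT x|lborel. \<bar>w t x\<bar> powr q) powr (1 / q) \<le> C * (1 + t) powr (- (1 / 2) * (1 - 1 / q))"
proof -
  obtain k where k: "q < 2 ^ k" using real_arch_pow[of 2 q] by auto
  define N where "N = (2::nat) ^ k"
  have N: "q < real N" "N \<ge> 1" using k by (auto simp: N_def)
  obtain C where C: "moment_decay N C" using moment_decay_powers_of_2[OF init] unfolding N_def by blast
  define A where "A = (LINT x|lborel. \<bar>w 0 x\<bar>)"
  define B where "B = A + sqrt \<bar>C\<bar> + 1"
  have A: "A \<ge> 0" by (simp add: A_def)
  have B: "B > 0" using A by (simp add: B_def add_nonneg_pos)
  have main: "integrable lborel (\<lambda>x. \<bar>w t x\<bar> powr q) \<and>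
      (LINT x|lborel. \<bar>w t x\<bar> powr q) powr (1 / q) \<le> B powr (1 / q) * (1 + t) powr (- (1 / 2) * (1 - 1 / q))"
    if t: "t \<ge> 0" for t
  proof -
    define l where "l = (1 + t) powr (- 1 / 2)"
    have l: "l > 0" using t by (simp add: l_def)
    have pt: "\<bar>a\<bar> powr q \<le> l powr (q - 1) * \<bar>a\<bar> + l powr (q - real N) * \<bar>a\<bar> ^ N" for a :: real
    proof (cases "a = 0")
      case False
      show ?thesis
      proof (cases "\<bar>a\<bar> \<le> l")
        case True
        have "\<bar>a\<bar> powr q = \<bar>a\<bar> powr (q - 1) * \<bar>a\<bar>" using False by (simp add: powr_diff)
        also have "\<dots> \<le> l powr (q - 1) * \<bar>a\<bar>"
          using True q by (intro mult_right_mono powr_mono2) auto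
        finally show ?thesis by (simp add: add_increasing2)
      next
        case False2: False
        have "\<bar>a\<bar> powr q = \<bar>a\<bar> powr (q - real N) * \<bar>a\<bar> ^ N"
          using False by (simp add: powr_diff powr_realpow)
        also have "\<dots> \<le> l powr (q - real N) * \<bar>a\<bar> ^ N"
          using False2 N l by (intro mult_right_mono powr_mono2') auto
        finally show ?thesis by (simp add: add_increasing)
      qed
    qed (use N in simp)
    have i1: "integrable lborel (\<lambda>x. \<bar>w t x\<bar>)" using L1_contraction(1)[OF init t] by simp
    have iN: "integrable lborel (\<lambda>x. \<bar>w t x\<bar> ^ N)" using C t by (simp add: moment_decay_def)
    have wm[measurable]: "w t \<in> borel_measurable borel" using w_L2[OF t] by (simp add: L2_def)
    have i: "integrable lborel (\<lambda>x. l powr (q - 1) * \<bar>w t x\<bar> + l powr (q - real N) * \<bar>w t x\<bar> ^ N)"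
      using i1 iN by auto
    have iq: "integrable lborel (\<lambda>x. \<bar>w t x\<bar> powr q)"
    proof (rule Bochner_Integration.integrable_bound[OF i])
      show "AE x in lborel. norm (\<bar>w t x\<bar> powr q)
          \<le> norm (l powr (q - 1) * \<bar>w t x\<bar> + l powr (q - real N) * \<bar>w t x\<bar> ^ N)"
        by (intro AE_I2) (use pt in \<open>auto intro: order_trans[OF _ abs_ge_self]\<close>)
    qed measurable
    have "(LINT x|lborel. \<bar>w t x\<bar> powr q)
        \<le> (LINT x|lborel. l powr (q - 1) * \<bar>w t x\<bar> + l powr (q - real N) * \<bar>w t x\<bar> ^ N)"
      by (rule integral_mono[OF iq i pt])
    also have "\<dots> = l powr (q - 1) * (LINT x|lborel. \<bar>w t x\<bar>)
        + l powr (q - real N) * (LINT x|lborel. \<bar>w t x\<bar> ^ N)"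
      using i1 iN by simp
    also have "\<dots> \<le> l powr (q - 1) * A
        + l powr (q - real N) * (sqrt \<bar>C\<bar> * (1 + t) powr (- (real N - 1) / 2))"
      unfolding A_def using L1_contraction(2)[OF init t] moment_decay_powr[OF N(2) C t]
      by (intro add_mono mult_left_mono) auto
    also have "\<dots> = (A + sqrt \<bar>C\<bar>) * (1 + t) powr (- (q - 1) / 2)"
    proof -
      have 1: "l powr (q - 1) = (1 + t) powr (- (q - 1) / 2)"
      proof -
        have "(- 1 / 2) * (q - 1) = - (q - 1) / 2" by argo
        then show ?thesis unfolding l_def powr_powr by (simp only:)
      qed
      have "(- 1 / 2) * (q - real N) + - (real N - 1) / 2 = - (q - 1) / 2" by argo
      then have 2: "l powr (q - real N) * (1 + t) powr (- (real N - 1) / 2) = (1 + t) powr (- (q - 1) / 2)"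
        unfolding l_def powr_powr powr_add[symmetric] by (simp only:)
      have "l powr (q - real N) * (sqrt \<bar>C\<bar> * (1 + t) powr (- (real N - 1) / 2))
          = sqrt \<bar>C\<bar> * (1 + t) powr (- (q - 1) / 2)"
        unfolding 2[symmetric] by (rule mult.left_commute)
      then show ?thesis unfolding 1 by (metis distrib_right mult.commute)
    qed
    also have "\<dots> \<le> B * (1 + t) powr (- (q - 1) / 2)"
      by (intro mult_right_mono) (auto simp: B_def)
    finally have "(LINT x|lborel. \<bar>w t x\<bar> powr q) powr (1 / q)
        \<le> (B * (1 + t) powr (- (q - 1) / 2)) powr (1 / q)"
      using q by (intro powr_mono2) auto
    also have "\<dots> = B powr (1 / q) * (1 + t) powr (- (1 / 2) * (1 - 1 / q))"
    proof -
      have "- (q - 1) / 2 * (1 / q) = - (1 / 2) * (1 - 1 / q)"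
        using q by (simp add: diff_divide_distrib)
      moreover have "(B * (1 + t) powr (- (q - 1) / 2)) powr (1 / q)
          = B powr (1 / q) * (1 + t) powr (- (q - 1) / 2 * (1 / q))"
        by (simp only: powr_mult powr_powr)
      ultimately show ?thesis by (simp only:)
    qed
    finally show ?thesis using iq by simp
  qed
  then show ?thesis using B by (intro exI[of _ "B powr (1 / q)"]) auto
qed

text \<open>Integrating the derivative of \<open>w\<^bsup>n + 1\<^esup>\<close> bounds the supremum by the moment of order \<open>2 n\<close>;
  the rate approaches \<open>1 / 2\<close> as \<open>n\<close> grows.\<close>

lemma sup_decay:
  assumes init: "integrable lborel (w 0)" and e: "e > 0"
  shows "\<exists>C>0. \<forall>t\<ge>0. \<forall>x. \<bar>w t x\<bar> \<le> C * (1 + t) powr (- (1 / 2) + e)"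
proof -
  \<comment> \<open>The rate obtained from \<open>n\<close> misses \<open>1 / 2\<close> by \<open>3 / (4 (n + 1))\<close>, so \<open>n > 1 / e\<close> suffices.\<close>
  obtain k where k: "1 / e < 2 ^ k" using real_arch_pow[of 2 "1 / e"] by auto
  define n where "n = (2::nat) ^ k"
  have n1: "n \<ge> 1" by (simp add: n_def)
  have ne: "1 < e * real n" using k e by (simp add: n_def field_simps)
  obtain C where C: "moment_decay (2 ^ Suc k) C" using moment_decay_powers_of_2[OF init] by blast
  have C: "moment_decay (2 * n) C" using C by (simp add: n_def)
  define B where "B = real (n + 1) * sqrt (sqrt \<bar>C\<bar>) * M + 1"
  have B: "B > 0" using M_nonneg by (simp add: B_def add_nonneg_pos)
  have "\<bar>w t x\<bar> \<le> B powr (1 / real (n + 1)) * (1 + t) powr (- (1 / 2) + e)" if t: "t \<ge> 0" for t x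
  proof -
    define E where "E = (LINT x|lborel. \<bar>w t x\<bar> ^ (2 * n))"
    have E0: "E \<ge> 0" by (simp add: E_def)
    have EE: "(nrm (\<lambda>x. w t x ^ n))\<^sup>2 = E"
      by (simp add: nrm_square E_def power_mult[symmetric] mult.commute power_even_abs)
    have nE: "nrm (\<lambda>x. w t x ^ n) = sqrt E"
      unfolding EE[symmetric] by simp
    have gi: "integrable lborel (\<lambda>x. w t x ^ n * wx t x)"
      by (rule L2_mult_integrable[OF w_power_L2[OF n1 t] wx_L2[OF t]])
    have "\<bar>w t x ^ (n + 1)\<bar> \<le> (LINT s|lborel. \<bar>real (n + 1) * w t s ^ (n + 1 - 1) * wx t s\<bar>)"
    proof (rule abs_le_integral_abs_deriv[OF w_power_primitive[OF t]])
      show "integrable lborel (\<lambda>x. w t x ^ (n + 1))"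
        using L2_mult_integrable[OF w_power_L2[OF n1 t] w_L2[OF t]] by (simp add: mult.commute)
      show "integrable lborel (\<lambda>x. real (n + 1) * w t x ^ (n + 1 - 1) * wx t x)"
        using gi by (simp add: mult.assoc)
    qed
    also have "\<dots> = real (n + 1) * (LINT s|lborel. \<bar>w t s ^ n * wx t s\<bar>)"
      by (subst integral_mult_right_zero[symmetric]) (simp add: abs_mult mult.assoc)
    also have "\<dots> \<le> real (n + 1) * (sqrt E * M)"
    proof (intro mult_left_mono)
      have "(LINT s|lborel. \<bar>w t s ^ n * wx t s\<bar>) \<le> nrm (\<lambda>x. w t x ^ n) * nrm (wx t)"
        by (rule cauchy_schwarz[OF w_power_L2[OF n1 t] wx_L2[OF t]])
      also have "\<dots> \<le> sqrt E * M" unfolding nE using wx_nrm[OF t] E0 by (intro mult_left_mono) auto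
      finally show "(LINT s|lborel. \<bar>w t s ^ n * wx t s\<bar>) \<le> sqrt E * M" .
    qed simp
    also have "\<dots> \<le> real (n + 1) * ((sqrt (sqrt \<bar>C\<bar>) * (1 + t) powr (- (2 * real n - 1) / 4)) * M)"
    proof (intro mult_left_mono mult_right_mono)
      have "E \<le> sqrt \<bar>C\<bar> * (1 + t) powr (- (real (2 * n) - 1) / 2)"
        unfolding E_def by (rule moment_decay_powr[OF _ C t]) (use n1 in simp)
      then have "sqrt E \<le> sqrt (sqrt \<bar>C\<bar> * (1 + t) powr (- (real (2 * n) - 1) / 2))" by simp
      also have "\<dots> = sqrt (sqrt \<bar>C\<bar>) * (1 + t) powr (- (2 * real n - 1) / 4)"
        using t by (simp add: real_sqrt_mult powr_half_sqrt[symmetric] powr_powr)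
      finally show "sqrt E \<le> sqrt (sqrt \<bar>C\<bar>) * (1 + t) powr (- (2 * real n - 1) / 4)" .
    qed (use M_nonneg in auto)
    also have "\<dots> = (real (n + 1) * sqrt (sqrt \<bar>C\<bar>) * M) * (1 + t) powr (- (2 * real n - 1) / 4)"
      by simp
    also have "\<dots> \<le> B * (1 + t) powr (- (2 * real n - 1) / 4)"
      by (intro mult_right_mono) (auto simp: B_def)
    finally have "\<bar>w t x\<bar> ^ (n + 1) \<le> B * (1 + t) powr (- (2 * real n - 1) / 4)"
      by (simp only: power_abs)
    also have "\<dots> \<le> B * (1 + t) powr ((- (1 / 2) + e) * real (n + 1))"
    proof (intro mult_left_mono powr_mono)
      show "- (2 * real n - 1) / 4 \<le> (- (1 / 2) + e) * real (n + 1)"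
        using ne e by (simp add: field_simps)
    qed (use t B in auto)
    also have "\<dots> = (B powr (1 / real (n + 1)) * (1 + t) powr (- (1 / 2) + e)) ^ (n + 1)"
    proof -
      have "(B powr (1 / real (n + 1))) ^ (n + 1) = B"
        using B by (subst powr_power) auto
      moreover have "((1 + t) powr (- (1 / 2) + e)) ^ (n + 1) = (1 + t) powr ((- (1 / 2) + e) * real (n + 1))"
        using t by (subst powr_power) (auto simp: mult.commute)
      ultimately show ?thesis by (simp only: power_mult_distrib)
    qed
    finally show ?thesis unfolding Suc_eq_plus1[symmetric] by (rule power_le_imp_le_base) simp
  qed
  then show ?thesis using B by (intro exI[of _ "B powr (1 / real (n + 1))"]) auto
qed

end

section \<open>The decay theorem\<close>

lemma Lp_cong_AE:
  assumes "v \<in> borel_measurable borel" "w \<in> borel_measurable borel" "AE x in lborel. v x = w x"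
    and "integrable lborel (\<lambda>x. \<bar>w x\<bar> powr q)"
  shows "in_Lp q v" "Lp_norm q v = (LINT x|lborel. \<bar>w x\<bar> powr q) powr (1 / q)"
proof -
  note assms(1,2)[measurable]
  have ae: "AE x in lborel. \<bar>w x\<bar> powr q = \<bar>v x\<bar> powr q"
    using assms(3) by eventually_elim simp
  have "integrable lborel (\<lambda>x. \<bar>v x\<bar> powr q)"
    by (rule integrable_cong_AE_imp[OF assms(4) _ ae]) measurable
  then show "in_Lp q v" using assms(1) by (simp add: in_Lp_def)
  have "(LINT x|lborel. \<bar>v x\<bar> powr q) = (LINT x|lborel. \<bar>w x\<bar> powr q)"
  proof (rule integral_cong_AE)
    show "AE x in lborel. \<bar>v x\<bar> powr q = \<bar>w x\<bar> powr q"
      using assms(3) by eventually_elim simp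
  qed measurable
  then show "Lp_norm q v = (LINT x|lborel. \<bar>w x\<bar> powr q) powr (1 / q)"
    by (simp add: Lp_norm_def)
qed

lemma global_solution_borel:
  assumes "global_solution f \<sigma> c u0 u" "t \<ge> 0"
  shows "(\<lambda>x. u t x - c) \<in> borel_measurable borel"
proof -
  have "C0_time 2 (\<lambda>t x. u t x - c)"
    using assms(1) by (auto simp: global_solution_def solution_class_def)
  then show ?thesis using assms(2) by (intro in_Hk_borel[of 2]) (auto simp: C0_time_def)
qed

lemma global_solution_initial:
  "global_solution f \<sigma> c u0 u \<Longrightarrow> AE x in lborel. u 0 x = u0 x"
  by (auto simp: global_solution_def cauchy_problem_def)

text \<open>By uniqueness, bounds for one solution hold for all solutions with the same data; this is what
  allows the constants to precede the solution in the theorem.\<close>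

lemma (in parabolic_law) global_solution_eq_classical:
  assumes w: "classical_solution f \<sigma> c M w wx wt"
    and w0: "AE x in lborel. u0 x - c = w 0 x"
    and u: "global_solution f \<sigma> c u0 u" and t: "t \<ge> 0"
  shows "AE x in lborel. u t x - c = w t x"
proof -
  obtain N v vx vt where v: "classical_solution f \<sigma> c N v vx vt"
    and uv: "\<And>t. t \<ge> 0 \<Longrightarrow> AE x in lborel. u t x - c = v t x"
    using global_solution_imp_classical[OF u] by metis
  have "AE x in lborel. v 0 x = w 0 x"
    using uv[OF order_refl] w0 global_solution_initial[OF u] by eventually_elim simp
  then have "v t x = w t x" for x
    using classical_solution_unique[of "max M N" v vx vt w wx wt, OF _ _ _ t]
      classical_solution_mono[OF v] classical_solution_mono[OF w] by simp
  then show ?thesis using uv[OF t] by simp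
qed

theorem theorem1p3:
  fixes p c :: real and f \<sigma> u0 :: "real \<Rightarrow> real"
  assumes "p > 1 / 3"
    and "Ck 3 f" and "Ck 2 \<sigma>"
    and "\<sigma> 0 = 0" and "\<And>v. deriv \<sigma> v > 0"
    and "same_order (\<lambda>v. \<bar>\<sigma> v\<bar>) (\<lambda>v. \<bar>v\<bar> powr p)"
    and "same_order (\<lambda>v. \<bar>deriv \<sigma> v\<bar>) (\<lambda>v. \<bar>v\<bar> powr (p - 1))"
    and "in_Hk 2 (\<lambda>x. u0 x - c)" and "in_Lp 1 (\<lambda>x. u0 x - c)"
  shows
    "(\<exists>C>0. \<forall>u. global_solution f \<sigma> c u0 u \<longrightarrow> (\<forall>t\<ge>0.
        in_Lp 1 (\<lambda>x. u t x - c) \<and>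
        Lp_norm 1 (\<lambda>x. u t x - c) \<le> C * max 1 (ln (1 + t)))) \<and>
     (\<forall>q>1. \<exists>C>0. \<forall>u. global_solution f \<sigma> c u0 u \<longrightarrow> (\<forall>t\<ge>0.
        in_Lp q (\<lambda>x. u t x - c) \<and>
        Lp_norm q (\<lambda>x. u t x - c)
          \<le> C * (1 + t) powr (- (1 / 2) * (1 - 1 / q)) * max 1 (ln (1 + t)))) \<and>
     (\<forall>\<epsilon>>0. \<exists>C>0. \<forall>u. global_solution f \<sigma> c u0 u \<longrightarrow> (\<forall>t\<ge>0.
        Linf_norm (\<lambda>x. u t x - c) \<le> ereal (C * (1 + t) powr (- (1 / 2) + \<epsilon>))))"
proof (cases "\<exists>u. global_solution f \<sigma> c u0 u")
  case False
  then have none: "\<not> global_solution f \<sigma> c u0 u" for u by simp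
  have "(1::real) > 0" by simp
  with none show ?thesis by blast
next
  case True
  then obtain u' where u': "global_solution f \<sigma> c u0 u'" ..
  have "Ck (Suc (Suc 1)) f" "Ck (Suc 1) \<sigma>"
    using \<open>Ck 3 f\<close> \<open>Ck 2 \<sigma>\<close> by (simp_all add: numeral_2_eq_2 numeral_3_eq_3)
  then have "Ck 1 f" "Ck 1 \<sigma>" by (blast dest: Ck_Suc_imp_Ck)+
  then interpret parabolic_law f \<sigma> c
    using assms(4,5) by unfold_locales
  obtain M w wx wt where w: "classical_solution f \<sigma> c M w wx wt"
    and u'w: "\<And>t. t \<ge> 0 \<Longrightarrow> AE x in lborel. u' t x - c = w t x"
    using global_solution_imp_classical[OF u'] by metis
  interpret classical_solution f \<sigma> c M w wx wt by (rule w)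
  have w0: "AE x in lborel. u0 x - c = w 0 x"
    using u'w[OF order_refl] global_solution_initial[OF u'] by eventually_elim simp
  have w_borel: "w t \<in> borel_measurable borel" if "t \<ge> 0" for t
    using w_L2[OF that] by (rule L2_borel)
  have init: "integrable lborel (w 0)"
  proof (rule integrable_cong_AE_imp)
    have "integrable lborel (\<lambda>x. \<bar>u0 x - c\<bar>)" "(\<lambda>x. u0 x - c) \<in> borel_measurable lborel"
      using \<open>in_Lp 1 (\<lambda>x. u0 x - c)\<close> by (auto simp: in_Lp_def)
    then show "integrable lborel (\<lambda>x. u0 x - c)" by (simp add: integrable_abs_iff)
  qed (use w0 w_borel in auto)
  note eq = global_solution_eq_classical[OF w w0] and borel = global_solution_borel
  have log: "a \<le> a * max 1 (ln (1 + t))" if "a \<ge> 0" for a t :: real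
    using mult_left_mono[of 1 "max 1 (ln (1 + t))" a] that by simp
  show ?thesis
  proof (intro conjI allI impI)
    define C where "C = (LINT x|lborel. \<bar>w 0 x\<bar>) + 1"
    have C: "C > 0" by (simp add: C_def add_nonneg_pos)
    have "in_Lp 1 (\<lambda>x. u t x - c) \<and> Lp_norm 1 (\<lambda>x. u t x - c) \<le> C * max 1 (ln (1 + t))"
      if u: "global_solution f \<sigma> c u0 u" and t: "t \<ge> 0" for u t
    proof -
      note L = L1_contraction[OF init t]
      have i: "integrable lborel (\<lambda>x. \<bar>w t x\<bar> powr 1)" using L(1) by simp
      note T = Lp_cong_AE[OF borel[OF u t] w_borel[OF t] eq[OF u t] i]
      have "Lp_norm 1 (\<lambda>x. u t x - c) = (LINT x|lborel. \<bar>w t x\<bar>)" using T(2) by simp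
      also have "\<dots> \<le> C" using L(2) by (simp add: C_def)
      also have "\<dots> \<le> C * max 1 (ln (1 + t))" using C by (intro log) simp
      finally show ?thesis using T(1) by simp
    qed
    with C show "\<exists>C>0. \<forall>u. global_solution f \<sigma> c u0 u \<longrightarrow> (\<forall>t\<ge>0. in_Lp 1 (\<lambda>x. u t x - c) \<and>
        Lp_norm 1 (\<lambda>x. u t x - c) \<le> C * max 1 (ln (1 + t)))" by blast
  next
    fix q :: real assume q: "q > 1"
    obtain C where C: "C > 0" "\<And>t. t \<ge> 0 \<Longrightarrow> integrable lborel (\<lambda>x. \<bar>w t x\<bar> powr q)"
      "\<And>t. t \<ge> 0 \<Longrightarrow> (LINT x|lborel. \<bar>w t x\<bar> powr q) powr (1 / q)
          \<le> C * (1 + t) powr (- (1 / 2) * (1 - 1 / q))"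
      using Lq_decay[OF init q] by blast
    have "in_Lp q (\<lambda>x. u t x - c) \<and> Lp_norm q (\<lambda>x. u t x - c)
        \<le> C * (1 + t) powr (- (1 / 2) * (1 - 1 / q)) * max 1 (ln (1 + t))"
      if u: "global_solution f \<sigma> c u0 u" and t: "t \<ge> 0" for u t
    proof -
      note T = Lp_cong_AE[OF borel[OF u t] w_borel[OF t] eq[OF u t] C(2)[OF t]]
      have "Lp_norm q (\<lambda>x. u t x - c) \<le> C * (1 + t) powr (- (1 / 2) * (1 - 1 / q))"
        unfolding T(2) by (rule C(3)[OF t])
      also have "\<dots> \<le> C * (1 + t) powr (- (1 / 2) * (1 - 1 / q)) * max 1 (ln (1 + t))"
        using C(1) by (intro log) simp
      finally show ?thesis using T(1) by simp
    qed
    with C(1) show "\<exists>C>0. \<forall>u. global_solution f \<sigma> c u0 u \<longrightarrow> (\<forall>t\<ge>0. in_Lp q (\<lambda>x. u t x - c) \<and>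
        Lp_norm q (\<lambda>x. u t x - c)
          \<le> C * (1 + t) powr (- (1 / 2) * (1 - 1 / q)) * max 1 (ln (1 + t)))" by blast
  next
    fix \<epsilon> :: real assume e: "\<epsilon> > 0"
    obtain C where C: "C > 0" "\<And>t x. t \<ge> 0 \<Longrightarrow> \<bar>w t x\<bar> \<le> C * (1 + t) powr (- (1 / 2) + \<epsilon>)"
      using sup_decay[OF init e] by blast
    have "Linf_norm (\<lambda>x. u t x - c) \<le> ereal (C * (1 + t) powr (- (1 / 2) + \<epsilon>))"
      if u: "global_solution f \<sigma> c u0 u" and t: "t \<ge> 0" for u t
      unfolding Linf_norm_def
    proof (rule esssup_I)
      show "(\<lambda>x. ereal \<bar>u t x - c\<bar>) \<in> borel_measurable lborel" using borel[OF u t] by simp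
      show "AE x in lborel. ereal \<bar>u t x - c\<bar> \<le> ereal (C * (1 + t) powr (- (1 / 2) + \<epsilon>))"
        using eq[OF u t] by eventually_elim (use C(2)[OF t] in simp)
    qed
    with C(1) show "\<exists>C>0. \<forall>u. global_solution f \<sigma> c u0 u \<longrightarrow> (\<forall>t\<ge>0.
        Linf_norm (\<lambda>x. u t x - c) \<le> ereal (C * (1 + t) powr (- (1 / 2) + \<epsilon>)))" by blast
  qed
qed

end
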